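(* Let $T>0$. Suppose that $g\in C_c^2(\mathbb{R}_+)$ and $$M:=\sup_{s\ge0}|g''(s)|<\infty.$$ (a) Then there exists a constant $c_3=c_3(\mu,\sigma,r,T)\in\mathbb{R}_+$ such that for any $m>m_0$, $t_k\in[0,T]$, and any value $x=S_m(t_k)$ we have $$\left|a_m(t_k,x)-\partial_xf_m(t_{k+1},x)\right|\le c_3Mx\,2^{-m},$$ $$\left|b_m(t_k,x)-r_m^{-k-1}\left(f_m(t_{k+1},u_mx)-u_mx\,\partial_xf_m(t_{k+1},x)\right)\right|\le c_3M(1+\sigma2^{-m}+|\mu|2^{-2m})x^2\,2^{-m}.$$ (b) Moreover, using the notation $t^{(m)}=\lfloor t2^{2m}\rfloor2^{-2m}$, almost surely $$\lim_{m\to\infty}\sup_{0\le t\le T}|a_m(t^{(m)})-a(t)|=0,\qquad\lim_{m\to\infty}\sup_{0\le t\le T}|b_m(t^{(m)})-b(t)|=0,$$ where $(a(t),b(t))$ is the replicating portfolio of the Black--Scholes model.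
   Context: $\mathbb{R}_+=[0,\infty)$; $C^2_c(\mathbb{R}_+)$ denotes twice continuously differentiable functions on $\mathbb{R}_+$ with compact support. Fixed parameters: $\mu\in\mathbb{R}$, $\sigma>0$, $r>0$, $s_0>0$; $m$ is a nonnegative integer. Random walks $B_m$ and Brownian motion $B$ (``twist and shrink''). Let $X_m(k)$ ($m\ge0$, $k\ge1$) be i.i.d. with $\mathbb{P}(X_m(k)=\pm1)=\frac12$ on a complete probability space $(\Omega,\mathcal F,\mathbb{P})$, and let $Y_m(n)=\sum_{k=1}^nX_m(k)$, $Y_m(0)=0$. For $m\ge1$ let $T_m(0)=0$, $T_m(k+1)=\min\{n>T_m(k):|Y_m(n)-Y_m(T_m(k))|=2\}$. Put $\widetilde X_0=X_0$, and recursively for $m\ge1$ and $T_m(k)<n\le T_m(k+1)$ put $\widetilde X_m(n)=X_m(n)$ if $Y_m(T_m(k+1))-Y_m(T_m(k))=2\widetilde X_{m-1}(k+1)$, and $\widetilde X_m(n)=-X_m(n)$ otherwise. Let $\widetilde Y_m(n)=\sum_{j\le n}\widetilde X_m(j)$, extended to real times by linear interpolation, and $B_m(t)=2^{-m}\widetilde Y_m(t2^{2m})$. It is known that each $\widetilde Y_m$ is a simple symmetric random walk and that $B_m$ converges a.s., uniformly on bounded intervals, to a Brownian motion $B$. Discrete model. $\Delta t=2^{-2m}$, $t_k=k\Delta t$, $N=\lfloor T2^{2m}\rfloor$, $r_m=1+r2^{-2m}$, $u_m=1+\sigma2^{-m}+\mu2^{-2m}$, $d_m=1-\sigma2^{-m}+\mu2^{-2m}$,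 $q_m^\pm=\frac12\pm\frac12\frac{r-\mu}{\sigma}2^{-m}$, $m_0=\frac1{\log2}\log\frac{|r-\mu|}{\sigma}$ (so $0<q_m^+<1$ for $m>m_0$). The stock price is $S_m(0)=s_0$, $S_m(t_{k+1})=S_m(t_k)\{1+\mu\Delta t+\sigma(B_m(t_{k+1})-B_m(t_k))\}$; thus the possible values of $S_m(t_k)$ are $s_0u_m^id_m^{k-i}$, $0\le i\le k$. The price of the claim $g$ with maturity $T$ is $$f_m(t_k,x)=r_m^{k-N}\sum_{i=0}^{N-k}\binom{N-k}{i}(q_m^+)^i(q_m^-)^{N-k-i}g(xu_m^id_m^{N-k-i}).$$ The discrete replicating portfolio (numbers of shares and of bonds held on $[t_k,t_{k+1})$) is $$a_m(t_k,x)=\frac{f_m(t_{k+1},u_mx)-f_m(t_{k+1},d_mx)}{(u_m-d_m)x},\qquad b_m(t_k,x)=r_m^{-k-1}\left(f_m(t_{k+1},u_mx)-a_m(t_k,x)u_mx\right),$$ and $a_m(t_k):=a_m(t_k,S_m(t_k))$, $b_m(t_k):=b_m(t_k,S_m(t_k))$. Black--Scholes model. $S(t)=s_0\exp((\mu-\sigma^2/2)t+\sigma B(t))$; $f(t,x)=e^{-r(T-t)}\mathbb{E}[g(xe^{(r-\sigma^2/2)(T-t)+\sigma W(T-t)})]$ with $W$ a standard Brownian motion; $a(t)=\partial_xf(t,S(t))$, $b(t)=e^{-rt}\{f(t,S(t))-S(t)\partial_xf(t,S(t))\}$.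
   Formalization: Part (a) is stated for d_m ≥ 0 and x > 0 only, since otherwise g is evaluated at negative numbers or a_m divides by zero; f_m(t_{N+1},x), needed at t_k = t_N, is taken to be g(x). *)

theory Defs
  imports "HOL-Probability.Probability"
begin

section \<open>Random walks and Brownian motion\<close>

text \<open>The index \<open>0\<close> of \<open>X m\<close> is not used: the variables of interest are \<open>X m k\<close> with \<open>k \<ge> 1\<close>.\<close>

definition iid_signs :: "'a measure \<Rightarrow> (nat \<Rightarrow> nat \<Rightarrow> 'a \<Rightarrow> real) \<Rightarrow> bool" where
  "iid_signs \<Omega> X \<longleftrightarrow>
     prob_space.indep_vars \<Omega> (\<lambda>_. borel) (\<lambda>(m, k). X m k) (UNIV \<times> {1..}) \<and>
     (\<forall>m. \<forall>k\<ge>1. measure \<Omega> {\<omega> \<in> space \<Omega>. X m k \<omega> = 1} = 1/2 \<and>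
                  measure \<Omega> {\<omega> \<in> space \<Omega>. X m k \<omega> = -1} = 1/2)"

text \<open>The ``twist and shrink'' construction is pathwise, so it is defined for an array
  \<open>x m k\<close> of numbers, to be instantiated with \<open>X m k \<omega>\<close>. The minimum in the stopping
  times and the index \<open>k\<close> with \<open>T\<^sub>m(k) < n \<le> T\<^sub>m(k+1)\<close> exist for almost every path only;
  on the remaining null set \<open>LEAST\<close> and \<open>THE\<close> return unspecified values.\<close>

definition walk :: "(nat \<Rightarrow> nat \<Rightarrow> real) \<Rightarrow> nat \<Rightarrow> nat \<Rightarrow> real" where
  "walk x m n = (\<Sum>k=1..n. x m k)"

primrec stop_time :: "(nat \<Rightarrow> nat \<Rightarrow> real) \<Rightarrow> nat \<Rightarrow> nat \<Rightarrow> nat" where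
  "stop_time x m 0 = 0"
| "stop_time x m (Suc k) =
     (LEAST n. n > stop_time x m k \<and> \<bar>walk x m n - walk x m (stop_time x m k)\<bar> = 2)"

primrec twisted_step :: "(nat \<Rightarrow> nat \<Rightarrow> real) \<Rightarrow> nat \<Rightarrow> nat \<Rightarrow> real" where
  "twisted_step x 0 n = x 0 n"
| "twisted_step x (Suc m) n =
     (let k = (THE k. stop_time x (Suc m) k < n \<and> n \<le> stop_time x (Suc m) (k + 1)) in
      if walk x (Suc m) (stop_time x (Suc m) (k + 1)) - walk x (Suc m) (stop_time x (Suc m) k)
           = 2 * twisted_step x m (k + 1)
      then x (Suc m) n else - x (Suc m) n)"

definition twisted_walk :: "(nat \<Rightarrow> nat \<Rightarrow> real) \<Rightarrow> nat \<Rightarrow> nat \<Rightarrow> real" where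
  "twisted_walk x m n = (\<Sum>j=1..n. twisted_step x m j)"

definition twisted_walk_interp :: "(nat \<Rightarrow> nat \<Rightarrow> real) \<Rightarrow> nat \<Rightarrow> real \<Rightarrow> real" where
  "twisted_walk_interp x m s =
     (let n = nat \<lfloor>s\<rfloor> in
      twisted_walk x m n + (s - real n) * (twisted_walk x m (n + 1) - twisted_walk x m n))"

definition BM_approx :: "(nat \<Rightarrow> nat \<Rightarrow> real) \<Rightarrow> nat \<Rightarrow> real \<Rightarrow> real" where
  "BM_approx x m t = twisted_walk_interp x m (t * 2^(2*m)) / 2^m"

definition BM_limit ::
  "'a measure \<Rightarrow> (nat \<Rightarrow> nat \<Rightarrow> 'a \<Rightarrow> real) \<Rightarrow> (real \<Rightarrow> 'a \<Rightarrow> real) \<Rightarrow> bool" where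
  "BM_limit \<Omega> X B \<longleftrightarrow>
     (AE \<omega> in \<Omega>. \<forall>K\<ge>0. uniform_limit {0..K}
        (\<lambda>m t. BM_approx (\<lambda>m k. X m k \<omega>) m t) (\<lambda>t. B t \<omega>) sequentially)"

definition standard_BM :: "'b measure \<Rightarrow> (real \<Rightarrow> 'b \<Rightarrow> real) \<Rightarrow> bool" where
  "standard_BM \<Omega> W \<longleftrightarrow>
     prob_space \<Omega> \<and>
     (\<forall>t\<ge>0. W t \<in> borel_measurable \<Omega>) \<and>
     (AE \<omega> in \<Omega>. W 0 \<omega> = 0) \<and>
     (\<forall>(n::nat) (\<tau> :: nat \<Rightarrow> real). 0 \<le> \<tau> 0 \<and> (\<forall>i<n. \<tau> i < \<tau> (Suc i)) \<longrightarrow>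
        prob_space.indep_vars \<Omega> (\<lambda>_. borel) (\<lambda>i \<omega>. W (\<tau> (Suc i)) \<omega> - W (\<tau> i) \<omega>) {..<n}) \<and>
     (\<forall>s t. 0 \<le> s \<and> s < t \<longrightarrow>
        distributed \<Omega> lborel (\<lambda>\<omega>. W t \<omega> - W s \<omega>) (normal_density 0 (sqrt (t - s)))) \<and>
     (AE \<omega> in \<Omega>. continuous_on {0..} (\<lambda>t. W t \<omega>))"


section \<open>Payoffs\<close>

text \<open>Payoffs are functions on \<open>[0, \<infinity>)\<close>, represented by total functions whose values at
  negative arguments are irrelevant. The derivative is one-sided at \<open>0\<close>.\<close>

definition D_plus :: "(real \<Rightarrow> real) \<Rightarrow> real \<Rightarrow> real" where
  "D_plus g s = vector_derivative g (at s within {0..})"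

definition C2c_plus :: "(real \<Rightarrow> real) \<Rightarrow> bool" where
  "C2c_plus g \<longleftrightarrow>
     g differentiable_on {0..} \<and>
     D_plus g differentiable_on {0..} \<and>
     continuous_on {0..} (D_plus (D_plus g)) \<and>
     compact (closure {s \<in> {0..}. g s \<noteq> 0})"


section \<open>Discrete model\<close>

definition grid_time :: "nat \<Rightarrow> nat \<Rightarrow> real" where
  "grid_time m k = real k / 2^(2*m)"

definition num_steps :: "real \<Rightarrow> nat \<Rightarrow> nat" where
  "num_steps T m = nat \<lfloor>T * 2^(2*m)\<rfloor>"

definition bond_factor :: "real \<Rightarrow> nat \<Rightarrow> real" where
  "bond_factor r m = 1 + r / 2^(2*m)"

definition up_factor :: "real \<Rightarrow> real \<Rightarrow> nat \<Rightarrow> real" where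
  "up_factor \<mu> \<sigma> m = 1 + \<sigma> / 2^m + \<mu> / 2^(2*m)"

definition down_factor :: "real \<Rightarrow> real \<Rightarrow> nat \<Rightarrow> real" where
  "down_factor \<mu> \<sigma> m = 1 - \<sigma> / 2^m + \<mu> / 2^(2*m)"

definition q_plus :: "real \<Rightarrow> real \<Rightarrow> real \<Rightarrow> nat \<Rightarrow> real" where
  "q_plus \<mu> \<sigma> r m = 1/2 + 1/2 * ((r - \<mu>) / \<sigma>) / 2^m"

definition q_minus :: "real \<Rightarrow> real \<Rightarrow> real \<Rightarrow> nat \<Rightarrow> real" where
  "q_minus \<mu> \<sigma> r m = 1/2 - 1/2 * ((r - \<mu>) / \<sigma>) / 2^m"

text \<open>For \<open>r = \<mu>\<close> the logarithm is read as \<open>-\<infinity>\<close>, whereas \<open>ln 0 = 0\<close> in the library.\<close>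

definition m_zero :: "real \<Rightarrow> real \<Rightarrow> real \<Rightarrow> ereal" where
  "m_zero \<mu> \<sigma> r = (if r = \<mu> then -\<infinity> else ereal (1 / ln 2 * ln (\<bar>r - \<mu>\<bar> / \<sigma>)))"

primrec disc_stock ::
  "real \<Rightarrow> real \<Rightarrow> real \<Rightarrow> (nat \<Rightarrow> nat \<Rightarrow> real) \<Rightarrow> nat \<Rightarrow> nat \<Rightarrow> real" where
  "disc_stock s0 \<mu> \<sigma> x m 0 = s0"
| "disc_stock s0 \<mu> \<sigma> x m (Suc k) = disc_stock s0 \<mu> \<sigma> x m k *
     (1 + \<mu> / 2^(2*m) +
      \<sigma> * (BM_approx x m (grid_time m (Suc k)) - BM_approx x m (grid_time m k)))"

definition stock_values :: "real \<Rightarrow> real \<Rightarrow> real \<Rightarrow> nat \<Rightarrow> nat \<Rightarrow> real set" where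
  "stock_values s0 \<mu> \<sigma> m k =
     {s0 * up_factor \<mu> \<sigma> m ^ i * down_factor \<mu> \<sigma> m ^ (k - i) | i. i \<le> k}"

text \<open>In \<open>disc_price\<close> the difference \<open>num_steps T m - k\<close> is truncated: after maturity, for
  \<open>k > num_steps T m\<close>, the price is the payoff \<open>g x\<close>. This matters only for the
  portfolio at \<open>k = num_steps T m\<close>, which refers to the price at \<open>k + 1\<close>.\<close>

definition disc_price ::
  "real \<Rightarrow> real \<Rightarrow> real \<Rightarrow> real \<Rightarrow> (real \<Rightarrow> real) \<Rightarrow> nat \<Rightarrow> nat \<Rightarrow> real \<Rightarrow> real" where
  "disc_price \<mu> \<sigma> r T g m k x =
     (let n = num_steps T m - k in
      bond_factor r m powi (- int n) *
      (\<Sum>i=0..n. real (n choose i) * q_plus \<mu> \<sigma> r m ^ i * q_minus \<mu> \<sigma> r m ^ (n - i) *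
                 g (x * up_factor \<mu> \<sigma> m ^ i * down_factor \<mu> \<sigma> m ^ (n - i))))"

definition disc_shares ::
  "real \<Rightarrow> real \<Rightarrow> real \<Rightarrow> real \<Rightarrow> (real \<Rightarrow> real) \<Rightarrow> nat \<Rightarrow> nat \<Rightarrow> real \<Rightarrow> real" where
  "disc_shares \<mu> \<sigma> r T g m k x =
     (disc_price \<mu> \<sigma> r T g m (k + 1) (up_factor \<mu> \<sigma> m * x)
      - disc_price \<mu> \<sigma> r T g m (k + 1) (down_factor \<mu> \<sigma> m * x))
     / ((up_factor \<mu> \<sigma> m - down_factor \<mu> \<sigma> m) * x)"

definition disc_bonds ::
  "real \<Rightarrow> real \<Rightarrow> real \<Rightarrow> real \<Rightarrow> (real \<Rightarrow> real) \<Rightarrow> nat \<Rightarrow> nat \<Rightarrow> real \<Rightarrow> real" where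
  "disc_bonds \<mu> \<sigma> r T g m k x =
     bond_factor r m powi (- int k - 1) *
     (disc_price \<mu> \<sigma> r T g m (k + 1) (up_factor \<mu> \<sigma> m * x)
      - disc_shares \<mu> \<sigma> r T g m k x * up_factor \<mu> \<sigma> m * x)"

definition disc_shares_path ::
  "real \<Rightarrow> real \<Rightarrow> real \<Rightarrow> real \<Rightarrow> real \<Rightarrow> (real \<Rightarrow> real) \<Rightarrow> (nat \<Rightarrow> nat \<Rightarrow> real) \<Rightarrow> nat \<Rightarrow> nat \<Rightarrow> real"
  where
  "disc_shares_path s0 \<mu> \<sigma> r T g x m k = disc_shares \<mu> \<sigma> r T g m k (disc_stock s0 \<mu> \<sigma> x m k)"

definition disc_bonds_path ::
  "real \<Rightarrow> real \<Rightarrow> real \<Rightarrow> real \<Rightarrow> real \<Rightarrow> (real \<Rightarrow> real) \<Rightarrow> (nat \<Rightarrow> nat \<Rightarrow> real) \<Rightarrow> nat \<Rightarrow> nat \<Rightarrow> real"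
  where
  "disc_bonds_path s0 \<mu> \<sigma> r T g x m k = disc_bonds \<mu> \<sigma> r T g m k (disc_stock s0 \<mu> \<sigma> x m k)"

text \<open>The index \<open>k\<close> with \<open>grid_time m k = \<lfloor>t 2\<^sup>2\<^sup>m\<rfloor> 2\<^sup>-\<^sup>2\<^sup>m\<close>.\<close>

definition grid_index :: "nat \<Rightarrow> real \<Rightarrow> nat" where
  "grid_index m t = nat \<lfloor>t * 2^(2*m)\<rfloor>"


section \<open>Black--Scholes model\<close>

definition BS_stock :: "real \<Rightarrow> real \<Rightarrow> real \<Rightarrow> (real \<Rightarrow> real) \<Rightarrow> real \<Rightarrow> real" where
  "BS_stock s0 \<mu> \<sigma> \<beta> t = s0 * exp ((\<mu> - \<sigma>\<^sup>2 / 2) * t + \<sigma> * \<beta> t)"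

definition BS_price ::
  "'b measure \<Rightarrow> (real \<Rightarrow> 'b \<Rightarrow> real) \<Rightarrow> real \<Rightarrow> real \<Rightarrow> real \<Rightarrow> (real \<Rightarrow> real) \<Rightarrow> real \<Rightarrow> real \<Rightarrow> real"
  where
  "BS_price \<Omega> W \<sigma> r T g t x = exp (- r * (T - t)) *
     prob_space.expectation \<Omega>
       (\<lambda>\<omega>. g (x * exp ((r - \<sigma>\<^sup>2 / 2) * (T - t) + \<sigma> * W (T - t) \<omega>)))"

definition BS_shares ::
  "'b measure \<Rightarrow> (real \<Rightarrow> 'b \<Rightarrow> real) \<Rightarrow> real \<Rightarrow> real \<Rightarrow> real \<Rightarrow> real \<Rightarrow> real \<Rightarrow> (real \<Rightarrow> real) \<Rightarrow>
   (real \<Rightarrow> real) \<Rightarrow> real \<Rightarrow> real"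
  where
  "BS_shares \<Omega> W s0 \<mu> \<sigma> r T g \<beta> t =
     deriv (\<lambda>x. BS_price \<Omega> W \<sigma> r T g t x) (BS_stock s0 \<mu> \<sigma> \<beta> t)"

definition BS_bonds ::
  "'b measure \<Rightarrow> (real \<Rightarrow> 'b \<Rightarrow> real) \<Rightarrow> real \<Rightarrow> real \<Rightarrow> real \<Rightarrow> real \<Rightarrow> real \<Rightarrow> (real \<Rightarrow> real) \<Rightarrow>
   (real \<Rightarrow> real) \<Rightarrow> real \<Rightarrow> real"
  where
  "BS_bonds \<Omega> W s0 \<mu> \<sigma> r T g \<beta> t = exp (- r * t) *
     (BS_price \<Omega> W \<sigma> r T g t (BS_stock s0 \<mu> \<sigma> \<beta> t)
      - BS_stock s0 \<mu> \<sigma> \<beta> t * 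
        deriv (\<lambda>x. BS_price \<Omega> W \<sigma> r T g t x) (BS_stock s0 \<mu> \<sigma> \<beta> t))"

end

theory Submission
  imports Defs "HOL-Real_Asymp.Real_Asymp"
begin

text \<open>In logarithmic coordinates, with \<open>K y = g (exp y)\<close>, one step of the binomial model is the operator
  \<open>two_point\<close> and the Black--Scholes price is the discounted heat semigroup with drift \<open>r - \<sigma>\<^sup>2/2\<close>
  and volatility \<open>\<sigma>\<close>. Both are averages of translates, hence contractions that preserve Taylor bounds of
  \<open>K\<close>. The first two moments of one step agree up to \<open>o(\<Delta>t)\<close>, and \<open>K\<close> has a uniformly
  continuous second derivative, so Lindeberg's telescoping sum gives convergence of the discrete prices to
  the Black--Scholes price, uniformly in time and space. The second derivatives in \<open>y\<close> are bounded
  uniformly in \<open>m\<close>, so the first derivatives, that is the hedges, converge uniformly as well. Along a path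
  the logarithm of the discrete stock is a linear function of \<open>B\<^sub>m\<close> and time up to \<open>O(2\<^sup>-\<^sup>m)\<close>.

  The estimates (a) are Taylor's formula for each term of the binomial sum; the remainders add up to the
  second moment \<open>(q\<^sup>+ u\<^sup>2 + q\<^sup>- d\<^sup>2)\<^sup>n\<close> with \<open>n\<close> the number of remaining steps, which is at most
  \<open>exp (C T)\<close>.\<close>

text \<open>With p = 2^-m, a payoff with bounded third derivative would give a one-step error of
  order p^3. A payoff that is only C^2 has no such bound; uniform continuity of the second
  derivative replaces it. The Taylor error becomes
  \<open>\<delta> * h\<^sup>2 + C * \<bar>h\<bar> ^ 3\<close> with \<open>\<delta>\<close> at
  choice: summed over n steps with n p^2 at most T, the first term gives a multiple of
  \<open>\<delta>\<close> and the second tends to 0. Logarithmic coordinates make this uniform in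
  space: steps become translations by ln u and ln d, and the derivatives x g' and x^2 g'' + x g' are
  bounded, also near x = 0. The parameter \<mu> has to disappear in the limit. Under the weights q
  the log step has mean (\<mu> + \<kappa> \<sigma> - \<sigma>^2/2) p^2 + o(p^2); for \<kappa> = (r -
  \<mu>)/\<sigma> the coefficient is r - \<sigma>^2/2. As prices and their derivatives converge
  uniformly in time and space, randomness enters last: the stock path is substituted into
  deterministic functions whose limits are Lipschitz in space. Thus (b) is proved for each single
  path with steps of size 1 along which B_m converges uniformly.\<close>

section \<open>The discrete portfolio and the derivative of the discrete price\<close>

text \<open>The function s -> g s - s * g' a has derivative g' s - g' a, which is at most M * |b -
  a| on the segment from a to b; the mean value inequality does the rest. The factor 1/2 of the
  sharp remainder is given up.\<close>

lemma quadratic_remainder_bound: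
  fixes g g' :: "real \<Rightarrow> real"
  assumes "convex S"
    and deriv: "\<And>s. s \<in> S \<Longrightarrow> (g has_real_derivative g' s) (at s within S)"
    and lip: "\<And>s t. s \<in> S \<Longrightarrow> t \<in> S \<Longrightarrow> \<bar>g' s - g' t\<bar> \<le> M * \<bar>s - t\<bar>"
    and "M \<ge> 0" and ab: "a \<in> S" "b \<in> S"
  shows "\<bar>g b - g a - (b - a) * g' a\<bar> \<le> M * (b - a)\<^sup>2"
proof -
  have sub: "closed_segment a b \<subseteq> S"
    using \<open>convex S\<close> ab by (simp add: closed_segment_subset)
  have "norm ((g b - b * g' a) - (g a - a * g' a)) \<le> (M * \<bar>b - a\<bar>) * norm (b - a)"
  proof (rule field_differentiable_bound[where S = "closed_segment a b" and f' = "\<lambda>s. g' s - g' a"])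
    fix s assume s: "s \<in> closed_segment a b"
    show "((\<lambda>s. g s - s * g' a) has_real_derivative g' s - g' a) (at s within closed_segment a b)"
      using DERIV_subset[OF deriv sub] s sub by (auto intro!: derivative_eq_intros)
    have "\<bar>g' s - g' a\<bar> \<le> M * \<bar>s - a\<bar>"
      using lip s sub ab by blast
    also have "\<dots> \<le> M * \<bar>b - a\<bar>"
      using s \<open>M \<ge> 0\<close> by (intro mult_left_mono) (auto simp: closed_segment_eq_real_ivl split: if_splits)
    finally show "norm (g' s - g' a) \<le> M * \<bar>b - a\<bar>" by simp
  qed auto
  then show ?thesis
    by (simp add: algebra_simps power2_eq_square abs_mult[symmetric])
qed

lemma D_plus_deriv:
  assumes "g differentiable_on {0..}" "0 \<le> s"
  shows "(g has_real_derivative D_plus g s) (at s within {0..})"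
  using assms vector_derivative_works[of g "at s within {0..}"]
  by (auto simp: D_plus_def differentiable_on_def has_real_derivative_iff_has_vector_derivative)

lemma C2c_plus_derivs:
  assumes "C2c_plus g" "0 \<le> s"
  shows "(g has_real_derivative D_plus g s) (at s within {0..})"
    and "(D_plus g has_real_derivative D_plus (D_plus g) s) (at s within {0..})"
  using assms by (auto simp: C2c_plus_def intro: D_plus_deriv)

lemma C2c_plus_derivs_pos:
  assumes "C2c_plus g" "0 < s"
  shows "(g has_real_derivative D_plus g s) (at s)"
    and "(D_plus g has_real_derivative D_plus (D_plus g) s) (at s)"
  using C2c_plus_derivs[of g s] assms at_within_interior[of s "{0..}"] by auto

lemma C2c_plus_quadratic_remainder:
  assumes g: "C2c_plus g" and M: "\<And>s. 0 \<le> s \<Longrightarrow> \<bar>D_plus (D_plus g) s\<bar> \<le> M"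
    and "0 \<le> a" "0 \<le> b"
  shows "\<bar>g b - g a - (b - a) * D_plus g a\<bar> \<le> M * (b - a)\<^sup>2"
proof (rule quadratic_remainder_bound[where S = "{0..}"])
  show "\<bar>D_plus g s - D_plus g t\<bar> \<le> M * \<bar>s - t\<bar>" if "s \<in> {0..}" "t \<in> {0..}" for s t
    using field_differentiable_bound[of "{0..}" "D_plus g" "D_plus (D_plus g)" M s t]
      C2c_plus_derivs(2)[OF g] M that by auto
qed (use assms C2c_plus_derivs(1)[OF g] order_trans[OF abs_ge_zero M[of 0]] in auto)

section \<open>Weights and second moments of the binomial model\<close>

lemma m_zero_less_imp:
  assumes "\<sigma> > 0" "m_zero \<mu> \<sigma> r < ereal (real m)"
  shows "\<bar>r - \<mu>\<bar> / \<sigma> < 2 ^ m"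
proof (cases "r = \<mu>")
  case False
  then have "ln (\<bar>r - \<mu>\<bar> / \<sigma>) < real m * ln 2"
    using assms by (simp add: m_zero_def field_simps)
  also have "\<dots> = ln (2 ^ m)" by (simp add: ln_realpow)
  finally show ?thesis using assms False by simp
qed auto

lemma q_nonneg:
  assumes "\<bar>r - \<mu>\<bar> / \<sigma> < 2 ^ m" "\<sigma> > 0"
  shows "0 \<le> q_plus \<mu> \<sigma> r m" "0 \<le> q_minus \<mu> \<sigma> r m"
proof -
  have "\<bar>(r - \<mu>) / \<sigma> / 2 ^ m\<bar> < 1"
    using assms by (simp add: abs_divide divide_simps mult.commute)
  then show "0 \<le> q_plus \<mu> \<sigma> r m" "0 \<le> q_minus \<mu> \<sigma> r m"
    unfolding q_plus_def q_minus_def by linarith+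
qed

lemma q_minus_eq: "q_minus \<mu> \<sigma> r m = 1 - q_plus \<mu> \<sigma> r m"
  by (simp add: q_minus_def q_plus_def)

text \<open>Half of u^2 + d^2 contains no odd power of 2^-m, and the differences of the weights and
  of the squares, both of order 2^-m, enter only through their product. So the moment is 1 plus a
  multiple of the time step, which survives being raised to the number of steps.\<close>

lemma second_moment_eq:
  assumes "\<sigma> > 0"
  shows "q_plus \<mu> \<sigma> r m * (up_factor \<mu> \<sigma> m)\<^sup>2 + q_minus \<mu> \<sigma> r m * (down_factor \<mu> \<sigma> m)\<^sup>2
    = (1 + \<mu> / 2^(2*m))\<^sup>2 + 2 * (1 + \<mu> / 2^(2*m)) * (r - \<mu>) / 2^(2*m) + \<sigma>\<^sup>2 / 2^(2*m)"
proof -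
  define p :: real where "p = 1 / 2^m"
  have p: "x / 2^m = x * p" "x / 2^(2*m) = x * p\<^sup>2" for x
    by (simp_all add: p_def power_divide power_mult[symmetric] mult.commute)
  show ?thesis
    using assms unfolding q_plus_def q_minus_def up_factor_def down_factor_def p
    by (simp add: field_simps power2_eq_square)
qed

lemma num_steps_diff_le:
  assumes "T > 0"
  shows "real (num_steps T m - k) / 2^(2*m) \<le> T"
proof -
  have "real (num_steps T m - k) \<le> real (num_steps T m)" by simp
  also have "\<dots> \<le> T * 2^(2*m)" using assms by (simp add: num_steps_def)
  finally show ?thesis by (simp add: field_simps)
qed

text \<open>\<open>C\<close> bounds the coefficient of the time step in the second moment for all
  \<open>m\<close> at once, higher powers of the step being at most 1. Then 1 + x \<le> exp x, and
  the remaining steps cover a time of at most T.\<close>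

lemma second_moment_power_bound:
  fixes \<mu> \<sigma> r T :: real
  assumes "\<sigma> > 0" "T > 0"
    and "0 \<le> q_plus \<mu> \<sigma> r m" "0 \<le> q_minus \<mu> \<sigma> r m"
  defines "C \<equiv> 2 * \<bar>\<mu>\<bar> + \<mu>\<^sup>2 + 2 * (1 + \<bar>\<mu>\<bar>) * \<bar>r - \<mu>\<bar> + \<sigma>\<^sup>2"
  shows "(q_plus \<mu> \<sigma> r m * (up_factor \<mu> \<sigma> m)\<^sup>2 + q_minus \<mu> \<sigma> r m * (down_factor \<mu> \<sigma> m)\<^sup>2)
           ^ (num_steps T m - k) \<le> exp (C * T)"
proof -
  let ?n = "num_steps T m - k"
  define s :: real where "s = 1 / 2^(2*m)"
  have s: "x / 2^(2*m) = x * s" for x by (simp add: s_def)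
  have s01: "0 \<le> s" "s \<le> 1" by (simp_all add: s_def)
  let ?v = "q_plus \<mu> \<sigma> r m * (up_factor \<mu> \<sigma> m)\<^sup>2 + q_minus \<mu> \<sigma> r m * (down_factor \<mu> \<sigma> m)\<^sup>2"
  have C: "C \<ge> 0" by (auto simp: C_def)
  have "?v = 1 + (2 * \<mu> + \<mu>\<^sup>2 * s + 2 * (1 + \<mu> * s) * (r - \<mu>) + \<sigma>\<^sup>2) * s"
    unfolding second_moment_eq[OF assms(1)] s by (simp add: algebra_simps power2_eq_square)
  also have "\<dots> \<le> 1 + C * s"
  proof -
    have "\<bar>1 + \<mu> * s\<bar> \<le> 1 + \<bar>\<mu>\<bar>"
      using s01 by (intro order_trans[OF abs_triangle_ineq]) (auto simp: abs_mult intro: mult_left_le)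
    then have "\<bar>1 + \<mu> * s\<bar> * \<bar>r - \<mu>\<bar> \<le> (1 + \<bar>\<mu>\<bar>) * \<bar>r - \<mu>\<bar>"
      by (intro mult_right_mono) auto
    then have "(1 + \<mu> * s) * (r - \<mu>) \<le> (1 + \<bar>\<mu>\<bar>) * \<bar>r - \<mu>\<bar>"
      unfolding abs_mult[symmetric] by linarith
    moreover have "\<mu>\<^sup>2 * s \<le> \<mu>\<^sup>2" using s01 by (auto intro: mult_left_le)
    moreover have "\<mu> \<le> \<bar>\<mu>\<bar>" by simp
    ultimately have "2 * \<mu> + \<mu>\<^sup>2 * s + 2 * (1 + \<mu> * s) * (r - \<mu>) + \<sigma>\<^sup>2 \<le> C"
      unfolding C_def by linarith
    then show ?thesis using s01 by (auto intro: mult_right_mono)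
  qed
  also have "\<dots> \<le> exp (C * s)" by (rule exp_ge_add_one_self)
  finally have "?v ^ ?n \<le> exp (C * s) ^ ?n"
    using assms by (intro power_mono) auto
  also have "\<dots> = exp (C * (real ?n / 2^(2*m)))" by (simp add: exp_of_nat_mult[symmetric] s_def)
  also have "\<dots> \<le> exp (C * T)"
    using mult_left_mono[OF num_steps_diff_le[OF \<open>T > 0\<close>, of m k] C] by simp
  finally show ?thesis .
qed

lemma disc_price_has_deriv:
  fixes \<mu> \<sigma> r T x :: real and k m :: nat
  assumes g: "C2c_plus g" and "x > 0"
    and "0 \<le> up_factor \<mu> \<sigma> m" "0 \<le> down_factor \<mu> \<sigma> m"
  defines "n \<equiv> num_steps T m - k"
  defines "c \<equiv> \<lambda>i. up_factor \<mu> \<sigma> m ^ i * down_factor \<mu> \<sigma> m ^ (n - i)"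
  shows "((\<lambda>y. disc_price \<mu> \<sigma> r T g m k y) has_real_derivative
    bond_factor r m powi (- int n) *
      (\<Sum>i=0..n. real (n choose i) * q_plus \<mu> \<sigma> r m ^ i * q_minus \<mu> \<sigma> r m ^ (n - i) *
                 (c i * D_plus g (x * c i)))) (at x)"
proof -
  have "((\<lambda>y. g (y * c i)) has_real_derivative c i * D_plus g (x * c i)) (at x)" for i
  \<comment> \<open>With down factor 0 the factor \<open>c i\<close> may vanish; the term is then
    constant in y, which agrees with the formula. Otherwise the argument of \<open>g\<close> is
    positive, where the derivative is two-sided.\<close>
  proof (cases "c i = 0")
    case False
    moreover have "c i \<ge> 0" using assms by (auto simp: c_def)
    ultimately have "x * c i > 0" using \<open>x > 0\<close> by simp
    moreover have "((\<lambda>y. y * c i) has_real_derivative c i) (at x)"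
      by (auto intro!: derivative_eq_intros)
    ultimately have "((\<lambda>y. g (y * c i)) has_real_derivative D_plus g (x * c i) * c i) (at x)"
      using C2c_plus_derivs_pos(1)[OF g] by (intro DERIV_chain2[where f = g and g = "\<lambda>y. y * c i"]) auto
    then show ?thesis by (simp add: mult.commute)
  qed simp
  note * = this[unfolded c_def]
  show ?thesis
    unfolding disc_price_def Let_def n_def[symmetric] mult.assoc[of _ "up_factor \<mu> \<sigma> m ^ _"] c_def
    by (intro DERIV_cmult DERIV_sum *)
qed

lemma binomial_weighted_second_moment:
  "(\<Sum>i=0..n. real (n choose i) * q ^ i * q' ^ (n - i) * (u ^ i * d ^ (n - i))\<^sup>2)
     = (q * u\<^sup>2 + q' * d\<^sup>2) ^ n" for q q' u d :: real
  by (simp add: binomial_ring atLeast0AtMost power_mult_distrib power_mult[symmetric] mult_ac)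

text \<open>Expanding the prices at u x and d x about x, term by term in the binomial sum, makes the
  linear parts cancel exactly against (u - d) x times the derivative. The remainders are quadratic
  in u - 1 and d - 1, hence of order p^2, and division by u - d = 2 \<sigma> p leaves order
  p.\<close>

lemma disc_shares_deriv_bound:
  fixes \<mu> \<sigma> r T x :: real
  assumes pos: "\<sigma> > 0" "r > 0" "T > 0" and g: "C2c_plus g"
    and M: "\<And>s. 0 \<le> s \<Longrightarrow> \<bar>D_plus (D_plus g) s\<bar> \<le> M"
    and m: "\<bar>r - \<mu>\<bar> / \<sigma> < 2 ^ m" and d0: "0 \<le> down_factor \<mu> \<sigma> m" and "x > 0"
  defines "C \<equiv> 2 * \<bar>\<mu>\<bar> + \<mu>\<^sup>2 + 2 * (1 + \<bar>\<mu>\<bar>) * \<bar>r - \<mu>\<bar> + \<sigma>\<^sup>2"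
  shows "\<bar>disc_shares \<mu> \<sigma> r T g m k x - deriv (\<lambda>y. disc_price \<mu> \<sigma> r T g m (k + 1) y) x\<bar>
          \<le> (\<sigma> + \<mu>\<^sup>2 / \<sigma>) * exp (C * T) * M * x / 2^m"
proof -
  define p :: real where "p = 1 / 2^m"
  have p: "y / 2^m = y * p" "y / 2^(2*m) = y * p\<^sup>2" for y
    by (simp_all add: p_def power_divide power_mult[symmetric] mult.commute)
  have p01: "0 < p" "p \<le> 1" by (simp_all add: p_def)
  define u where "u = up_factor \<mu> \<sigma> m"
  define d where "d = down_factor \<mu> \<sigma> m"
  define q where "q = q_plus \<mu> \<sigma> r m"
  define q' where "q' = q_minus \<mu> \<sigma> r m"
  have q: "0 \<le> q" "0 \<le> q'" using q_nonneg[OF m pos(1)] by (auto simp: q_def q'_def)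
  have ud: "u - d = 2 * \<sigma> * p" and u1: "u - 1 = \<sigma> * p + \<mu> * p\<^sup>2" and d1: "d - 1 = - \<sigma> * p + \<mu> * p\<^sup>2"
    unfolding u_def d_def up_factor_def down_factor_def p by auto
  have "d \<ge> 0" using d0 d_def by simp
  moreover have "2 * \<sigma> * p > 0" using pos p01 by simp
  ultimately have "u \<ge> 0" using ud by linarith
  have "M \<ge> 0" using M[of 0] by auto
  define n where "n = num_steps T m - (k + 1)"
  define c where "c i = u ^ i * d ^ (n - i)" for i
  have c0: "c i \<ge> 0" for i using \<open>u \<ge> 0\<close> \<open>d \<ge> 0\<close> by (simp add: c_def)
  define w where "w i = real (n choose i) * q ^ i * q' ^ (n - i)" for i
  have w0: "w i \<ge> 0" for i using q by (simp add: w_def)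
  define \<rho> where "\<rho> = bond_factor r m powi (- int n)"
  have \<rho>: "0 \<le> \<rho>" "\<rho> \<le> 1"
    using pos unfolding \<rho>_def bond_factor_def
    by (auto simp: power_int_minus inverse_le_1_iff one_le_power)
  have F: "disc_price \<mu> \<sigma> r T g m (k+1) y = \<rho> * (\<Sum>i=0..n. w i * g (y * c i))" for y
    unfolding disc_price_def Let_def n_def[symmetric] w_def c_def \<rho>_def u_def d_def q_def q'_def
    by (simp add: mult.assoc)
  have D: "deriv (\<lambda>y. disc_price \<mu> \<sigma> r T g m (k + 1) y) x
      = \<rho> * (\<Sum>i=0..n. w i * (c i * D_plus g (x * c i)))"
    using DERIV_imp_deriv[OF disc_price_has_deriv[OF g \<open>x > 0\<close>, of \<mu> \<sigma> m r T "k+1"]]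
      \<open>u \<ge> 0\<close> \<open>d \<ge> 0\<close>
    unfolding n_def[symmetric] w_def c_def \<rho>_def u_def d_def q_def q'_def by simp
  \<comment> \<open>The numerator error of the i-th term. It is the difference of two Taylor
    remainders at the common point \<open>x * c i\<close>, since (u - 1) - (d - 1) = u - d.\<close>
  define e where "e i = g (u * x * c i) - g (d * x * c i) - (u - d) * x * (c i * D_plus g (x * c i))" for i
  have e: "\<bar>e i\<bar> \<le> M * x\<^sup>2 * (2 * (\<sigma>\<^sup>2 * p\<^sup>2 + \<mu>\<^sup>2 * p ^ 4)) * (c i)\<^sup>2" for i
  proof -
    let ?a = "x * c i"
    have *: "\<bar>g (v * x * c i) - g ?a - (v - 1) * ?a * D_plus g ?a\<bar> \<le> M * ((v - 1) * ?a)\<^sup>2" if "v \<ge> 0" for v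
    proof -
      have "v * x * c i - ?a = (v - 1) * ?a" by (simp add: algebra_simps)
      then show ?thesis
        using C2c_plus_quadratic_remainder[OF g M, of ?a "v * x * c i"] that \<open>x > 0\<close> c0 by auto
    qed
    have "e i = (g (u * x * c i) - g ?a - (u - 1) * ?a * D_plus g ?a)
         - (g (d * x * c i) - g ?a - (d - 1) * ?a * D_plus g ?a)"
      unfolding e_def by (simp add: algebra_simps)
    then have "\<bar>e i\<bar> \<le> M * ((u - 1) * ?a)\<^sup>2 + M * ((d - 1) * ?a)\<^sup>2"
      using *[OF \<open>u \<ge> 0\<close>] *[OF \<open>d \<ge> 0\<close>] by linarith
    also have "\<dots> = M * x\<^sup>2 * ((u - 1)\<^sup>2 + (d - 1)\<^sup>2) * (c i)\<^sup>2"
      unfolding power_mult_distrib by (simp add: distrib_left distrib_right mult_ac)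
    \<comment> \<open>The mixed terms 2 \<sigma> \<mu> p^3 have opposite signs and cancel.\<close>
    also have "(u - 1)\<^sup>2 + (d - 1)\<^sup>2 = 2 * (\<sigma>\<^sup>2 * p\<^sup>2 + \<mu>\<^sup>2 * p ^ 4)"
      unfolding u1 d1 by (simp add: algebra_simps power2_eq_square power4_eq_xxxx)
    finally show ?thesis .
  qed
  have "disc_price \<mu> \<sigma> r T g m (k+1) (u * x) - disc_price \<mu> \<sigma> r T g m (k+1) (d * x)
      - (u - d) * x * (\<rho> * (\<Sum>i=0..n. w i * (c i * D_plus g (x * c i)))) = \<rho> * (\<Sum>i=0..n. w i * e i)"
    unfolding F e_def ud by (simp add: sum_subtractf sum_distrib_left right_diff_distrib mult_ac)
  moreover have "\<bar>\<rho> * (\<Sum>i=0..n. w i * e i)\<bar> \<le> (M * x\<^sup>2 * (2 * (\<sigma>\<^sup>2 * p\<^sup>2 + \<mu>\<^sup>2 * p ^ 4))) * exp (C * T)"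
  proof -
    have "\<bar>\<rho> * (\<Sum>i=0..n. w i * e i)\<bar> \<le> 1 * \<bar>\<Sum>i=0..n. w i * e i\<bar>"
      using \<rho> by (simp add: abs_mult mult_left_le_one_le)
    also have "\<dots> \<le> (\<Sum>i=0..n. w i * \<bar>e i\<bar>)"
      using w0 by (auto intro!: order_trans[OF sum_abs] sum_mono simp: abs_mult)
    also have "\<dots> \<le> (\<Sum>i=0..n. w i * (M * x\<^sup>2 * (2 * (\<sigma>\<^sup>2 * p\<^sup>2 + \<mu>\<^sup>2 * p ^ 4)) * (c i)\<^sup>2))"
      using w0 e by (intro sum_mono mult_left_mono) auto
    also have "\<dots> = M * x\<^sup>2 * (2 * (\<sigma>\<^sup>2 * p\<^sup>2 + \<mu>\<^sup>2 * p ^ 4)) * (\<Sum>i=0..n. w i * (c i)\<^sup>2)"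
      unfolding sum_distrib_left by (simp only: mult_ac)
    also have "(\<Sum>i=0..n. w i * (c i)\<^sup>2) = (q * u\<^sup>2 + q' * d\<^sup>2) ^ n"
      unfolding w_def c_def by (rule binomial_weighted_second_moment)
    also have "M * x\<^sup>2 * (2 * (\<sigma>\<^sup>2 * p\<^sup>2 + \<mu>\<^sup>2 * p ^ 4)) * (q * u\<^sup>2 + q' * d\<^sup>2) ^ n
       \<le> M * x\<^sup>2 * (2 * (\<sigma>\<^sup>2 * p\<^sup>2 + \<mu>\<^sup>2 * p ^ 4)) * exp (C * T)"
      using second_moment_power_bound[OF pos(1,3), of \<mu> r m "k+1"] q \<open>M \<ge> 0\<close>
      unfolding C_def n_def q_def q'_def u_def d_def by (intro mult_left_mono) auto
    finally show ?thesis .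
  qed
  ultimately have main: "\<bar>disc_price \<mu> \<sigma> r T g m (k+1) (u * x) - disc_price \<mu> \<sigma> r T g m (k+1) (d * x)
      - (u - d) * x * (\<rho> * (\<Sum>i=0..n. w i * (c i * D_plus g (x * c i))))\<bar>
      \<le> (M * x\<^sup>2 * (2 * (\<sigma>\<^sup>2 * p\<^sup>2 + \<mu>\<^sup>2 * p ^ 4))) * exp (C * T)" by simp
  have udx: "(u - d) * x > 0" using ud pos p01 \<open>x > 0\<close> by simp
  then have nz: "(u - d) * x \<noteq> 0" by linarith
  have "disc_shares \<mu> \<sigma> r T g m k x - deriv (\<lambda>y. disc_price \<mu> \<sigma> r T g m (k + 1) y) x
     = (disc_price \<mu> \<sigma> r T g m (k+1) (u * x) - disc_price \<mu> \<sigma> r T g m (k+1) (d * x)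
      - (u - d) * x * (\<rho> * (\<Sum>i=0..n. w i * (c i * D_plus g (x * c i))))) / ((u - d) * x)"
    unfolding D disc_shares_def u_def[symmetric] d_def[symmetric] diff_divide_distrib
    by (simp only: nonzero_mult_div_cancel_left[OF nz])
  then have "\<bar>disc_shares \<mu> \<sigma> r T g m k x - deriv (\<lambda>y. disc_price \<mu> \<sigma> r T g m (k + 1) y) x\<bar>
     = \<bar>disc_price \<mu> \<sigma> r T g m (k+1) (u * x) - disc_price \<mu> \<sigma> r T g m (k+1) (d * x)
      - (u - d) * x * (\<rho> * (\<Sum>i=0..n. w i * (c i * D_plus g (x * c i))))\<bar> / ((u - d) * x)"
    by (simp only: abs_divide abs_of_pos[OF udx])
  also have "\<dots> \<le> (M * x\<^sup>2 * (2 * (\<sigma>\<^sup>2 * p\<^sup>2 + \<mu>\<^sup>2 * p ^ 4))) * exp (C * T) / ((u - d) * x)"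
    using main udx by (intro divide_right_mono) auto
  also have "\<dots> = (\<sigma> + \<mu>\<^sup>2 / \<sigma> * p\<^sup>2) * (exp (C * T) * M * x * p)"
    unfolding ud using pos p01 \<open>x > 0\<close>
    by (simp add: field_simps power2_eq_square power4_eq_xxxx)
  also have "\<dots> \<le> (\<sigma> + \<mu>\<^sup>2 / \<sigma> * 1) * (exp (C * T) * M * x * p)"
    using p01 pos \<open>M \<ge> 0\<close> \<open>x > 0\<close>
    by (intro mult_right_mono add_left_mono mult_left_mono) (auto simp: power_le_one)
  finally show ?thesis unfolding p by (simp add: mult_ac)
qed

text \<open>The bond formula is affine in the number of shares, so the error is the share error
  times u x, discounted by a factor of at most 1. \<open>D\<close> is arbitrary here and stands for
  the price derivative later.\<close>

lemma disc_bonds_deriv_bound: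
  assumes pos: "\<sigma> > 0" "r > 0" "x > 0" and d0: "0 \<le> down_factor \<mu> \<sigma> m"
    and A: "\<bar>disc_shares \<mu> \<sigma> r T g m k x - D\<bar> \<le> A"
  shows "\<bar>disc_bonds \<mu> \<sigma> r T g m k x
           - bond_factor r m powi (- int k - 1) *
             (disc_price \<mu> \<sigma> r T g m (k + 1) (up_factor \<mu> \<sigma> m * x) - up_factor \<mu> \<sigma> m * x * D)\<bar>
          \<le> A * (1 + \<sigma> / 2^m + \<bar>\<mu>\<bar> / 2^(2*m)) * x"
proof -
  define u where "u = up_factor \<mu> \<sigma> m"
  define \<rho> where "\<rho> = bond_factor r m powi (- int k - 1)"
  have "\<rho> = inverse (bond_factor r m ^ (k + 1))"
    unfolding \<rho>_def using power_int_minus[of "bond_factor r m" "int (k + 1)"]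
    by (metis diff_minus_eq_add add.commute minus_add_distrib of_nat_1 of_nat_add power_int_of_nat uminus_add_conv_diff)
  then have \<rho>: "0 \<le> \<rho>" "\<rho> \<le> 1"
    using pos unfolding bond_factor_def
    by (auto simp del: power_Suc simp: inverse_le_1_iff one_le_power)
  have "\<sigma> / 2^m > 0" "\<mu> / 2^(2*m) \<le> \<bar>\<mu>\<bar> / 2^(2*m)"
    using pos by (auto intro: divide_right_mono)
  then have u: "0 \<le> u" "u \<le> 1 + \<sigma> / 2^m + \<bar>\<mu>\<bar> / 2^(2*m)"
    using d0 unfolding u_def up_factor_def down_factor_def by linarith+
  have "A \<ge> 0" using A by auto
  have "disc_bonds \<mu> \<sigma> r T g m k x - \<rho> * (disc_price \<mu> \<sigma> r T g m (k + 1) (u * x) - u * x * D)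
     = \<rho> * ((D - disc_shares \<mu> \<sigma> r T g m k x) * (u * x))"
    unfolding disc_bonds_def u_def[symmetric] \<rho>_def[symmetric] by (simp add: algebra_simps)
  then have "\<bar>disc_bonds \<mu> \<sigma> r T g m k x - \<rho> * (disc_price \<mu> \<sigma> r T g m (k + 1) (u * x) - u * x * D)\<bar>
     = \<rho> * (\<bar>disc_shares \<mu> \<sigma> r T g m k x - D\<bar> * (u * x))"
    using \<rho> u pos by (simp add: abs_mult abs_minus_commute)
  also have "\<dots> \<le> 1 * (A * ((1 + \<sigma> / 2^m + \<bar>\<mu>\<bar> / 2^(2*m)) * x))"
    using \<rho> u pos A \<open>A \<ge> 0\<close> by (intro mult_mono) auto
  finally show ?thesis unfolding u_def \<rho>_def by (simp add: mult_ac)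
qed

section \<open>Taylor bounds and averaging operators\<close>

text \<open>Here \<open>\<phi>1\<close> and \<open>\<phi>2\<close> play the role of derivatives. Taylor bounds are used
  in place of derivatives because they are linear in \<open>(\<phi>, \<phi>1, \<phi>2)\<close> and translation invariant,
  hence stable under averaging without differentiation under the integral sign.\<close>

definition jet1 :: "real \<Rightarrow> (real \<Rightarrow> real) \<Rightarrow> (real \<Rightarrow> real) \<Rightarrow> bool" where
  "jet1 B \<phi> \<phi>1 \<longleftrightarrow> \<phi> \<in> borel_measurable borel \<and> \<phi>1 \<in> borel_measurable borel \<and>
     (\<forall>y. \<bar>\<phi> y\<bar> \<le> B) \<and> (\<forall>y. \<bar>\<phi>1 y\<bar> \<le> B) \<and>
     (\<forall>y h. \<bar>\<phi> (y + h) - \<phi> y - h * \<phi>1 y\<bar> \<le> B * h\<^sup>2)"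

definition jet2 :: "real \<Rightarrow> real \<Rightarrow> real \<Rightarrow> (real \<Rightarrow> real) \<Rightarrow> (real \<Rightarrow> real) \<Rightarrow> (real \<Rightarrow> real) \<Rightarrow> bool" where
  "jet2 B \<delta> C \<phi> \<phi>1 \<phi>2 \<longleftrightarrow> \<phi> \<in> borel_measurable borel \<and> \<phi>1 \<in> borel_measurable borel \<and>
     \<phi>2 \<in> borel_measurable borel \<and>
     (\<forall>y. \<bar>\<phi> y\<bar> \<le> B) \<and> (\<forall>y. \<bar>\<phi>1 y\<bar> \<le> B) \<and> (\<forall>y. \<bar>\<phi>2 y\<bar> \<le> B) \<and>
     (\<forall>y h. \<bar>\<phi> (y + h) - \<phi> y - h * \<phi>1 y - h\<^sup>2 / 2 * \<phi>2 y\<bar> \<le> \<delta> * h\<^sup>2 + C * \<bar>h\<bar> ^ 3)"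

lemma jet1_has_deriv:
  assumes "jet1 B \<phi> \<phi>1"
  shows "(\<phi> has_real_derivative \<phi>1 y) (at y)"
proof -
  have "((\<lambda>h. (\<phi> (y + h) - \<phi> y) / h - \<phi>1 y) \<longlongrightarrow> 0) (at 0)"
  proof (rule Lim_null_comparison)
    show "\<forall>\<^sub>F h in at 0. norm ((\<phi> (y + h) - \<phi> y) / h - \<phi>1 y) \<le> B * \<bar>h\<bar>"
    proof (rule eventually_at_filter[THEN iffD2], rule always_eventually, intro allI impI)
      fix h :: real assume "h \<noteq> 0"
      then have "\<bar>(\<phi> (y + h) - \<phi> y) / h - \<phi>1 y\<bar> = \<bar>\<phi> (y + h) - \<phi> y - h * \<phi>1 y\<bar> / \<bar>h\<bar>"
        by (subst abs_divide[symmetric]) (simp add: diff_divide_distrib)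
      also have "\<dots> \<le> B * h\<^sup>2 / \<bar>h\<bar>"
        using assms by (auto simp: jet1_def intro!: divide_right_mono)
      also have "\<dots> = B * \<bar>h\<bar>" 
      proof -
        have "h\<^sup>2 = \<bar>h\<bar> * \<bar>h\<bar>" by (simp add: power2_eq_square)
        then show ?thesis using \<open>h \<noteq> 0\<close> by (simp del: abs_mult_self_eq)
      qed
      finally show "norm ((\<phi> (y + h) - \<phi> y) / h - \<phi>1 y) \<le> B * \<bar>h\<bar>" by simp
    qed
    show "((\<lambda>h. B * \<bar>h\<bar>) \<longlongrightarrow> 0) (at 0)"
      by (auto intro!: tendsto_eq_intros)
  qed
  then show ?thesis unfolding DERIV_def using LIM_zero_iff by blast
qed

text \<open>For the second bound, the expansion from y to z and the one from z back to y are added: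
  the values of \<open>\<phi>\<close> cancel and h times the difference of \<open>\<phi>1\<close>
  remains, of size at most 2 B h^2.\<close>

lemma jet1_lipschitz:
  assumes "jet1 B \<phi> \<phi>1"
  shows "\<bar>\<phi> y - \<phi> z\<bar> \<le> B * \<bar>y - z\<bar>" and "\<bar>\<phi>1 y - \<phi>1 z\<bar> \<le> 2 * B * \<bar>y - z\<bar>"
proof -
  show "\<bar>\<phi> y - \<phi> z\<bar> \<le> B * \<bar>y - z\<bar>"
    using field_differentiable_bound[of UNIV \<phi> \<phi>1 B y z] jet1_has_deriv[OF assms] assms
    by (auto simp: jet1_def)
  define h where "h = z - y"
  have "\<bar>\<phi> (y + h) - \<phi> y - h * \<phi>1 y\<bar> \<le> B * h\<^sup>2" "\<bar>\<phi> (z + - h) - \<phi> z - (- h) * \<phi>1 z\<bar> \<le> B * (- h)\<^sup>2"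
    using assms unfolding jet1_def by blast+
  moreover have "y + h = z" "z + - h = y" by (simp_all add: h_def)
  ultimately have "\<bar>h * (\<phi>1 z - \<phi>1 y)\<bar> \<le> 2 * B * h\<^sup>2" by (simp add: right_diff_distrib)
  then have *: "\<bar>h\<bar> * \<bar>\<phi>1 y - \<phi>1 z\<bar> \<le> \<bar>h\<bar> * (2 * B * \<bar>h\<bar>)"
    unfolding abs_mult power2_abs[of h, symmetric] power2_eq_square
    by (simp add: abs_minus_commute mult_ac)
  then show "\<bar>\<phi>1 y - \<phi>1 z\<bar> \<le> 2 * B * \<bar>y - z\<bar>"
  proof (cases "h = 0")
    case False
    then have "\<bar>\<phi>1 y - \<phi>1 z\<bar> \<le> 2 * B * \<bar>h\<bar>"
      using mult_left_le_imp_le[OF *] by simp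
    then show ?thesis by (simp add: h_def abs_minus_commute)
  qed (simp add: h_def)
qed

section \<open>The two-point operator and its powers\<close>

definition two_point :: "real \<Rightarrow> real \<Rightarrow> real \<Rightarrow> (real \<Rightarrow> real) \<Rightarrow> real \<Rightarrow> real" where
  "two_point q v w \<phi> y = q * \<phi> (y + v) + (1 - q) * \<phi> (y + w)"

lemma convex_abs_bound:
  fixes q a b c :: real
  assumes "0 \<le> q" "q \<le> 1" "\<bar>a\<bar> \<le> c" "\<bar>b\<bar> \<le> c"
  shows "\<bar>q * a + (1 - q) * b\<bar> \<le> c"
proof -
  have "\<bar>q * a + (1 - q) * b\<bar> \<le> q * \<bar>a\<bar> + (1 - q) * \<bar>b\<bar>"
    using assms by (intro order_trans[OF abs_triangle_ineq]) (simp add: abs_mult)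
  also have "\<dots> \<le> q * c + (1 - q) * c"
    using assms by (intro add_mono mult_left_mono) auto
  finally show ?thesis by (simp add: algebra_simps)
qed

lemma two_point_abs_le:
  assumes "0 \<le> q" "q \<le> 1" "\<And>y. \<bar>\<phi> y\<bar> \<le> c"
  shows "\<bar>two_point q v w \<phi> y\<bar> \<le> c"
  using assms by (auto simp: two_point_def intro: convex_abs_bound)

lemma jet1_two_point:
  assumes q: "0 \<le> q" "q \<le> 1" and J: "jet1 B \<phi> \<phi>1"
  shows "jet1 B (two_point q v w \<phi>) (two_point q v w \<phi>1)"
proof -
  have [measurable]: "\<phi> \<in> borel_measurable borel" "\<phi>1 \<in> borel_measurable borel"
    using J by (auto simp: jet1_def)
  have "\<bar>two_point q v w \<phi> (y + h) - two_point q v w \<phi> y - h * two_point q v w \<phi>1 y\<bar> \<le> B * h\<^sup>2" for y h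
  proof -
    have "two_point q v w \<phi> (y + h) - two_point q v w \<phi> y - h * two_point q v w \<phi>1 y
      = q * (\<phi> ((y + v) + h) - \<phi> (y + v) - h * \<phi>1 (y + v))
        + (1 - q) * (\<phi> ((y + w) + h) - \<phi> (y + w) - h * \<phi>1 (y + w))"
      unfolding two_point_def by (simp add: algebra_simps)
    also have "\<bar>\<dots>\<bar> \<le> B * h\<^sup>2"
      using q J unfolding jet1_def by (intro convex_abs_bound) blast+
    finally show ?thesis .
  qed
  moreover have "two_point q v w \<phi> \<in> borel_measurable borel" "two_point q v w \<phi>1 \<in> borel_measurable borel"
    unfolding two_point_def by measurable
  ultimately show ?thesis
    using q J unfolding jet1_def by (auto intro: two_point_abs_le)
qed

lemma jet1_two_point_funpow:
  assumes "0 \<le> q" "q \<le> 1" "jet1 B \<phi> \<phi>1"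
  shows "jet1 B ((two_point q v w ^^ n) \<phi>) ((two_point q v w ^^ n) \<phi>1)"
  by (induction n) (use assms jet1_two_point in auto)

lemma two_point_funpow_eq:
  "(two_point q v w ^^ n) \<phi> y =
     (\<Sum>i=0..n. real (n choose i) * q ^ i * (1 - q) ^ (n - i) * \<phi> (y + real i * v + real (n - i) * w))"
proof (induction n arbitrary: y)
  case (Suc n)
  define b where "b i = q ^ i * (1 - q) ^ (Suc n - i) * \<phi> (y + real i * v + real (Suc n - i) * w)" for i
  have "(two_point q v w ^^ Suc n) \<phi> y =
     (\<Sum>i=0..n. real (n choose i) * b (Suc i)) + (\<Sum>i=0..n. real (n choose i) * b i)"
  proof -
    have "q * (\<Sum>i=0..n. real (n choose i) * q ^ i * (1 - q) ^ (n - i)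
             * \<phi> ((y + v) + real i * v + real (n - i) * w)) = (\<Sum>i=0..n. real (n choose i) * b (Suc i))"
      unfolding sum_distrib_left b_def by (intro sum.cong refl) (simp add: algebra_simps)
    moreover have "(1 - q) * (\<Sum>i=0..n. real (n choose i) * q ^ i * (1 - q) ^ (n - i)
             * \<phi> ((y + w) + real i * v + real (n - i) * w)) = (\<Sum>i=0..n. real (n choose i) * b i)"
      unfolding sum_distrib_left b_def
      by (intro sum.cong refl) (simp add: Suc_diff_le algebra_simps)
    ultimately show ?thesis by (simp add: two_point_def Suc.IH)
  qed
  \<comment> \<open>The sum may be extended to \<open>Suc n\<close>, where the binomial coefficient
    is 0; splitting off i = 0 then aligns it with the shifted sum, and Pascal's rule
    applies.\<close>
  also have "(\<Sum>i=0..n. real (n choose i) * b i) = b 0 + (\<Sum>i=0..n. real (n choose Suc i) * b (Suc i))"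
  proof -
    have "(\<Sum>i=0..n. real (n choose i) * b i) = (\<Sum>i=0..Suc n. real (n choose i) * b i)" by simp
    then show ?thesis unfolding sum.atLeast0_atMost_Suc_shift by simp
  qed
  also have "(\<Sum>i=0..n. real (n choose i) * b (Suc i)) + (b 0 + (\<Sum>i=0..n. real (n choose Suc i) * b (Suc i)))
     = b 0 + (\<Sum>i=0..n. real (Suc n choose Suc i) * b (Suc i))"
    by (simp add: sum.distrib[symmetric] algebra_simps)
  also have "\<dots> = (\<Sum>i=0..Suc n. real (Suc n choose i) * b i)"
    unfolding sum.atLeast0_atMost_Suc_shift by simp
  finally show ?case by (simp add: b_def mult_ac)
qed simp

section \<open>The Gaussian semigroup\<close>

text \<open>The transition operator of Brownian motion with drift \<open>a\<close> and volatility
  \<open>\<sigma>\<close>. Integrating against a standard normal variable, rather than a density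
  depending on \<open>t\<close>, gives one measure for all times and includes t = 0 as the
  identity.\<close>

definition heat :: "real \<Rightarrow> real \<Rightarrow> real \<Rightarrow> (real \<Rightarrow> real) \<Rightarrow> real \<Rightarrow> real" where
  "heat a \<sigma> t \<phi> y = (\<integral>z. \<phi> (y + (a * t + \<sigma> * sqrt t * z)) \<partial>std_normal_distribution)"

lemma prob_space_std_normal: "prob_space std_normal_distribution"
  by (simp add: prob_space_normal_density)

lemma heat_0 [simp]: "heat a \<sigma> 0 \<phi> = \<phi>"
  using prob_space.prob_space[OF prob_space_std_normal]
  by (auto simp: heat_def fun_eq_iff)

lemma integrable_heat:
  fixes \<phi> :: "real \<Rightarrow> real"
  assumes [measurable]: "\<phi> \<in> borel_measurable borel" and "\<And>y. \<bar>\<phi> y\<bar> \<le> B"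
  shows "integrable std_normal_distribution (\<lambda>z. \<phi> (y + (c + s * z)))"
  using assms by (intro finite_measure.integrable_const_bound[where B = B]
      prob_space.finite_measure prob_space_std_normal) auto

lemma measurable_heat [measurable]:
  assumes [measurable]: "\<phi> \<in> borel_measurable borel"
  shows "heat a \<sigma> t \<phi> \<in> borel_measurable borel"
proof -
  interpret prob_space std_normal_distribution by (rule prob_space_std_normal)
  show ?thesis unfolding heat_def[abs_def] by measurable
qed

lemma std_normal_integral_abs_le:
  fixes f :: "real \<Rightarrow> real"
  assumes "integrable std_normal_distribution f" "\<And>z. \<bar>f z\<bar> \<le> c"
  shows "\<bar>\<integral>z. f z \<partial>std_normal_distribution\<bar> \<le> c"
proof -
  interpret prob_space std_normal_distribution by (rule prob_space_std_normal)
  have "f z \<le> c" "- c \<le> f z" for z using assms(2)[of z] by auto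
  then have "(\<integral>z. f z \<partial>std_normal_distribution) \<le> c" "- c \<le> (\<integral>z. f z \<partial>std_normal_distribution)"
    using assms(1) by (auto intro!: integral_le_const integral_ge_const)
  then show ?thesis by simp
qed

lemma heat_abs_le:
  assumes "\<phi> \<in> borel_measurable borel" "\<And>y. \<bar>\<phi> y\<bar> \<le> c"
  shows "\<bar>heat a \<sigma> t \<phi> y\<bar> \<le> c"
  unfolding heat_def using assms by (intro std_normal_integral_abs_le integrable_heat) auto

lemma jet1_heat:
  assumes J: "jet1 B \<phi> \<phi>1"
  shows "jet1 B (heat a \<sigma> t \<phi>) (heat a \<sigma> t \<phi>1)"
proof -
  have m[measurable]: "\<phi> \<in> borel_measurable borel" "\<phi>1 \<in> borel_measurable borel"
    and b: "\<And>y. \<bar>\<phi> y\<bar> \<le> B" "\<And>y. \<bar>\<phi>1 y\<bar> \<le> B"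
    and J': "\<And>y h. \<bar>\<phi> (y + h) - \<phi> y - h * \<phi>1 y\<bar> \<le> B * h\<^sup>2"
    using J by (auto simp: jet1_def)
  note i[simp] = integrable_heat[OF m(1) b(1)] integrable_heat[OF m(2) b(2)]
  have "\<bar>heat a \<sigma> t \<phi> (y + h) - heat a \<sigma> t \<phi> y - h * heat a \<sigma> t \<phi>1 y\<bar> \<le> B * h\<^sup>2" for y h
  proof -
    let ?s = "\<lambda>z. a * t + \<sigma> * sqrt t * z"
    have "heat a \<sigma> t \<phi> (y + h) - heat a \<sigma> t \<phi> y - h * heat a \<sigma> t \<phi>1 y
      = (\<integral>z. \<phi> ((y + h) + ?s z) - \<phi> (y + ?s z) - h * \<phi>1 (y + ?s z) \<partial>std_normal_distribution)"
      unfolding heat_def by simp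
    also have "\<bar>\<dots>\<bar> \<le> B * h\<^sup>2"
    proof (rule std_normal_integral_abs_le)
      show "\<bar>\<phi> ((y + h) + ?s z) - \<phi> (y + ?s z) - h * \<phi>1 (y + ?s z)\<bar> \<le> B * h\<^sup>2" for z
        using J'[of "y + ?s z" h] by (simp add: algebra_simps)
    qed auto
    finally show ?thesis .
  qed
  then show ?thesis
    using b heat_abs_le[OF m(1) b(1)] heat_abs_le[OF m(2) b(2)] unfolding jet1_def by auto
qed

lemma jet2_heat:
  assumes J: "jet2 B \<delta> C \<phi> \<phi>1 \<phi>2"
  shows "jet2 B \<delta> C (heat a \<sigma> t \<phi>) (heat a \<sigma> t \<phi>1) (heat a \<sigma> t \<phi>2)"
proof -
  have m[measurable]: "\<phi> \<in> borel_measurable borel" "\<phi>1 \<in> borel_measurable borel" "\<phi>2 \<in> borel_measurable borel"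
    and b: "\<And>y. \<bar>\<phi> y\<bar> \<le> B" "\<And>y. \<bar>\<phi>1 y\<bar> \<le> B" "\<And>y. \<bar>\<phi>2 y\<bar> \<le> B"
    and J': "\<And>y h. \<bar>\<phi> (y + h) - \<phi> y - h * \<phi>1 y - h\<^sup>2 / 2 * \<phi>2 y\<bar> \<le> \<delta> * h\<^sup>2 + C * \<bar>h\<bar> ^ 3"
    using J by (auto simp: jet2_def)
  note i[simp] = integrable_heat[OF m(1) b(1)] integrable_heat[OF m(2) b(2)] integrable_heat[OF m(3) b(3)]
  have "\<bar>heat a \<sigma> t \<phi> (y + h) - heat a \<sigma> t \<phi> y - h * heat a \<sigma> t \<phi>1 y - h\<^sup>2 / 2 * heat a \<sigma> t \<phi>2 y\<bar>
      \<le> \<delta> * h\<^sup>2 + C * \<bar>h\<bar> ^ 3" for y h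
  proof -
    let ?s = "\<lambda>z. a * t + \<sigma> * sqrt t * z"
    have "heat a \<sigma> t \<phi> (y + h) - heat a \<sigma> t \<phi> y - h * heat a \<sigma> t \<phi>1 y - h\<^sup>2 / 2 * heat a \<sigma> t \<phi>2 y
      = (\<integral>z. \<phi> ((y + h) + ?s z) - \<phi> (y + ?s z) - h * \<phi>1 (y + ?s z) - h\<^sup>2 / 2 * \<phi>2 (y + ?s z)
          \<partial>std_normal_distribution)"
      unfolding heat_def by simp
    also have "\<bar>\<dots>\<bar> \<le> \<delta> * h\<^sup>2 + C * \<bar>h\<bar> ^ 3"
    proof (rule std_normal_integral_abs_le)
      show "\<bar>\<phi> ((y + h) + ?s z) - \<phi> (y + ?s z) - h * \<phi>1 (y + ?s z) - h\<^sup>2 / 2 * \<phi>2 (y + ?s z)\<bar>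
          \<le> \<delta> * h\<^sup>2 + C * \<bar>h\<bar> ^ 3" for z
        using J'[of "y + ?s z" h] by (simp add: algebra_simps)
    qed auto
    finally show ?thesis .
  qed
  then show ?thesis
    using b heat_abs_le[OF m(1) b(1)] heat_abs_le[OF m(2) b(2)] heat_abs_le[OF m(3) b(3)]
    unfolding jet2_def by auto
qed

text \<open>X / sqrt t is standard normal. The probability space is general because the lemma serves
  twice: for the increment of \<open>W\<close>, and on a product space in the semigroup law.\<close>

lemma heat_eq_normal_expectation:
  assumes "prob_space P" "distributed P lborel X (normal_density 0 (sqrt t))" "t > 0"
    and [measurable]: "\<phi> \<in> borel_measurable borel"
  shows "(\<integral>\<omega>. \<phi> (y + (a * t + \<sigma> * X \<omega>)) \<partial>P) = heat a \<sigma> t \<phi> y"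
proof -
  interpret prob_space P by fact
  have D: "distributed P lborel (\<lambda>\<omega>. X \<omega> / sqrt t) std_normal_density"
    using assms normal_standard_normal_convert[of "sqrt t" X 0] by simp
  have "heat a \<sigma> t \<phi> y = (\<integral>z. std_normal_density z * \<phi> (y + (a * t + \<sigma> * sqrt t * z)) \<partial>lborel)"
    unfolding heat_def by (subst integral_density) auto
  also have "\<dots> = (\<integral>\<omega>. \<phi> (y + (a * t + \<sigma> * sqrt t * (X \<omega> / sqrt t))) \<partial>P)"
    by (rule distributed_integral[OF D]) auto
  also have "\<dots> = (\<integral>\<omega>. \<phi> (y + (a * t + \<sigma> * X \<omega>)) \<partial>P)"
    using \<open>t > 0\<close> by simp
  finally show ?thesis by simp
qed

text \<open>The two coordinates are independent under the product measure; scaled, they are normal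
  with variances s and t, and variances of independent normals add.\<close>

lemma distributed_sum_std_normal_pair:
  assumes "s > 0" "t > 0"
  shows "distributed (std_normal_distribution \<Otimes>\<^sub>M std_normal_distribution) lborel
     (\<lambda>p. sqrt s * fst p + sqrt t * snd p) (normal_density 0 (sqrt (s + t)))"
proof -
  let ?N = "std_normal_distribution"
  interpret N: prob_space ?N by (rule prob_space_std_normal)
  interpret P: pair_prob_space ?N ?N ..
  have f: "distr (?N \<Otimes>\<^sub>M ?N) borel fst = ?N"
    using N.distr_pair_fst[of ?N] by (simp cong: distr_cong)
  have s: "distr (?N \<Otimes>\<^sub>M ?N) borel snd = ?N"
    by (intro measure_eqI)
       (auto simp: emeasure_distr N.emeasure_pair_measure_Times N.emeasure_space_1[simplified]
          space_pair_measure vimage_snd Times_Int_Times simp del: emeasure_density)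
  have i: "P.indep_var borel fst borel snd"
    unfolding P.indep_var_distribution_eq f s by (auto intro!: distr_id2[symmetric] sets_pair_measure_cong)
  have d: "distributed (?N \<Otimes>\<^sub>M ?N) lborel fst std_normal_density"
     "distributed (?N \<Otimes>\<^sub>M ?N) lborel snd std_normal_density"
    using f s by (auto simp: distributed_def cong: distr_cong)
  have "P.indep_var borel (\<lambda>p. sqrt s * fst p) borel (\<lambda>p. sqrt t * snd p)"
    using P.indep_var_compose[OF i, of "\<lambda>x. sqrt s * x" borel "\<lambda>x. sqrt t * x" borel]
    by (simp add: comp_def)
  from P.add_indep_normal[OF this, of "sqrt s" "sqrt t" 0 0]
  show ?thesis
    using P.normal_density_affine[OF d(1), of "sqrt s" 0] P.normal_density_affine[OF d(2), of "sqrt t" 0] assms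
    by simp
qed

text \<open>By Fubini the iterated average is an average over the product measure, in which the two
  Gaussian displacements add up to one of variance s + t. Boundedness of \<open>\<phi>\<close>
  supplies integrability; zero times are separated because normal densities need positive
  variance.\<close>

lemma heat_add:
  assumes [measurable]: "\<phi> \<in> borel_measurable borel" and b: "\<And>y. \<bar>\<phi> y\<bar> \<le> B" and "0 \<le> s" "0 \<le> t"
  shows "heat a \<sigma> s (heat a \<sigma> t \<phi>) = heat a \<sigma> (s + t) \<phi>"
proof (cases "s = 0 \<or> t = 0")
  case False
  let ?N = "std_normal_distribution"
  interpret N: prob_space ?N by (rule prob_space_std_normal)
  interpret P: pair_prob_space ?N ?N ..
  have st: "s > 0" "t > 0" using False assms by auto
  show ?thesis
  proof
    fix y
    let ?f = "\<lambda>p. \<phi> (y + (a * (s + t) + \<sigma> * (sqrt s * fst p + sqrt t * snd p)))"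
    have "heat a \<sigma> s (heat a \<sigma> t \<phi>) y = (\<integral>z. \<integral>w. ?f (z, w) \<partial>?N \<partial>?N)"
      unfolding heat_def by (simp add: algebra_simps)
    also have "\<dots> = (\<integral>p. ?f p \<partial>(?N \<Otimes>\<^sub>M ?N))"
      using b by (intro P.integral_fst' P.integrable_const_bound[where B = B]) auto
    also have "\<dots> = heat a \<sigma> (s + t) \<phi> y"
      using st by (intro heat_eq_normal_expectation distributed_sum_std_normal_pair P.prob_space_axioms) auto
    finally show "heat a \<sigma> s (heat a \<sigma> t \<phi>) y = heat a \<sigma> (s + t) \<phi> y" .
  qed
qed auto

section \<open>Lindeberg comparison\<close>

lemma std_normal_moments:
  "integrable std_normal_distribution (\<lambda>z. z)" "(\<integral>z. z \<partial>std_normal_distribution) = 0"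
  "integrable std_normal_distribution (\<lambda>z. z\<^sup>2)" "(\<integral>z. z\<^sup>2 \<partial>std_normal_distribution) = 1"
  "integrable std_normal_distribution (\<lambda>z. \<bar>z\<bar> ^ 3)"
  using integrable_std_normal_distribution_moment[of 1] integral_std_normal_distribution_moment_odd[of 1]
    integrable_std_normal_distribution_moment[of 2] std_normal_distribution_even_moments[of 1]
    integrable_abs[OF integrable_std_normal_distribution_moment[of 3]]
  by (simp_all add: power_abs)

text \<open>Convexity of the cube; it separates drift and noise in the third absolute moment of a
  Gaussian displacement.\<close>

lemma abs_add_cubed_le: "\<bar>x + y\<bar> ^ 3 \<le> 4 * (\<bar>x\<bar> ^ 3 + \<bar>y\<bar> ^ 3)" for x y :: real
proof -
  have "0 \<le> 3 * (\<bar>x\<bar> + \<bar>y\<bar>) * (\<bar>x\<bar> - \<bar>y\<bar>)\<^sup>2" by simp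
  also have "\<dots> = 4 * (\<bar>x\<bar> ^ 3 + \<bar>y\<bar> ^ 3) - (\<bar>x\<bar> + \<bar>y\<bar>) ^ 3"
    by (simp only: power2_eq_square power3_eq_cube algebra_simps)
  finally have "(\<bar>x\<bar> + \<bar>y\<bar>) ^ 3 \<le> 4 * (\<bar>x\<bar> ^ 3 + \<bar>y\<bar> ^ 3)" by simp
  moreover have "\<bar>x + y\<bar> ^ 3 \<le> (\<bar>x\<bar> + \<bar>y\<bar>) ^ 3" by (intro power_mono abs_triangle_ineq) simp
  ultimately show ?thesis by linarith
qed

text \<open>The displacement a t + \<sigma> sqrt t z has mean a t and second moment a^2 t^2 +
  \<sigma>^2 t, so integrating the Taylor expansion reproduces exactly these two terms and only the
  integrated remainder is left.\<close>

lemma heat_taylor: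
  assumes J: "jet2 B \<delta> C \<phi> \<phi>1 \<phi>2" and "\<delta> \<ge> 0" "C \<ge> 0" "\<sigma> \<ge> 0" "t \<ge> 0"
  shows "\<bar>heat a \<sigma> t \<phi> y - \<phi> y - a * t * \<phi>1 y - (a\<^sup>2 * t\<^sup>2 + \<sigma>\<^sup>2 * t) / 2 * \<phi>2 y\<bar>
    \<le> \<delta> * (a\<^sup>2 * t\<^sup>2 + \<sigma>\<^sup>2 * t)
      + C * (4 * (\<bar>a * t\<bar> ^ 3 + (\<sigma> * sqrt t) ^ 3 * (\<integral>z. \<bar>z\<bar> ^ 3 \<partial>std_normal_distribution)))"
proof -
  let ?N = "std_normal_distribution"
  interpret prob_space ?N by (rule prob_space_std_normal)
  define s where "s = \<sigma> * sqrt t"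
  define h where "h z = a * t + s * z" for z
  have s: "s \<ge> 0" "s\<^sup>2 = \<sigma>\<^sup>2 * t" using assms by (auto simp: s_def power_mult_distrib)
  note [simp] = std_normal_moments
  have m[measurable]: "\<phi> \<in> borel_measurable borel"
    and b: "\<And>y. \<bar>\<phi> y\<bar> \<le> B"
    and J': "\<And>y h. \<bar>\<phi> (y + h) - \<phi> y - h * \<phi>1 y - h\<^sup>2 / 2 * \<phi>2 y\<bar> \<le> \<delta> * h\<^sup>2 + C * \<bar>h\<bar> ^ 3"
    using J by (auto simp: jet2_def)
  have i[simp]: "integrable ?N (\<lambda>z. \<phi> (y + h z))" unfolding h_def by (rule integrable_heat[OF m b])
  have h1[simp]: "integrable ?N h" "(\<integral>z. h z \<partial>?N) = a * t"
    unfolding h_def[abs_def] using prob_space by simp_all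
  have h2eq: "(h z)\<^sup>2 = a\<^sup>2 * t\<^sup>2 + 2 * a * t * s * z + s\<^sup>2 * z\<^sup>2" for z
    by (simp add: h_def power2_eq_square algebra_simps)
  have h2[simp]: "integrable ?N (\<lambda>z. (h z)\<^sup>2)" "(\<integral>z. (h z)\<^sup>2 \<partial>?N) = a\<^sup>2 * t\<^sup>2 + s\<^sup>2"
    unfolding h2eq using prob_space by simp_all
  have h3le: "\<bar>h z\<bar> ^ 3 \<le> 4 * (\<bar>a * t\<bar> ^ 3 + s ^ 3 * \<bar>z\<bar> ^ 3)" for z
    using abs_add_cubed_le[of "a * t" "s * z"] s by (simp add: h_def abs_mult power_mult_distrib)
  have i3[simp]: "integrable ?N (\<lambda>z. 4 * (\<bar>a * t\<bar> ^ 3 + s ^ 3 * \<bar>z\<bar> ^ 3))" by simp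
  have h3[simp]: "integrable ?N (\<lambda>z. \<bar>h z\<bar> ^ 3)"
    by (rule Bochner_Integration.integrable_bound[OF i3]) (use h3le s in \<open>auto simp: h_def[abs_def]\<close>)
  let ?R = "\<lambda>z. \<phi> (y + h z) - \<phi> y - h z * \<phi>1 y - (h z)\<^sup>2 / 2 * \<phi>2 y"
  have iR: "integrable ?N ?R" by simp
  have "heat a \<sigma> t \<phi> y = (\<integral>z. \<phi> (y + h z) \<partial>?N)" by (simp add: heat_def h_def s_def)
  then have eq: "heat a \<sigma> t \<phi> y - \<phi> y - a * t * \<phi>1 y - (a\<^sup>2 * t\<^sup>2 + \<sigma>\<^sup>2 * t) / 2 * \<phi>2 y = (\<integral>z. ?R z \<partial>?N)"
    using prob_space by (simp add: s(2))
  have "\<bar>heat a \<sigma> t \<phi> y - \<phi> y - a * t * \<phi>1 y - (a\<^sup>2 * t\<^sup>2 + \<sigma>\<^sup>2 * t) / 2 * \<phi>2 y\<bar>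
      \<le> (\<integral>z. \<bar>?R z\<bar> \<partial>?N)"
    unfolding eq by (rule integral_abs_bound)
  also have "\<dots> \<le> (\<integral>z. \<delta> * (h z)\<^sup>2 + C * (4 * (\<bar>a * t\<bar> ^ 3 + s ^ 3 * \<bar>z\<bar> ^ 3)) \<partial>?N)"
  proof (rule integral_mono)
    show "integrable ?N (\<lambda>z. \<bar>?R z\<bar>)" using iR by (rule integrable_abs)
    show "\<bar>?R z\<bar> \<le> \<delta> * (h z)\<^sup>2 + C * (4 * (\<bar>a * t\<bar> ^ 3 + s ^ 3 * \<bar>z\<bar> ^ 3))" for z
      by (rule order_trans[OF J']) (intro add_left_mono mult_left_mono h3le \<open>C \<ge> 0\<close>)
  qed simp
  also have "\<dots> = \<delta> * (a\<^sup>2 * t\<^sup>2 + \<sigma>\<^sup>2 * t)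
      + C * (4 * (\<bar>a * t\<bar> ^ 3 + s ^ 3 * (\<integral>z. \<bar>z\<bar> ^ 3 \<partial>?N)))"
    using prob_space by (simp add: s(2))
  finally show ?thesis unfolding s_def .
qed

lemma two_point_taylor:
  assumes J: "jet2 B \<delta> C \<phi> \<phi>1 \<phi>2" and "0 \<le> q" "q \<le> 1"
  shows "\<bar>two_point q v w \<phi> y - \<phi> y - (q * v + (1 - q) * w) * \<phi>1 y - (q * v\<^sup>2 + (1 - q) * w\<^sup>2) / 2 * \<phi>2 y\<bar>
    \<le> \<delta> * (q * v\<^sup>2 + (1 - q) * w\<^sup>2) + C * (q * \<bar>v\<bar> ^ 3 + (1 - q) * \<bar>w\<bar> ^ 3)"
proof -
  define R where "R h = \<phi> (y + h) - \<phi> y - h * \<phi>1 y - h\<^sup>2 / 2 * \<phi>2 y" for h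
  have R: "\<bar>R h\<bar> \<le> \<delta> * h\<^sup>2 + C * \<bar>h\<bar> ^ 3" for h using J by (auto simp: jet2_def R_def)
  have "two_point q v w \<phi> y - \<phi> y - (q * v + (1 - q) * w) * \<phi>1 y - (q * v\<^sup>2 + (1 - q) * w\<^sup>2) / 2 * \<phi>2 y
    = q * R v + (1 - q) * R w"
    by (simp add: two_point_def R_def field_simps)
  also have "\<bar>\<dots>\<bar> \<le> q * \<bar>R v\<bar> + (1 - q) * \<bar>R w\<bar>"
    using assms by (intro order_trans[OF abs_triangle_ineq]) (simp add: abs_mult)
  also have "\<dots> \<le> q * (\<delta> * v\<^sup>2 + C * \<bar>v\<bar> ^ 3) + (1 - q) * (\<delta> * w\<^sup>2 + C * \<bar>w\<bar> ^ 3)"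
    using assms by (intro add_mono mult_left_mono R) auto
  finally show ?thesis by (simp add: algebra_simps)
qed

text \<open>Both operators are expanded at the same point with the same \<open>\<phi>1\<close> and
  \<open>\<phi>2\<close>. What remains is the mismatch of the first two moments, weighted by the
  bound on these functions, and the two remainders.\<close>

lemma two_point_heat_diff:
  assumes J: "jet2 B \<delta> C \<phi> \<phi>1 \<phi>2" and "0 \<le> q" "q \<le> 1" and "\<delta> \<ge> 0" "C \<ge> 0" "\<sigma> \<ge> 0" "t \<ge> 0"
  shows "\<bar>two_point q v w \<phi> y - heat a \<sigma> t \<phi> y\<bar>
    \<le> B * \<bar>q * v + (1 - q) * w - a * t\<bar>
      + B / 2 * \<bar>q * v\<^sup>2 + (1 - q) * w\<^sup>2 - (a\<^sup>2 * t\<^sup>2 + \<sigma>\<^sup>2 * t)\<bar>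
      + \<delta> * (q * v\<^sup>2 + (1 - q) * w\<^sup>2 + (a\<^sup>2 * t\<^sup>2 + \<sigma>\<^sup>2 * t))
      + C * (q * \<bar>v\<bar> ^ 3 + (1 - q) * \<bar>w\<bar> ^ 3
          + 4 * (\<bar>a * t\<bar> ^ 3 + (\<sigma> * sqrt t) ^ 3 * (\<integral>z. \<bar>z\<bar> ^ 3 \<partial>std_normal_distribution)))"
proof -
  define e1 where "e1 = q * v + (1 - q) * w - a * t"
  define e2 where "e2 = q * v\<^sup>2 + (1 - q) * w\<^sup>2 - (a\<^sup>2 * t\<^sup>2 + \<sigma>\<^sup>2 * t)"
  define P where "P = two_point q v w \<phi> y - \<phi> y - (q * v + (1 - q) * w) * \<phi>1 y
    - (q * v\<^sup>2 + (1 - q) * w\<^sup>2) / 2 * \<phi>2 y"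
  define H where "H = heat a \<sigma> t \<phi> y - \<phi> y - a * t * \<phi>1 y - (a\<^sup>2 * t\<^sup>2 + \<sigma>\<^sup>2 * t) / 2 * \<phi>2 y"
  have "\<bar>\<phi>1 y\<bar> \<le> B" "\<bar>\<phi>2 y\<bar> \<le> B" using J by (auto simp: jet2_def)
  then have e: "\<bar>e1 * \<phi>1 y\<bar> \<le> B * \<bar>e1\<bar>" "\<bar>e2 / 2 * \<phi>2 y\<bar> \<le> B / 2 * \<bar>e2\<bar>"
    using mult_right_mono[of "\<bar>\<phi>1 y\<bar>" B "\<bar>e1\<bar>"] mult_right_mono[of "\<bar>\<phi>2 y\<bar>" B "\<bar>e2\<bar>"]
    by (simp_all add: abs_mult mult.commute)
  have "two_point q v w \<phi> y - heat a \<sigma> t \<phi> y = e1 * \<phi>1 y + e2 / 2 * \<phi>2 y + P - H"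
    unfolding e1_def e2_def P_def H_def by (simp add: field_simps)
  also have "\<bar>\<dots>\<bar> \<le> \<bar>e1 * \<phi>1 y\<bar> + \<bar>e2 / 2 * \<phi>2 y\<bar> + \<bar>P\<bar> + \<bar>H\<bar>" by linarith
  also have "\<dots> \<le> B * \<bar>e1\<bar> + B / 2 * \<bar>e2\<bar>
      + (\<delta> * (q * v\<^sup>2 + (1 - q) * w\<^sup>2) + C * (q * \<bar>v\<bar> ^ 3 + (1 - q) * \<bar>w\<bar> ^ 3))
      + (\<delta> * (a\<^sup>2 * t\<^sup>2 + \<sigma>\<^sup>2 * t)
         + C * (4 * (\<bar>a * t\<bar> ^ 3 + (\<sigma> * sqrt t) ^ 3 * (\<integral>z. \<bar>z\<bar> ^ 3 \<partial>std_normal_distribution))))"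
    unfolding P_def H_def
    by (intro add_mono e two_point_taylor[OF J assms(2,3)] heat_taylor[OF J assms(4-7)])
  finally show ?thesis
    unfolding e1_def[symmetric] e2_def[symmetric] distrib_left[of \<delta>] distrib_left[of C] by argo
qed

text \<open>Lindeberg's telescoping: the assumption compares one step of the two semigroups along the
  orbit of the second one only.\<close>

lemma two_point_heat_telescope:
  assumes q: "0 \<le> q" "q \<le> 1" and "t \<ge> 0"
    and K: "K \<in> borel_measurable borel" "\<And>y. \<bar>K y\<bar> \<le> B"
    and step: "\<And>j y. \<bar>two_point q v w (heat a \<sigma> (real j * t) K) y
                     - heat a \<sigma> t (heat a \<sigma> (real j * t) K) y\<bar> \<le> e"
  shows "\<bar>(two_point q v w ^^ n) K y - heat a \<sigma> (real n * t) K y\<bar> \<le> real n * e"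
proof (induction n arbitrary: y)
  case (Suc n)
  let ?D = "\<lambda>y. (two_point q v w ^^ n) K y - heat a \<sigma> (real n * t) K y"
  have "heat a \<sigma> t (heat a \<sigma> (real n * t) K) = heat a \<sigma> (real (Suc n) * t) K"
    using heat_add[OF K, of t "real n * t" a \<sigma>] \<open>t \<ge> 0\<close> by (simp add: algebra_simps)
  \<comment> \<open>The error of the first n steps is averaged with weights q and 1 - q, which
    cannot enlarge it; the second summand is one fresh step.\<close>
  then have "(two_point q v w ^^ Suc n) K y - heat a \<sigma> (real (Suc n) * t) K y
     = (q * ?D (y + v) + (1 - q) * ?D (y + w))
       + (two_point q v w (heat a \<sigma> (real n * t) K) y - heat a \<sigma> t (heat a \<sigma> (real n * t) K) y)"
    by (simp add: two_point_def algebra_simps)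
  also have "\<bar>\<dots>\<bar> \<le> real n * e + e"
    by (intro order_trans[OF abs_triangle_ineq] add_mono step convex_abs_bound q Suc.IH)
  finally show ?case by (simp add: algebra_simps)
qed simp

text \<open>All errors are measured against p^2, the time step, because about T / p^2 of them are
  added. In the application \<open>\<kappa>\<close> is minus the market price of risk, which makes
  the drift risk neutral.\<close>

lemma log_factor_asymptotics:
  fixes \<kappa> \<mu> \<sigma> a r c :: real
  assumes "\<sigma> > 0"
  defines "v \<equiv> \<lambda>p. ln (1 + \<sigma> * p + \<mu> * p\<^sup>2)" and "w \<equiv> \<lambda>p. ln (1 - \<sigma> * p + \<mu> * p\<^sup>2)"
    and "q \<equiv> \<lambda>p. 1/2 + 1/2 * \<kappa> * p"
  shows "((\<lambda>p. (q p * v p + (1 - q p) * w p - (\<mu> + \<kappa> * \<sigma> - \<sigma>\<^sup>2 / 2) * p\<^sup>2) / p\<^sup>2) \<longlongrightarrow> 0) (at_right 0)" (is ?a)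
    and "((\<lambda>p. (q p * (v p)\<^sup>2 + (1 - q p) * (w p)\<^sup>2) / p\<^sup>2) \<longlongrightarrow> \<sigma>\<^sup>2) (at_right 0)" (is ?b)
    and "((\<lambda>p. (q p * \<bar>v p\<bar> ^ 3 + (1 - q p) * \<bar>w p\<bar> ^ 3) / p\<^sup>2) \<longlongrightarrow> 0) (at_right 0)" (is ?c)
    and "((\<lambda>p. (4 * (\<bar>a * p\<^sup>2\<bar> ^ 3 + (\<sigma> * p) ^ 3 * c)) / p\<^sup>2) \<longlongrightarrow> 0) (at_right 0)" (is ?d)
proof -
  show ?a unfolding q_def v_def w_def using assms(1) by (real_asymp simp: power2_eq_square)
  show ?b unfolding q_def v_def w_def using assms(1) by (real_asymp simp: power2_eq_square)
  show ?c unfolding q_def v_def w_def using assms(1) by (real_asymp simp: power2_eq_square)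
  have "((\<lambda>p. 4 * \<bar>a\<bar> ^ 3 * p ^ 4 + 4 * \<sigma> ^ 3 * c * p) \<longlongrightarrow> 0) (at_right 0)"
    by (auto intro!: tendsto_eq_intros)
  then show ?d
  proof (rule Lim_transform_eventually)
    show "\<forall>\<^sub>F p in at_right 0. 4 * \<bar>a\<bar> ^ 3 * p ^ 4 + 4 * \<sigma> ^ 3 * c * p
        = (4 * (\<bar>a * p\<^sup>2\<bar> ^ 3 + (\<sigma> * p) ^ 3 * c)) / p\<^sup>2"
      by (rule eventually_mono[OF eventually_at_right_less])
         (simp add: abs_mult power_mult_distrib field_simps power2_eq_square power3_eq_cube power4_eq_xxxx)
  qed
qed


text \<open>Here \<open>p\<close> is the square root of the time step.\<close>

lemma two_point_heat_limit:
  fixes \<kappa> \<mu> \<sigma> T \<eta> :: real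
  defines "v \<equiv> \<lambda>p. ln (1 + \<sigma> * p + \<mu> * p\<^sup>2)" and "w \<equiv> \<lambda>p. ln (1 - \<sigma> * p + \<mu> * p\<^sup>2)"
    and "q \<equiv> \<lambda>p. 1/2 + 1/2 * \<kappa> * p" and "a \<equiv> \<mu> + \<kappa> * \<sigma> - \<sigma>\<^sup>2 / 2"
  assumes "\<sigma> > 0" "T > 0" "\<eta> > 0"
    and J: "\<And>\<delta>. \<delta> > 0 \<Longrightarrow> \<exists>C\<ge>0. jet2 B \<delta> C K K1 K2"
  shows "\<forall>\<^sub>F p in at_right 0. \<forall>n y. real n * p\<^sup>2 \<le> T \<longrightarrow>
     \<bar>(two_point (q p) (v p) (w p) ^^ n) K y - heat a \<sigma> (real n * p\<^sup>2) K y\<bar> \<le> \<eta>"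
proof -
  \<comment> \<open>Two-point and Gaussian second moments are both close to \<sigma>^2 p^2, so
    \<open>\<delta>\<close> costs about 2 \<delta> \<sigma>^2 p^2 = \<eta> / (2 T) p^2 per step.
    That is half of the admissible \<eta> / T p^2 and leaves room for the vanishing terms.\<close>
  define \<delta> where "\<delta> = \<eta> / (4 * T * \<sigma>\<^sup>2)"
  have "\<delta> > 0" using assms by (simp add: \<delta>_def)
  then obtain C where "C \<ge> 0" and JC: "jet2 B \<delta> C K K1 K2" using J by blast
  define c where "c = (\<integral>z. \<bar>z\<bar> ^ 3 \<partial>std_normal_distribution)"
  define E1 where "E1 p = q p * v p + (1 - q p) * w p - a * p\<^sup>2" for p
  define E2 where "E2 p = q p * (v p)\<^sup>2 + (1 - q p) * (w p)\<^sup>2" for p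
  define E3 where "E3 p = q p * \<bar>v p\<bar> ^ 3 + (1 - q p) * \<bar>w p\<bar> ^ 3" for p
  define E4 where "E4 p = 4 * (\<bar>a * p\<^sup>2\<bar> ^ 3 + (\<sigma> * p) ^ 3 * c)" for p
  define N2 where "N2 p = a\<^sup>2 * (p\<^sup>2)\<^sup>2 + \<sigma>\<^sup>2 * p\<^sup>2" for p
  define E where "E p = B * \<bar>E1 p\<bar> + B / 2 * \<bar>E2 p - N2 p\<bar> + \<delta> * (E2 p + N2 p) + C * (E3 p + E4 p)" for p
  note L = log_factor_asymptotics[OF \<open>\<sigma> > 0\<close>]
  have L1: "((\<lambda>p. E1 p / p\<^sup>2) \<longlongrightarrow> 0) (at_right 0)" and L2: "((\<lambda>p. E2 p / p\<^sup>2) \<longlongrightarrow> \<sigma>\<^sup>2) (at_right 0)"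
    and L3: "((\<lambda>p. E3 p / p\<^sup>2) \<longlongrightarrow> 0) (at_right 0)" and L4: "((\<lambda>p. E4 p / p\<^sup>2) \<longlongrightarrow> 0) (at_right 0)"
    using L(1-3)[where \<kappa> = \<kappa> and \<mu> = \<mu>] L(4)[where a = a and c = c]
    unfolding E1_def E2_def E3_def E4_def v_def w_def q_def a_def .
  have pos: "\<forall>\<^sub>F p::real in at_right 0. 0 < p" by (rule eventually_at_right_less)
  have N2: "((\<lambda>p. N2 p / p\<^sup>2) \<longlongrightarrow> \<sigma>\<^sup>2) (at_right 0)"
  proof (rule Lim_transform_eventually)
    show "((\<lambda>p. a\<^sup>2 * p\<^sup>2 + \<sigma>\<^sup>2) \<longlongrightarrow> \<sigma>\<^sup>2) (at_right 0)" by (auto intro!: tendsto_eq_intros)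
    show "\<forall>\<^sub>F p in at_right 0. a\<^sup>2 * p\<^sup>2 + \<sigma>\<^sup>2 = N2 p / p\<^sup>2"
      by (rule eventually_mono[OF pos]) (simp add: N2_def field_simps power2_eq_square)
  qed
  have "((\<lambda>p. B * \<bar>E1 p / p\<^sup>2\<bar> + B / 2 * \<bar>E2 p / p\<^sup>2 - N2 p / p\<^sup>2\<bar> + \<delta> * (E2 p / p\<^sup>2 + N2 p / p\<^sup>2)
      + C * (E3 p / p\<^sup>2 + E4 p / p\<^sup>2)) \<longlongrightarrow> B * \<bar>0\<bar> + B / 2 * \<bar>\<sigma>\<^sup>2 - \<sigma>\<^sup>2\<bar> + \<delta> * (\<sigma>\<^sup>2 + \<sigma>\<^sup>2) + C * (0 + 0)) (at_right 0)"
    by (intro tendsto_intros L1 L2 L3 L4 N2)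
  moreover have "\<delta> * (\<sigma>\<^sup>2 + \<sigma>\<^sup>2) = \<eta> / (2 * T)" using assms by (simp add: \<delta>_def field_simps)
  ultimately have "((\<lambda>p. B * \<bar>E1 p / p\<^sup>2\<bar> + B / 2 * \<bar>E2 p / p\<^sup>2 - N2 p / p\<^sup>2\<bar> + \<delta> * (E2 p / p\<^sup>2 + N2 p / p\<^sup>2)
      + C * (E3 p / p\<^sup>2 + E4 p / p\<^sup>2)) \<longlongrightarrow> \<eta> / (2 * T)) (at_right 0)" by simp
  moreover have "\<eta> / (2 * T) < \<eta> / T" using assms by (simp add: field_simps)
  ultimately have "\<forall>\<^sub>F p in at_right 0. B * \<bar>E1 p / p\<^sup>2\<bar> + B / 2 * \<bar>E2 p / p\<^sup>2 - N2 p / p\<^sup>2\<bar>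
      + \<delta> * (E2 p / p\<^sup>2 + N2 p / p\<^sup>2) + C * (E3 p / p\<^sup>2 + E4 p / p\<^sup>2) < \<eta> / T"
    by (rule order_tendstoD)
  moreover have "\<forall>\<^sub>F p in at_right 0. 0 < q p" "\<forall>\<^sub>F p in at_right 0. q p < 1"
  proof -
    have "(q \<longlongrightarrow> 1/2) (at_right 0)" unfolding q_def by (auto intro!: tendsto_eq_intros)
    then show "\<forall>\<^sub>F p in at_right 0. 0 < q p" "\<forall>\<^sub>F p in at_right 0. q p < 1" by (auto intro: order_tendstoD)
  qed
  ultimately show ?thesis using pos
  proof eventually_elim
    case (elim p)
    have "E p / p\<^sup>2 = B * \<bar>E1 p / p\<^sup>2\<bar> + B / 2 * \<bar>E2 p / p\<^sup>2 - N2 p / p\<^sup>2\<bar>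
      + \<delta> * (E2 p / p\<^sup>2 + N2 p / p\<^sup>2) + C * (E3 p / p\<^sup>2 + E4 p / p\<^sup>2)"
      unfolding E_def diff_divide_distrib[symmetric] add_divide_distrib[symmetric] abs_divide
      by (simp add: add_divide_distrib distrib_left)
    then have "E p / p\<^sup>2 < \<eta> / T" using elim(1) by (simp only:)
    then have Ep: "E p \<le> \<eta> / T * p\<^sup>2" using elim(4) by (simp add: pos_divide_less_eq)
    have m: "K \<in> borel_measurable borel" and b: "\<And>y. \<bar>K y\<bar> \<le> B" using JC by (auto simp: jet2_def)
    \<comment> \<open>The heat semigroup preserves the Taylor bounds with the same constants, so a
      single \<open>E p\<close> serves along the whole orbit.\<close>
    have step: "\<bar>two_point (q p) (v p) (w p) (heat a \<sigma> (real j * p\<^sup>2) K) y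
                     - heat a \<sigma> (p\<^sup>2) (heat a \<sigma> (real j * p\<^sup>2) K) y\<bar> \<le> E p" for j y
      using two_point_heat_diff[OF jet2_heat[OF JC], of "q p" \<sigma> "p\<^sup>2" "v p" "w p" a \<sigma> "real j * p\<^sup>2" y]
        elim \<open>\<delta> > 0\<close> \<open>C \<ge> 0\<close> \<open>\<sigma> > 0\<close>
      unfolding E_def E1_def E2_def E3_def E4_def N2_def c_def by simp
    show ?case
    proof (intro allI impI)
      fix n y assume n: "real n * p\<^sup>2 \<le> T"
      have "\<bar>(two_point (q p) (v p) (w p) ^^ n) K y - heat a \<sigma> (real n * p\<^sup>2) K y\<bar> \<le> real n * E p"
        by (rule two_point_heat_telescope[OF _ _ _ m b step]) (use elim in auto)
      also have "\<dots> \<le> real n * (\<eta> / T * p\<^sup>2)" using Ep by (intro mult_left_mono) auto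
      also have "\<dots> = \<eta> / T * (real n * p\<^sup>2)" by simp
      also have "\<dots> \<le> \<eta> / T * T" using n assms by (intro mult_left_mono) auto
      finally show "\<bar>(two_point (q p) (v p) (w p) ^^ n) K y - heat a \<sigma> (real n * p\<^sup>2) K y\<bar> \<le> \<eta>"
        using assms by simp
    qed
  qed
qed

section \<open>Payoffs in logarithmic coordinates\<close>

text \<open>Taylor's formula in Lagrange form: the remainder is the second derivative at an
  intermediate point, which can be compared with its value at y by uniform continuity.\<close>

lemma second_order_mean_value:
  fixes K K1 K2 :: "real \<Rightarrow> real"
  assumes "\<And>y. (K has_real_derivative K1 y) (at y)" "\<And>y. (K1 has_real_derivative K2 y) (at y)"
  obtains \<xi> where "\<bar>\<xi> - y\<bar> \<le> \<bar>h\<bar>" "K (y + h) - K y - h * K1 y = h\<^sup>2 / 2 * K2 \<xi>"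
proof (cases "h = 0")
  case True
  then show ?thesis using that[of y] by simp
next
  case False
  define D where "D m = (if m = 0 then K else if m = Suc 0 then K1 else K2)" for m :: nat
  have "\<exists>t. (if y + h < y then y + h < t \<and> t < y else y < t \<and> t < y + h) \<and>
      K (y + h) = (\<Sum>m<2. (D m y / fact m) * ((y + h) - y) ^ m) + (D 2 t / fact 2) * ((y + h) - y)\<^sup>2"
    using False assms
    by (intro Taylor[where a = "min y (y + h)" and b = "max y (y + h)"]) (auto simp: D_def less_Suc_eq numeral_2_eq_2)
  then obtain t where t: "if y + h < y then y + h < t \<and> t < y else y < t \<and> t < y + h"
    "K (y + h) = (\<Sum>m<2. (D m y / fact m) * ((y + h) - y) ^ m) + (D 2 t / fact 2) * ((y + h) - y)\<^sup>2"
    by blast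
  show ?thesis
  proof (rule that)
    show "\<bar>t - y\<bar> \<le> \<bar>h\<bar>" using t(1) by (auto split: if_splits)
    show "K (y + h) - K y - h * K1 y = h\<^sup>2 / 2 * K2 t"
      using t(2) by (simp add: D_def numeral_2_eq_2 field_simps)
  qed
qed

text \<open>Beyond a bound of the support \<open>g\<close> is 0 on an open half line, hence so are
  its derivatives; there the one-sided derivatives are two-sided and therefore unique.\<close>

lemma C2c_plus_vanish:
  assumes "C2c_plus g"
  obtains R where "R > 0" "\<And>s. s > R \<Longrightarrow> g s = 0" "\<And>s. s > R \<Longrightarrow> D_plus g s = 0"
    "\<And>s. s > R \<Longrightarrow> D_plus (D_plus g) s = 0"
proof -
  have "bounded (closure {s \<in> {0..}. g s \<noteq> 0})"
    using assms by (auto simp: C2c_plus_def intro: compact_imp_bounded)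
  then have "bounded {s \<in> {0..}. g s \<noteq> 0}" by (rule bounded_subset) (rule closure_subset)
  then obtain R where R: "R > 0" "\<And>s. s \<in> {0..} \<Longrightarrow> g s \<noteq> 0 \<Longrightarrow> \<bar>s\<bar> \<le> R"
    unfolding bounded_pos by auto
  have g0: "g s = 0" if "s > R" for s using R(2)[of s] R(1) that by force
  have vanish: "f' s = 0" if f: "\<And>s. s > R \<Longrightarrow> f s = 0" and d: "(f has_real_derivative f' s) (at s)" and s: "s > R"
    for f f' :: "real \<Rightarrow> real" and s
  proof -
    have "(f has_real_derivative 0) (at s)"
      by (rule has_field_derivative_transform_within_open[where f = "\<lambda>_. 0" and S = "{R<..}"]) (use f s in auto)
    then show ?thesis using d by (rule DERIV_unique[symmetric])
  qed
  have g1: "D_plus g s = 0" if "s > R" for s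
    using vanish[of g "D_plus g" s] g0 C2c_plus_derivs_pos(1)[OF assms] that R(1) by auto
  have g2: "D_plus (D_plus g) s = 0" if "s > R" for s
    using vanish[of "D_plus g" "D_plus (D_plus g)" s] g1 C2c_plus_derivs_pos(2)[OF assms] that R(1) by auto
  show ?thesis using that R(1) g0 g1 g2 by blast
qed

lemma uniformly_continuous_on_compose_subset:
  fixes f :: "'a::metric_space \<Rightarrow> 'b::metric_space" and g :: "'b \<Rightarrow> 'c::metric_space"
  assumes "uniformly_continuous_on A f" "f ` A \<subseteq> B" "uniformly_continuous_on B g"
  shows "uniformly_continuous_on A (\<lambda>x. g (f x))"
proof -
  have "uniformly_continuous_on (f ` A) g"
    unfolding uniformly_continuous_on_def
  proof (intro allI impI)
    fix e :: real assume "e > 0"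
    then obtain d where d: "d > 0" "\<forall>x\<in>B. \<forall>x'\<in>B. dist x' x < d \<longrightarrow> dist (g x') (g x) < e"
      using assms(3) unfolding uniformly_continuous_on_def by metis
    with assms(2) show "\<exists>d>0. \<forall>x\<in>f ` A. \<forall>x'\<in>f ` A. dist x' x < d \<longrightarrow> dist (g x') (g x) < e"
      by (intro exI[of _ d]) (simp add: subset_iff)
  qed
  then show ?thesis by (rule uniformly_continuous_on_compose[OF assms(1)])
qed

text \<open>Continuous functions of compact support on the half line, read in logarithmic coordinates, are
  bounded and uniformly continuous: \<open>exp y\<close> may be cut off at the end of the support, where
  it becomes Lipschitz in \<open>y\<close>.\<close>

lemma vanishing_comp_exp:
  fixes \<phi> :: "real \<Rightarrow> real"
  assumes "continuous_on {0..} \<phi>" "R > 0" "\<And>s. s > R \<Longrightarrow> \<phi> s = 0"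
  shows "\<exists>B. \<forall>y. \<bar>\<phi> (exp y)\<bar> \<le> B" and "uniformly_continuous_on UNIV (\<lambda>y. \<phi> (exp y))"
proof -
  \<comment> \<open>R + 1 and not R: vanishing is assumed only strictly above R, and the cut-off
    value \<open>exp L\<close> has to lie there already.\<close>
  define L where "L = ln (R + 1)"
  have eL: "exp L = R + 1" using assms(2) by (simp add: L_def)
  have cut: "\<phi> (exp y) = \<phi> (exp (min y L))" for y
    using assms(2,3) eL by (cases "y \<le> L") (auto simp: min_def not_le, metis exp_less_cancel_iff less_add_one less_trans)
  have c: "continuous_on {0..R+1} \<phi>" using assms(1) by (rule continuous_on_subset) auto
  have mem: "exp (min y L) \<in> {0..R+1}" for y by (auto simp flip: eL)
  have "bounded (\<phi> ` {0..R+1})" using c by (intro compact_imp_bounded compact_continuous_image) auto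
  then obtain B where "\<And>s. s \<in> {0..R+1} \<Longrightarrow> \<bar>\<phi> s\<bar> \<le> B"
    unfolding bounded_iff by (metis image_eqI real_norm_def)
  then show "\<exists>B. \<forall>y. \<bar>\<phi> (exp y)\<bar> \<le> B" using cut mem by metis
  have e: "uniformly_continuous_on {..L} (exp :: real \<Rightarrow> real)"
  unfolding uniformly_continuous_on_def
  proof (intro allI impI)
    fix e :: real assume "e > 0"
    show "\<exists>d>0. \<forall>x\<in>{..L}. \<forall>x'\<in>{..L}. dist x' x < d \<longrightarrow> dist (exp x') (exp x) < e"
    proof (intro exI conjI ballI impI)
      show "e / exp L > 0" using \<open>e > 0\<close> by simp
      fix x x' assume "x \<in> {..L}" "x' \<in> {..L}" "dist x' x < e / exp L"
      moreover have "norm (exp x' - exp x) \<le> exp L * norm (x' - x)" if "x \<in> {..L}" "x' \<in> {..L}"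
        by (rule field_differentiable_bound[of "{..L}" exp exp]) (use that in \<open>auto intro!: derivative_eq_intros\<close>)
      ultimately show "dist (exp x') (exp x) < e"
        by (simp add: dist_norm) (smt (verit) exp_gt_zero mult.commute pos_less_divide_eq)
    qed
  qed
  have m: "uniformly_continuous_on UNIV (\<lambda>y. min y L)"
    unfolding uniformly_continuous_on_def dist_real_def by (smt (verit) min_def)
  have f: "uniformly_continuous_on {0..R+1} \<phi>"
    using c by (rule compact_uniformly_continuous) auto
  have "uniformly_continuous_on UNIV (\<lambda>y. exp (min y L))"
    using m _ e by (rule uniformly_continuous_on_compose_subset) auto
  then have "uniformly_continuous_on UNIV (\<lambda>y. \<phi> (exp (min y L)))"
    using _ f by (rule uniformly_continuous_on_compose_subset) (use mem in auto)
  then show "uniformly_continuous_on UNIV (\<lambda>y. \<phi> (exp y))"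
    unfolding cut[symmetric] .
qed

text \<open>For |h| < d, with d from uniform continuity, the second derivative moves by less than
  \<open>\<delta>\<close>. For |h| \<ge> d its bound B is at most B |h| / d, which goes into the
  cubic term. This is the origin of C = B / d.\<close>

lemma uniformly_continuous_second_deriv_jets:
  fixes K K1 K2 :: "real \<Rightarrow> real"
  assumes D1: "\<And>y. (K has_real_derivative K1 y) (at y)" and D2: "\<And>y. (K1 has_real_derivative K2 y) (at y)"
    and b: "\<And>y. \<bar>K y\<bar> \<le> B" "\<And>y. \<bar>K1 y\<bar> \<le> B" "\<And>y. \<bar>K2 y\<bar> \<le> B"
    and u: "uniformly_continuous_on UNIV K2"
  shows "jet1 B K K1" and "\<delta> > 0 \<Longrightarrow> \<exists>C\<ge>0. jet2 B \<delta> C K K1 K2"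
proof -
  have "continuous_on UNIV K" "continuous_on UNIV K1" "continuous_on UNIV K2"
    using D1 D2 u by (auto intro: DERIV_continuous_on uniformly_continuous_imp_continuous)
  then have m: "K \<in> borel_measurable borel" "K1 \<in> borel_measurable borel" "K2 \<in> borel_measurable borel"
    by (auto intro: borel_measurable_continuous_onI)
  have "B \<ge> 0" using b(1)[of 0] by auto
  show "jet1 B K K1"
    unfolding jet1_def
  proof (intro conjI allI m b)
    fix y h
    obtain \<xi> where "K (y + h) - K y - h * K1 y = h\<^sup>2 / 2 * K2 \<xi>"
      using second_order_mean_value[of K K1 K2 y h] D1 D2 by blast
    then have "\<bar>K (y + h) - K y - h * K1 y\<bar> = h\<^sup>2 * (\<bar>K2 \<xi>\<bar> / 2)" by (simp only: abs_mult) simp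
    also have "\<dots> \<le> h\<^sup>2 * B" using b(3)[of \<xi>] by (intro mult_left_mono) auto
    finally show "\<bar>K (y + h) - K y - h * K1 y\<bar> \<le> B * h\<^sup>2" by (simp add: mult.commute)
  qed
  show "\<exists>C\<ge>0. jet2 B \<delta> C K K1 K2" if "\<delta> > 0"
  proof -
    obtain d where "d > 0" and d: "\<And>x x'. dist x' x < d \<Longrightarrow> dist (K2 x') (K2 x) < \<delta>"
      using u \<open>\<delta> > 0\<close> unfolding uniformly_continuous_on_def by (metis UNIV_I)
    have "\<bar>K (y + h) - K y - h * K1 y - h\<^sup>2 / 2 * K2 y\<bar> \<le> \<delta> * h\<^sup>2 + B / d * \<bar>h\<bar> ^ 3" for y h
    proof -
      obtain \<xi> where \<xi>: "\<bar>\<xi> - y\<bar> \<le> \<bar>h\<bar>" "K (y + h) - K y - h * K1 y = h\<^sup>2 / 2 * K2 \<xi>"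
        using second_order_mean_value[of K K1 K2 y h] D1 D2 by blast
      have eq: "\<bar>K (y + h) - K y - h * K1 y - h\<^sup>2 / 2 * K2 y\<bar> = h\<^sup>2 / 2 * \<bar>K2 \<xi> - K2 y\<bar>"
        unfolding \<xi>(2) right_diff_distrib[symmetric] by (simp add: abs_mult)
      have "\<bar>K2 \<xi> - K2 y\<bar> / 2 \<le> \<delta> + B / d * \<bar>h\<bar>"
      proof (cases "\<bar>h\<bar> < d")
        case True
        then have *: "\<bar>K2 \<xi> - K2 y\<bar> < \<delta>" using d[of \<xi> y] \<xi>(1) by (simp add: dist_real_def)
        have "\<bar>K2 \<xi> - K2 y\<bar> / 2 \<le> \<bar>K2 \<xi> - K2 y\<bar>" by simp
        also note *
        also have "\<delta> \<le> \<delta> + B / d * \<bar>h\<bar>" using \<open>B \<ge> 0\<close> \<open>d > 0\<close> by simp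
        finally show ?thesis by simp
      next
        case False
        have "\<bar>K2 \<xi> - K2 y\<bar> \<le> \<bar>K2 \<xi>\<bar> + \<bar>K2 y\<bar>" by (rule abs_triangle_ineq4)
        then have "\<bar>K2 \<xi> - K2 y\<bar> \<le> 2 * B" using b(3)[of \<xi>] b(3)[of y] by linarith
        then have "\<bar>K2 \<xi> - K2 y\<bar> / 2 \<le> B * 1" by simp
        also have "\<dots> \<le> B * (\<bar>h\<bar> / d)" using False \<open>B \<ge> 0\<close> \<open>d > 0\<close> by (intro mult_left_mono) auto
        also have "\<dots> \<le> \<delta> + B / d * \<bar>h\<bar>" using \<open>\<delta> > 0\<close> by simp
        finally show ?thesis .
      qed
      then have "h\<^sup>2 * (\<bar>K2 \<xi> - K2 y\<bar> / 2) \<le> h\<^sup>2 * (\<delta> + B / d * \<bar>h\<bar>)" by (intro mult_left_mono) auto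
      also have "\<dots> = \<delta> * h\<^sup>2 + B / d * (h\<^sup>2 * \<bar>h\<bar>)" by (simp add: algebra_simps)
      also have "h\<^sup>2 * \<bar>h\<bar> = \<bar>h\<bar> ^ 3" by (simp add: power3_eq_cube power2_eq_square)
      finally show ?thesis unfolding eq by simp
    qed
    then have "jet2 B \<delta> (B / d) K K1 K2" unfolding jet2_def using m b by blast
    then show ?thesis using \<open>B \<ge> 0\<close> \<open>d > 0\<close> by (intro exI[of _ "B / d"]) auto
  qed
qed

text \<open>In terms of x = exp y the derivatives are x g' and x^2 g'' + x g'. They are continuous
  on the closed half line and vanish beyond the support, so they are bounded, and the second is
  uniformly continuous in y.\<close>

lemma payoff_jets:
  assumes g: "C2c_plus g"
  defines "K \<equiv> \<lambda>y. g (exp y)" and "K1 \<equiv> \<lambda>y. exp y * D_plus g (exp y)"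
    and "K2 \<equiv> \<lambda>y. (exp y)\<^sup>2 * D_plus (D_plus g) (exp y) + exp y * D_plus g (exp y)"
  obtains B where "B > 0" "jet1 B K K1" "\<And>\<delta>. \<delta> > 0 \<Longrightarrow> \<exists>C\<ge>0. jet2 B \<delta> C K K1 K2"
proof -
  obtain R where R: "R > 0" "\<And>s. s > R \<Longrightarrow> g s = 0" "\<And>s. s > R \<Longrightarrow> D_plus g s = 0"
    "\<And>s. s > R \<Longrightarrow> D_plus (D_plus g) s = 0"
    using C2c_plus_vanish[OF g] by blast
  have c: "continuous_on {0..} g" "continuous_on {0..} (D_plus g)" "continuous_on {0..} (D_plus (D_plus g))"
    using g by (auto simp: C2c_plus_def intro: differentiable_imp_continuous_on)
  have c1: "continuous_on {0..} (\<lambda>s. s * D_plus g s)"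
    and c2: "continuous_on {0..} (\<lambda>s. s\<^sup>2 * D_plus (D_plus g) s + s * D_plus g s)"
    by (intro continuous_intros c)+
  note v = vanishing_comp_exp[OF c(1) R(1)] vanishing_comp_exp[OF c1 R(1)] vanishing_comp_exp[OF c2 R(1)]
  obtain B0 where B0: "\<And>y. \<bar>K y\<bar> \<le> B0" using v(1) R unfolding K_def by blast
  obtain B1 where B1: "\<And>y. \<bar>K1 y\<bar> \<le> B1" using v(3) R unfolding K1_def by auto
  obtain B2 where B2: "\<And>y. \<bar>K2 y\<bar> \<le> B2" using v(5) R unfolding K2_def by auto
  have u: "uniformly_continuous_on UNIV K2" using v(6) R unfolding K2_def by auto
  \<comment> \<open>The 1 keeps B positive; later tolerances are divided by B.\<close>
  define B where "B = max 1 (max B0 (max B1 B2))"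
  have D1: "(K has_real_derivative K1 y) (at y)" for y
    using DERIV_chain2[OF C2c_plus_derivs_pos(1)[OF g] DERIV_exp, of y] by (simp add: K_def K1_def mult.commute)
  have "((\<lambda>y. D_plus g (exp y)) has_real_derivative D_plus (D_plus g) (exp y) * exp y) (at y)" for y
    by (rule DERIV_chain2[OF C2c_plus_derivs_pos(2)[OF g] DERIV_exp]) simp
  note [derivative_intros] = this
  have D2: "(K1 has_real_derivative K2 y) (at y)" for y
    unfolding K1_def K2_def by (auto intro!: derivative_eq_intros simp: power2_eq_square algebra_simps)
  have b: "\<bar>K y\<bar> \<le> B" "\<bar>K1 y\<bar> \<le> B" "\<bar>K2 y\<bar> \<le> B" for y
    using B0[of y] B1[of y] B2[of y] by (auto simp: B_def)
  note J = uniformly_continuous_second_deriv_jets[OF D1 D2 b u]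
  show ?thesis by (rule that[OF _ J(1) J(2)]) (auto simp: B_def)
qed

section \<open>Prices and paths in logarithmic coordinates\<close>

lemma factors_in_step_size:
  fixes m :: nat
  defines "p \<equiv> 1 / 2 ^ m :: real"
  shows "up_factor \<mu> \<sigma> m = 1 + \<sigma> * p + \<mu> * p\<^sup>2" "down_factor \<mu> \<sigma> m = 1 - \<sigma> * p + \<mu> * p\<^sup>2"
    "q_plus \<mu> \<sigma> r m = 1/2 + 1/2 * ((r - \<mu>) / \<sigma>) * p" "bond_factor r m = 1 + r * p\<^sup>2"
    "(1::real) / 2 ^ (2 * m) = p\<^sup>2"
  by (simp_all add: up_factor_def down_factor_def q_plus_def bond_factor_def p_def power_divide
      power_mult[symmetric] mult.commute)

lemma disc_price_exp:
  assumes "0 < up_factor \<mu> \<sigma> m" "0 < down_factor \<mu> \<sigma> m"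
  shows "disc_price \<mu> \<sigma> r T g m k (exp y) =
    bond_factor r m powi (- int (num_steps T m - k)) *
      (two_point (q_plus \<mu> \<sigma> r m) (ln (up_factor \<mu> \<sigma> m)) (ln (down_factor \<mu> \<sigma> m)) ^^ (num_steps T m - k))
        (\<lambda>y. g (exp y)) y"
proof -
  have "exp y * u ^ i * d ^ j = exp (y + real i * ln u + real j * ln d)"
    if "u > 0" "d > 0" for u d :: real and i j :: nat
    using that by (simp add: exp_add exp_of_nat_mult)
  then show ?thesis
    unfolding disc_price_def Let_def two_point_funpow_eq q_minus_eq using assms by simp
qed

text \<open>\<open>standard_BM\<close> describes increments, and W 0 = 0 only almost surely, so W
  \<tau> is replaced by W \<tau> - W 0 under the expectation. Maturity \<tau> = 0 is separate
  because there is no normal density of variance 0.\<close>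

lemma BS_price_exp:
  assumes W: "standard_BM \<Omega> W" and "t \<le> T"
    and [measurable]: "(\<lambda>y. g (exp y)) \<in> borel_measurable borel"
  shows "BS_price \<Omega> W \<sigma> r T g t (exp y) =
    exp (- r * (T - t)) * heat (r - \<sigma>\<^sup>2 / 2) \<sigma> (T - t) (\<lambda>y. g (exp y)) y"
proof -
  define \<tau> where "\<tau> = T - t"
  have "\<tau> \<ge> 0" using assms by (simp add: \<tau>_def)
  interpret prob_space \<Omega> using W by (simp add: standard_BM_def)
  have m[measurable]: "W 0 \<in> borel_measurable \<Omega>" "W \<tau> \<in> borel_measurable \<Omega>"
    using W \<open>\<tau> \<ge> 0\<close> by (auto simp: standard_BM_def)
  have W0: "AE \<omega> in \<Omega>. W 0 \<omega> = 0" using W by (simp add: standard_BM_def)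
  let ?K = "\<lambda>y. g (exp y)"
  have "expectation (\<lambda>\<omega>. ?K (y + ((r - \<sigma>\<^sup>2 / 2) * \<tau> + \<sigma> * W \<tau> \<omega>))) = heat (r - \<sigma>\<^sup>2 / 2) \<sigma> \<tau> ?K y"
  proof (cases "\<tau> = 0")
    case True
    have "expectation (\<lambda>\<omega>. ?K (y + ((r - \<sigma>\<^sup>2 / 2) * \<tau> + \<sigma> * W \<tau> \<omega>))) = expectation (\<lambda>\<omega>. ?K y)"
      using W0 True by (intro integral_cong_AE) auto
    then show ?thesis using True by (simp add: prob_space)
  next
    case False
    then have "\<tau> > 0" using \<open>\<tau> \<ge> 0\<close> by simp
    have "\<forall>s t. 0 \<le> s \<and> s < t \<longrightarrow>
        distributed \<Omega> lborel (\<lambda>\<omega>. W t \<omega> - W s \<omega>) (normal_density 0 (sqrt (t - s)))"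
      using W unfolding standard_BM_def by blast
    then have D: "distributed \<Omega> lborel (\<lambda>\<omega>. W \<tau> \<omega> - W 0 \<omega>) (normal_density 0 (sqrt \<tau>))"
      using \<open>\<tau> > 0\<close> by (metis diff_zero order_refl)
    have "expectation (\<lambda>\<omega>. ?K (y + ((r - \<sigma>\<^sup>2 / 2) * \<tau> + \<sigma> * W \<tau> \<omega>)))
        = expectation (\<lambda>\<omega>. ?K (y + ((r - \<sigma>\<^sup>2 / 2) * \<tau> + \<sigma> * (W \<tau> \<omega> - W 0 \<omega>))))"
      using W0 by (intro integral_cong_AE) auto
    also have "\<dots> = heat (r - \<sigma>\<^sup>2 / 2) \<sigma> \<tau> ?K y"
      by (rule heat_eq_normal_expectation[OF prob_space_axioms D \<open>\<tau> > 0\<close>]) measurable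
    finally show ?thesis .
  qed
  then show ?thesis
    unfolding BS_price_def \<tau>_def[symmetric] by (simp add: exp_add)
qed

section \<open>The approximating walk and the logarithm of the discrete stock\<close>

text \<open>Twisting only changes signs, whatever block index \<open>THE\<close> returns.\<close>

lemma abs_twisted_step:
  assumes "\<And>m k. k \<ge> 1 \<Longrightarrow> \<bar>x m k\<bar> = 1" and "n \<ge> 1"
  shows "\<bar>twisted_step x m n\<bar> = 1"
  using assms by (cases m) (auto simp: Let_def)

lemma BM_approx_grid:
  "BM_approx x m (grid_time m k) = twisted_walk x m k / 2 ^ m"
  by (simp add: BM_approx_def grid_time_def twisted_walk_interp_def Let_def)

lemma BM_approx_grid_diff:
  "BM_approx x m (grid_time m (Suc k)) - BM_approx x m (grid_time m k) = twisted_step x m (Suc k) / 2 ^ m"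
  unfolding BM_approx_grid by (simp add: twisted_walk_def diff_divide_distrib[symmetric])

text \<open>Linear interpolation moves by at most one step of the scaled walk, of size 2^-m, from
  the preceding grid point.\<close>

lemma BM_approx_near_grid:
  assumes x: "\<And>m k. k \<ge> 1 \<Longrightarrow> \<bar>x m k\<bar> = 1" and "t \<ge> 0"
  shows "\<bar>BM_approx x m (grid_time m (grid_index m t)) - BM_approx x m t\<bar> \<le> 1 / 2 ^ m"
proof -
  define s where "s = t * 2 ^ (2 * m)"
  define n where "n = nat \<lfloor>s\<rfloor>"
  have "s \<ge> 0" using assms by (simp add: s_def)
  then have n: "real n \<le> s" "s < real n + 1"
    unfolding n_def by linarith+
  have step: "twisted_walk x m (n + 1) - twisted_walk x m n = twisted_step x m (n + 1)"
    by (simp add: twisted_walk_def)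
  have "BM_approx x m t - BM_approx x m (grid_time m (grid_index m t))
      = (s - real n) * twisted_step x m (n + 1) / 2 ^ m"
    unfolding BM_approx_grid grid_index_def s_def[symmetric] n_def[symmetric]
    unfolding BM_approx_def s_def[symmetric] twisted_walk_interp_def Let_def n_def[symmetric] step
    by (simp add: add_divide_distrib)
  moreover have "\<bar>(s - real n) * twisted_step x m (n + 1) / 2 ^ m\<bar> \<le> 1 / 2 ^ m"
    using n abs_twisted_step[of x "n + 1" m] x by (simp add: abs_mult abs_divide divide_right_mono)
  ultimately show ?thesis by (metis abs_minus_commute)
qed

text \<open>Each step multiplies the stock by the up or down factor according to the sign of the
  walk. Its logarithm is (\<mu> - \<sigma>^2/2) p^2 plus or minus \<sigma> p, up to
  \<open>e\<close>; summation turns these parts into elapsed time and \<sigma> B_m. With e = o(p^2)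
  the total error k e tends to 0 on bounded time intervals.\<close>

lemma ln_disc_stock:
  assumes x: "\<And>m k. k \<ge> 1 \<Longrightarrow> \<bar>x m k\<bar> = 1" and "s0 > 0"
    and ud: "0 < up_factor \<mu> \<sigma> m" "0 < down_factor \<mu> \<sigma> m"
  defines "p \<equiv> 1 / 2 ^ m"
  assumes e: "\<bar>ln (up_factor \<mu> \<sigma> m) - (\<mu> - \<sigma>\<^sup>2 / 2) * p\<^sup>2 - \<sigma> * p\<bar> \<le> e"
    "\<bar>ln (down_factor \<mu> \<sigma> m) - (\<mu> - \<sigma>\<^sup>2 / 2) * p\<^sup>2 + \<sigma> * p\<bar> \<le> e"
  shows "disc_stock s0 \<mu> \<sigma> x m k > 0 \<and>
    \<bar>ln (disc_stock s0 \<mu> \<sigma> x m k)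
      - (ln s0 + (\<mu> - \<sigma>\<^sup>2 / 2) * grid_time m k + \<sigma> * BM_approx x m (grid_time m k))\<bar> \<le> real k * e"
proof (induction k)
  case 0
  then show ?case
    using \<open>s0 > 0\<close> by (simp add: BM_approx_grid twisted_walk_def) (simp add: grid_time_def)
next
  case (Suc k)
  let ?S = "disc_stock s0 \<mu> \<sigma> x m"
  define \<xi> where "\<xi> = twisted_step x m (Suc k)"
  have "\<bar>\<xi>\<bar> = 1" unfolding \<xi>_def by (rule abs_twisted_step) (use x in auto)
  then have \<xi>: "\<xi> = 1 \<or> \<xi> = -1" by linarith
  define c where "c = (if \<xi> = 1 then up_factor \<mu> \<sigma> m else down_factor \<mu> \<sigma> m)"
  have S: "?S (Suc k) = ?S k * c"
    using \<xi> by (auto simp: BM_approx_grid_diff c_def \<xi>_def[symmetric] up_factor_def down_factor_def simp del: twisted_step.simps)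
  have c: "c > 0" using ud by (simp add: c_def)
  have ce: "\<bar>ln c - (\<mu> - \<sigma>\<^sup>2 / 2) * p\<^sup>2 - \<sigma> * (\<xi> * p)\<bar> \<le> e" using \<xi> e by (auto simp: c_def)
  have g: "grid_time m (Suc k) = grid_time m k + p\<^sup>2"
    by (simp add: grid_time_def p_def add_divide_distrib power_divide power_mult[symmetric] mult.commute)
  have b: "BM_approx x m (grid_time m (Suc k)) = BM_approx x m (grid_time m k) + \<xi> * p"
    using BM_approx_grid_diff[of x m k] unfolding \<xi>_def p_def by simp
  have ln: "ln (?S (Suc k)) = ln (?S k) + ln c"
    using Suc.IH c unfolding S by (simp add: ln_mult)
  have "ln (?S (Suc k)) - (ln s0 + (\<mu> - \<sigma>\<^sup>2 / 2) * grid_time m (Suc k) + \<sigma> * BM_approx x m (grid_time m (Suc k)))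
     = (ln (?S k) - (ln s0 + (\<mu> - \<sigma>\<^sup>2 / 2) * grid_time m k + \<sigma> * BM_approx x m (grid_time m k)))
       + (ln c - (\<mu> - \<sigma>\<^sup>2 / 2) * p\<^sup>2 - \<sigma> * (\<xi> * p))"
    unfolding ln b unfolding g by (simp only: distrib_left)
  also have "\<bar>\<dots>\<bar> \<le> real k * e + e"
    using Suc.IH ce by (intro order_trans[OF abs_triangle_ineq] add_mono) auto
  finally show ?case
    using Suc.IH c unfolding S by (simp add: algebra_simps)
qed

lemma grid_time_eq: "grid_time m k = real k * (1 / 2 ^ m)\<^sup>2"
  by (simp add: grid_time_def power_divide power_mult[symmetric] mult.commute)

lemma grid_index_bounds:
  assumes "t \<ge> 0"
  shows "grid_time m (grid_index m t) \<le> t" "t < grid_time m (grid_index m t) + (1 / 2 ^ m)\<^sup>2"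
proof -
  define s where "s = t * 2 ^ (2 * m)"
  have "s \<ge> 0" using assms by (simp add: s_def)
  then have "real (nat \<lfloor>s\<rfloor>) \<le> s" "s < real (nat \<lfloor>s\<rfloor>) + 1" by linarith+
  then have "real (grid_index m t) \<le> t * 2 ^ (2 * m)" "t * 2 ^ (2 * m) < real (grid_index m t) + 1"
    unfolding grid_index_def s_def .
  moreover have "(1 / 2 ^ m)\<^sup>2 = (1::real) / 2 ^ (2 * m)"
    by (simp add: power_divide power_mult[symmetric] mult.commute)
  ultimately show "grid_time m (grid_index m t) \<le> t" "t < grid_time m (grid_index m t) + (1 / 2 ^ m)\<^sup>2"
    unfolding grid_time_def by (simp_all add: field_simps)
qed

text \<open>One step is lost by rounding and one because the hedge at \<open>k\<close> refers to the
  price at k + 1; hence the factor 2.\<close>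

lemma remaining_steps_bounds:
  fixes t T :: real and m :: nat
  assumes "0 \<le> t" "t \<le> T"
  defines "p2 \<equiv> (1 / 2 ^ m :: real)\<^sup>2" and "n \<equiv> num_steps T m - (grid_index m t + 1)"
  shows "\<bar>real n * p2 - (T - t)\<bar> \<le> 2 * p2" "real n * p2 \<le> T"
proof -
  define k where "k = grid_index m t"
  define N where "N = num_steps T m"
  have N: "N = grid_index m T" by (simp add: N_def num_steps_def grid_index_def)
  have p2: "p2 > 0" by (simp add: p2_def)
  have kt: "real k * p2 \<le> t" "t < real k * p2 + p2"
    using grid_index_bounds[OF \<open>0 \<le> t\<close>, of m] unfolding grid_time_eq k_def p2_def by auto
  have NT: "real N * p2 \<le> T" "T < real N * p2 + p2"
    using grid_index_bounds[of T m] assms unfolding grid_time_eq N p2_def by auto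
  have "k \<le> N"
    unfolding k_def N grid_index_def using assms by (intro nat_mono floor_mono mult_right_mono) auto
  show "\<bar>real n * p2 - (T - t)\<bar> \<le> 2 * p2"
  proof (cases "k = N")
    \<comment> \<open>Truncated subtraction gives n = 0, and T - t is below one step because t and T
      lie in the same grid cell.\<close>
    case True
    then show ?thesis using kt NT assms(1,2) unfolding n_def k_def[symmetric] N_def[symmetric] by simp
  next
    case False
    then have "real n = real N - real k - 1"
      using \<open>k \<le> N\<close> unfolding n_def k_def[symmetric] N_def[symmetric] by (simp add: of_nat_diff)
    then have "real n * p2 = real N * p2 - real k * p2 - p2" by (simp only: left_diff_distrib mult_1)
    then show ?thesis using kt NT by linarith
  qed
  have "real n * p2 \<le> real N * p2" using p2 unfolding n_def N_def by (intro mult_right_mono) auto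
  then show "real n * p2 \<le> T" using NT by linarith
qed

section \<open>Uniform convergence of the portfolios\<close>

lemma uniform_limit_squeeze:
  fixes f :: "'n \<Rightarrow> 'x \<Rightarrow> real"
  assumes "\<forall>\<^sub>F n in F. \<forall>x\<in>X. \<bar>f n x - l x\<bar> \<le> e n" "(e \<longlongrightarrow> 0) F"
  shows "uniform_limit X f l F"
proof (rule uniform_limitI)
  fix \<epsilon> :: real assume "\<epsilon> > 0"
  with assms(2) have "\<forall>\<^sub>F n in F. e n < \<epsilon>" by (rule order_tendstoD)
  with assms(1) show "\<forall>\<^sub>F n in F. \<forall>x\<in>X. dist (f n x) (l x) < \<epsilon>"
    by eventually_elim (auto simp: dist_real_def intro: le_less_trans)
qed

text \<open>Uniformity in y allows \<open>f n\<close> to be evaluated at the moving point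
  \<open>\<eta> n x\<close>; the Lipschitz bound is then needed for the limit \<open>l\<close>
  alone.\<close>

lemma uniform_limit_compose_lipschitz:
  fixes f :: "'n \<Rightarrow> 'x \<Rightarrow> real \<Rightarrow> real"
  assumes f: "uniform_limit (X \<times> UNIV) (\<lambda>n (x, y). f n x y) (\<lambda>(x, y). l x y) F"
    and L: "\<And>x y z. x \<in> X \<Longrightarrow> \<bar>l x y - l x z\<bar> \<le> L * \<bar>y - z\<bar>" and "L > 0"
    and \<eta>: "uniform_limit X \<eta> \<eta>' F"
  shows "uniform_limit X (\<lambda>n x. f n x (\<eta> n x)) (\<lambda>x. l x (\<eta>' x)) F"
proof (rule uniform_limitI)
  fix \<epsilon> :: real assume "\<epsilon> > 0"
  have "\<forall>\<^sub>F n in F. \<forall>p\<in>X \<times> UNIV. dist ((\<lambda>(x, y). f n x y) p) ((\<lambda>(x, y). l x y) p) < \<epsilon> / 2"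
    using uniform_limitD[OF f, of "\<epsilon> / 2"] \<open>\<epsilon> > 0\<close> by simp
  moreover have "\<forall>\<^sub>F n in F. \<forall>x\<in>X. dist (\<eta> n x) (\<eta>' x) < \<epsilon> / (2 * L)"
    using uniform_limitD[OF \<eta>, of "\<epsilon> / (2 * L)"] \<open>\<epsilon> > 0\<close> \<open>L > 0\<close> by simp
  ultimately show "\<forall>\<^sub>F n in F. \<forall>x\<in>X. dist (f n x (\<eta> n x)) (l x (\<eta>' x)) < \<epsilon>"
  proof eventually_elim
    case (elim n)
    show ?case
    proof
      fix x assume x: "x \<in> X"
      have 1: "\<bar>f n x (\<eta> n x) - l x (\<eta> n x)\<bar> < \<epsilon> / 2"
        using elim(1) x by (force simp: dist_real_def)
      have "\<bar>l x (\<eta> n x) - l x (\<eta>' x)\<bar> \<le> L * \<bar>\<eta> n x - \<eta>' x\<bar>" using L x by blast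
      also have "\<dots> \<le> L * (\<epsilon> / (2 * L))"
        using elim(2) x \<open>L > 0\<close> by (intro mult_left_mono) (auto simp: dist_real_def less_imp_le)
      also have "\<dots> = \<epsilon> / 2" using \<open>L > 0\<close> by simp
      finally show "dist (f n x (\<eta> n x)) (l x (\<eta>' x)) < \<epsilon>"
        using 1 unfolding dist_real_def by linarith
    qed
  qed
qed

text \<open>Landau's trick: a derivative is a difference quotient up to the bound on the second derivative
  times the width, so uniform convergence passes to derivatives.\<close>

lemma jet1_uniform_limit_deriv:
  fixes f f1 :: "'n \<Rightarrow> 'x \<Rightarrow> real \<Rightarrow> real"
  assumes J: "\<forall>\<^sub>F n in F. \<forall>x\<in>X. jet1 B (f n x) (f1 n x)" and J': "\<And>x. x \<in> X \<Longrightarrow> jet1 B (l x) (l1 x)"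
    and f: "uniform_limit (X \<times> UNIV) (\<lambda>n (x, y). f n x y) (\<lambda>(x, y). l x y) F" and "B > 0"
  shows "uniform_limit (X \<times> UNIV) (\<lambda>n (x, y). f1 n x y) (\<lambda>(x, y). l1 x y) F"
proof (rule uniform_limitI)
  fix \<epsilon> :: real assume "\<epsilon> > 0"
  \<comment> \<open>The two Taylor remainders contribute 2 B h^2 and the two price differences less
    than B h^2; after division by h the error is below 3 B h < 4 B h = \<epsilon>.\<close>
  define h where "h = \<epsilon> / (4 * B)"
  have h: "h > 0" "4 * B * h = \<epsilon>" using \<open>\<epsilon> > 0\<close> \<open>B > 0\<close> by (auto simp: h_def)
  have "\<forall>\<^sub>F n in F. \<forall>p\<in>X \<times> UNIV. dist ((\<lambda>(x, y). f n x y) p) ((\<lambda>(x, y). l x y) p) < B * h\<^sup>2 / 2"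
    using uniform_limitD[OF f, of "B * h\<^sup>2 / 2"] h \<open>B > 0\<close> by simp
  with J show "\<forall>\<^sub>F n in F. \<forall>p\<in>X \<times> UNIV. dist ((\<lambda>(x, y). f1 n x y) p) ((\<lambda>(x, y). l1 x y) p) < \<epsilon>"
  proof eventually_elim
    case (elim n)
    have "\<bar>f1 n x y - l1 x y\<bar> < \<epsilon>" if x: "x \<in> X" for x y
    proof -
      have d: "\<bar>f n x y - l x y\<bar> < B * h\<^sup>2 / 2" for y using elim(2) x by (force simp: dist_real_def)
      have "\<bar>f n x (y + h) - f n x y - h * f1 n x y\<bar> \<le> B * h\<^sup>2" "\<bar>l x (y + h) - l x y - h * l1 x y\<bar> \<le> B * h\<^sup>2"
        using elim(1) J' x unfolding jet1_def by blast+
      with d[of y] d[of "y + h"] have "\<bar>h * f1 n x y - h * l1 x y\<bar> < 3 * (B * h\<^sup>2)" by linarith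
      then have "h * \<bar>f1 n x y - l1 x y\<bar> < h * (3 * B * h)"
        using h by (simp add: right_diff_distrib[symmetric] abs_mult power2_eq_square mult_ac)
      then have "\<bar>f1 n x y - l1 x y\<bar> < 3 * B * h" using h by simp
      moreover have "B * h > 0" using h \<open>B > 0\<close> by simp
      ultimately show ?thesis using h(2) by linarith
    qed
    then show ?case by (auto simp: dist_real_def)
  qed
qed

lemma jet1_scale:
  assumes "jet1 B \<phi> \<phi>1" "0 \<le> c" "c \<le> 1"
  shows "jet1 B (\<lambda>y. c * \<phi> y) (\<lambda>y. c * \<phi>1 y)"
proof -
  have le: "\<bar>c * z\<bar> \<le> b" if "\<bar>z\<bar> \<le> b" for z b :: real
    using assms(2,3) that by (simp add: abs_mult) (meson abs_ge_zero mult_left_le_one_le order_trans)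
  have "\<bar>c * \<phi> (y + h) - c * \<phi> y - h * (c * \<phi>1 y)\<bar> \<le> B * h\<^sup>2" for y h
  proof -
    have "c * \<phi> (y + h) - c * \<phi> y - h * (c * \<phi>1 y) = c * (\<phi> (y + h) - \<phi> y - h * \<phi>1 y)"
      by (simp add: algebra_simps)
    then show ?thesis using le[of "\<phi> (y + h) - \<phi> y - h * \<phi>1 y" "B * h\<^sup>2"] assms(1) by (simp add: jet1_def)
  qed
  then show ?thesis using assms(1) le by (auto simp: jet1_def)
qed

text \<open>\<open>\<phi>\<close> is Lipschitz and the displacement changes by a (s - t) + \<sigma>
  (sqrt s - sqrt t) z, whence Hoelder continuity of order 1/2 in time. It compensates for the
  discrete time to maturity being off by up to two steps.\<close>

lemma heat_time_lipschitz:
  assumes J: "jet1 B \<phi> \<phi>1" and "\<sigma> \<ge> 0" "s \<ge> 0" "t \<ge> 0"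
  shows "\<bar>heat a \<sigma> s \<phi> y - heat a \<sigma> t \<phi> y\<bar>
    \<le> B * (\<bar>a\<bar> * \<bar>s - t\<bar> + \<sigma> * sqrt \<bar>s - t\<bar> * (\<integral>z. \<bar>z\<bar> \<partial>std_normal_distribution))"
proof -
  let ?N = "std_normal_distribution"
  interpret prob_space ?N by (rule prob_space_std_normal)
  have m: "\<phi> \<in> borel_measurable borel" and b: "\<And>y. \<bar>\<phi> y\<bar> \<le> B" using J by (auto simp: jet1_def)
  have "B \<ge> 0" using b[of 0] by linarith
  have [simp]: "integrable ?N (\<lambda>z. \<bar>z\<bar>)" using std_normal_moments(1) by (rule integrable_abs)
  let ?f = "\<lambda>t z. \<phi> (y + (a * t + \<sigma> * sqrt t * z))"
  have i: "integrable ?N (?f t)" for t by (rule integrable_heat[OF m b])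
  have sq: "\<bar>sqrt s - sqrt t\<bar> \<le> sqrt \<bar>s - t\<bar>"
  proof -
    have "sqrt u \<le> sqrt v + sqrt \<bar>u - v\<bar>" if "u \<ge> 0" "v \<ge> 0" for u v :: real
    proof -
      have "sqrt u \<le> sqrt (v + \<bar>u - v\<bar>)" by (rule real_sqrt_le_mono) linarith
      also have "\<dots> \<le> sqrt v + sqrt \<bar>u - v\<bar>" using that by (intro sqrt_add_le_add_sqrt) auto
      finally show ?thesis .
    qed
    from this[of s t] this[of t s] assms show ?thesis by (simp add: abs_minus_commute)
  qed
  have "\<bar>heat a \<sigma> s \<phi> y - heat a \<sigma> t \<phi> y\<bar> = \<bar>\<integral>z. ?f s z - ?f t z \<partial>?N\<bar>"
    unfolding heat_def using i by simp
  also have "\<dots> \<le> (\<integral>z. \<bar>?f s z - ?f t z\<bar> \<partial>?N)" by (rule integral_abs_bound)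
  also have "\<dots> \<le> (\<integral>z. B * (\<bar>a\<bar> * \<bar>s - t\<bar> + \<sigma> * sqrt \<bar>s - t\<bar> * \<bar>z\<bar>) \<partial>?N)"
  proof (rule integral_mono)
    show "integrable ?N (\<lambda>z. \<bar>?f s z - ?f t z\<bar>)"
      by (intro integrable_abs Bochner_Integration.integrable_diff i)
    fix z
    have "\<bar>?f s z - ?f t z\<bar> \<le> B * \<bar>a * (s - t) + \<sigma> * (sqrt s - sqrt t) * z\<bar>"
      using jet1_lipschitz(1)[OF J, of "y + (a * s + \<sigma> * sqrt s * z)" "y + (a * t + \<sigma> * sqrt t * z)"]
      by (simp add: algebra_simps)
    also have "\<dots> \<le> B * (\<bar>a\<bar> * \<bar>s - t\<bar> + \<sigma> * \<bar>sqrt s - sqrt t\<bar> * \<bar>z\<bar>)"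
      using \<open>B \<ge> 0\<close> \<open>\<sigma> \<ge> 0\<close>
      by (intro mult_left_mono order_trans[OF abs_triangle_ineq]) (auto simp: abs_mult)
    also have "\<dots> \<le> B * (\<bar>a\<bar> * \<bar>s - t\<bar> + \<sigma> * sqrt \<bar>s - t\<bar> * \<bar>z\<bar>)"
      using \<open>B \<ge> 0\<close> \<open>\<sigma> \<ge> 0\<close> sq by (intro mult_left_mono add_left_mono mult_right_mono) auto
    finally show "\<bar>?f s z - ?f t z\<bar> \<le> B * (\<bar>a\<bar> * \<bar>s - t\<bar> + \<sigma> * sqrt \<bar>s - t\<bar> * \<bar>z\<bar>)" .
  qed simp
  also have "\<dots> = B * (\<bar>a\<bar> * \<bar>s - t\<bar> + \<sigma> * sqrt \<bar>s - t\<bar> * (\<integral>z. \<bar>z\<bar> \<partial>?N))"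
    using prob_space by simp
  finally show ?thesis .
qed

lemma filterlim_step_size: "filterlim (\<lambda>m. 1 / 2 ^ m :: real) (at_right 0) sequentially"
  by real_asymp

text \<open>Stated for general step counts because it serves twice: with the remaining steps and
  \<tau> = T - t for the prices, and with k + 1 steps and \<tau> = t for the bonds.\<close>

lemma discount_uniform_limit:
  fixes n :: "nat \<Rightarrow> 'x \<Rightarrow> nat" and \<tau> :: "'x \<Rightarrow> real"
  assumes "r > 0" and n: "\<And>m x. x \<in> X \<Longrightarrow> \<bar>real (n m x) * (1 / 2 ^ m)\<^sup>2 - \<tau> x\<bar> \<le> 2 * (1 / 2 ^ m)\<^sup>2"
    and \<tau>: "\<And>x. x \<in> X \<Longrightarrow> 0 \<le> \<tau> x \<and> \<tau> x \<le> T"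
  shows "uniform_limit X (\<lambda>m x. bond_factor r m powi (- int (n m x))) (\<lambda>x. exp (- r * \<tau> x)) sequentially"
proof (rule uniform_limit_squeeze[where e = "\<lambda>m. (T + 2) * \<bar>ln (1 + r * (1 / 2 ^ m)\<^sup>2) / (1 / 2 ^ m)\<^sup>2 - r\<bar> + r * (2 * (1 / 2 ^ m)\<^sup>2)"])
  have "((\<lambda>p. (T + 2) * \<bar>ln (1 + r * p\<^sup>2) / p\<^sup>2 - r\<bar> + r * (2 * p\<^sup>2)) \<longlongrightarrow> (T + 2) * \<bar>r - r\<bar> + r * (2 * 0\<^sup>2)) (at_right 0)"
  proof (intro tendsto_intros)
    show "((\<lambda>p. ln (1 + r * p\<^sup>2) / p\<^sup>2) \<longlongrightarrow> r) (at_right 0)" using \<open>r > 0\<close> by real_asymp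
  qed
  from filterlim_compose[OF this filterlim_step_size]
  show "(\<lambda>m. (T + 2) * \<bar>ln (1 + r * (1 / 2 ^ m)\<^sup>2) / (1 / 2 ^ m)\<^sup>2 - r\<bar> + r * (2 * (1 / 2 ^ m)\<^sup>2)) \<longlonglongrightarrow> 0"
    by simp
  show "\<forall>\<^sub>F m in sequentially. \<forall>x\<in>X. \<bar>bond_factor r m powi (- int (n m x)) - exp (- r * \<tau> x)\<bar>
      \<le> (T + 2) * \<bar>ln (1 + r * (1 / 2 ^ m)\<^sup>2) / (1 / 2 ^ m)\<^sup>2 - r\<bar> + r * (2 * (1 / 2 ^ m)\<^sup>2)"
  proof (intro always_eventually allI ballI)
    fix m x assume x: "x \<in> X"
    define p2 where "p2 = (1 / 2 ^ m :: real)\<^sup>2"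
    have p2: "0 < p2" "p2 \<le> 1" by (simp_all add: p2_def power_le_one)
    \<comment> \<open>The continuously compounded rate equivalent to one discrete step; it tends to
      r. The exponents are then compared, as exp (- u) is 1-Lipschitz for u \<ge> 0. The factor T +
      2 bounds n p^2, because p^2 \<le> 1.\<close>
    define \<Lambda> where "\<Lambda> = ln (1 + r * p2) / p2"
    have b: "bond_factor r m = 1 + r * p2" by (simp add: factors_in_step_size p2_def)
    have \<Lambda>0: "\<Lambda> \<ge> 0" using p2 \<open>r > 0\<close> by (simp add: \<Lambda>_def)
    have "bond_factor r m = exp (\<Lambda> * p2)" using p2 \<open>r > 0\<close> by (simp add: b \<Lambda>_def add_pos_pos)
    then have "bond_factor r m powi (- int (n m x)) = exp (- (real (n m x) * p2 * \<Lambda>))"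
      by (simp add: power_int_minus exp_of_nat_mult[symmetric] exp_minus mult_ac)
    moreover have "\<bar>exp (- u) - exp (- v)\<bar> \<le> \<bar>u - v\<bar>" if "u \<ge> 0" "v \<ge> 0" for u v :: real
    proof -
      have "norm (exp (- u) - exp (- v)) \<le> 1 * norm ((- u) - (- v))"
        by (rule field_differentiable_bound[of "{..0}" exp exp]) (use that in \<open>auto intro!: derivative_eq_intros\<close>)
      then show ?thesis by (simp add: abs_minus_commute)
    qed
    ultimately have "\<bar>bond_factor r m powi (- int (n m x)) - exp (- (r * \<tau> x))\<bar> \<le> \<bar>real (n m x) * p2 * \<Lambda> - r * \<tau> x\<bar>"
      using \<Lambda>0 p2 \<open>r > 0\<close> \<tau>[OF x] by simp
    also have "real (n m x) * p2 * \<Lambda> - r * \<tau> x = real (n m x) * p2 * (\<Lambda> - r) + r * (real (n m x) * p2 - \<tau> x)"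
      by (simp add: algebra_simps)
    also have "\<bar>\<dots>\<bar> \<le> real (n m x) * p2 * \<bar>\<Lambda> - r\<bar> + r * \<bar>real (n m x) * p2 - \<tau> x\<bar>"
      using p2 \<open>r > 0\<close> by (intro order_trans[OF abs_triangle_ineq]) (simp add: abs_mult)
    also have "\<dots> \<le> (T + 2) * \<bar>\<Lambda> - r\<bar> + r * (2 * p2)"
      using n[OF x, of m] \<tau>[OF x] p2 \<open>r > 0\<close> unfolding p2_def[symmetric]
      by (intro add_mono mult_right_mono mult_left_mono) auto
    finally show "\<bar>bond_factor r m powi (- int (n m x)) - exp (- r * \<tau> x)\<bar>
      \<le> (T + 2) * \<bar>ln (1 + r * (1 / 2 ^ m)\<^sup>2) / (1 / 2 ^ m)\<^sup>2 - r\<bar> + r * (2 * (1 / 2 ^ m)\<^sup>2)"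
      unfolding p2_def[symmetric] \<Lambda>_def[symmetric] by simp
  qed
qed

lemma eventually_factors_pos:
  assumes "\<sigma> > 0"
  shows "\<forall>\<^sub>F m in sequentially. 0 < up_factor \<mu> \<sigma> m \<and> 0 < down_factor \<mu> \<sigma> m
    \<and> 0 \<le> q_plus \<mu> \<sigma> r m \<and> q_plus \<mu> \<sigma> r m \<le> 1"
proof -
  have "((\<lambda>p. 1 + \<sigma> * p + \<mu> * p\<^sup>2) \<longlongrightarrow> 1) (at_right 0)" "((\<lambda>p. 1 - \<sigma> * p + \<mu> * p\<^sup>2) \<longlongrightarrow> 1) (at_right 0)"
    "((\<lambda>p. 1/2 + 1/2 * ((r - \<mu>) / \<sigma>) * p) \<longlongrightarrow> 1/2) (at_right 0)"
    using assms by (auto intro!: tendsto_eq_intros)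
  note this[THEN filterlim_compose, OF filterlim_step_size, folded factors_in_step_size]
  then have "\<forall>\<^sub>F m in sequentially. 0 < up_factor \<mu> \<sigma> m" "\<forall>\<^sub>F m in sequentially. 0 < down_factor \<mu> \<sigma> m"
    "\<forall>\<^sub>F m in sequentially. 0 < q_plus \<mu> \<sigma> r m" "\<forall>\<^sub>F m in sequentially. q_plus \<mu> \<sigma> r m < 1"
    by (auto intro: order_tendstoD)
  then show ?thesis by eventually_elim auto
qed

lemma ln_disc_stock_uniform_limit:
  assumes x: "\<And>m k. k \<ge> 1 \<Longrightarrow> \<bar>x m k\<bar> = 1" and pos: "s0 > 0" "\<sigma> > 0" "T > 0"
    and \<beta>: "uniform_limit {0..T} (BM_approx x) \<beta> sequentially"
  shows "uniform_limit {0..T} (\<lambda>m t. ln (disc_stock s0 \<mu> \<sigma> x m (grid_index m t)))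
    (\<lambda>t. ln s0 + (\<mu> - \<sigma>\<^sup>2 / 2) * t + \<sigma> * \<beta> t) sequentially"
    and "\<forall>\<^sub>F m in sequentially. \<forall>k. disc_stock s0 \<mu> \<sigma> x m k > 0"
proof -
  let ?c = "\<mu> - \<sigma>\<^sup>2 / 2"
  define e where "e p = \<bar>ln (1 + \<sigma> * p + \<mu> * p\<^sup>2) - ?c * p\<^sup>2 - \<sigma> * p\<bar> + \<bar>ln (1 - \<sigma> * p + \<mu> * p\<^sup>2) - ?c * p\<^sup>2 + \<sigma> * p\<bar>" for p
  have e1: "((\<lambda>p. (ln (1 + \<sigma> * p + \<mu> * p\<^sup>2) - ?c * p\<^sup>2 - \<sigma> * p) / p\<^sup>2) \<longlongrightarrow> 0) (at_right 0)"
    and e2: "((\<lambda>p. (ln (1 - \<sigma> * p + \<mu> * p\<^sup>2) - ?c * p\<^sup>2 + \<sigma> * p) / p\<^sup>2) \<longlongrightarrow> 0) (at_right 0)"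
    using \<open>\<sigma> > 0\<close> by (real_asymp simp: power2_eq_square)+
  have "((\<lambda>p. e p / p\<^sup>2) \<longlongrightarrow> 0) (at_right 0)"
    using tendsto_add[OF tendsto_rabs[OF e1] tendsto_rabs[OF e2]]
    by (simp only: e_def abs_divide abs_power2 add_divide_distrib[symmetric] abs_zero add_0_left)
  note e_lim = filterlim_compose[OF this filterlim_step_size]
  have up: "ln (up_factor \<mu> \<sigma> m) = ln (1 + \<sigma> * (1 / 2 ^ m) + \<mu> * (1 / 2 ^ m)\<^sup>2)"
    and down: "ln (down_factor \<mu> \<sigma> m) = ln (1 - \<sigma> * (1 / 2 ^ m) + \<mu> * (1 / 2 ^ m)\<^sup>2)" for m
    by (simp_all only: factors_in_step_size)
  have main: "\<forall>\<^sub>F m in sequentially. \<forall>k. disc_stock s0 \<mu> \<sigma> x m k > 0 \<and>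
      \<bar>ln (disc_stock s0 \<mu> \<sigma> x m k) - (ln s0 + ?c * grid_time m k + \<sigma> * BM_approx x m (grid_time m k))\<bar>
        \<le> real k * e (1 / 2 ^ m)"
    \<comment> \<open>The 0 stands for the interest rate, which the up and down factors do not
      contain.\<close>
    using eventually_factors_pos[OF \<open>\<sigma> > 0\<close>, of \<mu> 0]
  proof eventually_elim
    case (elim m)
    show ?case
      using elim by (intro allI ln_disc_stock x pos) (auto simp: up down e_def)
  qed
  then show "\<forall>\<^sub>F m in sequentially. \<forall>k. disc_stock s0 \<mu> \<sigma> x m k > 0" by eventually_elim blast
  have lim0: "(\<lambda>m. T * (e (1 / 2 ^ m) / (1 / 2 ^ m)\<^sup>2) + \<bar>?c\<bar> * (1 / 2 ^ m)\<^sup>2 + \<sigma> * (1 / 2 ^ m)) \<longlonglongrightarrow> 0"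
  proof -
    have "(\<lambda>m. 1 / 2 ^ m :: real) \<longlonglongrightarrow> 0" by real_asymp
    from tendsto_add[OF tendsto_add[OF tendsto_mult[OF tendsto_const[of T] e_lim]
          tendsto_mult[OF tendsto_const tendsto_power[OF this, of 2]]] tendsto_mult[OF tendsto_const this]]
    show ?thesis by simp
  qed
  \<comment> \<open>With \<sigma> B_m subtracted, the error has an explicit bound: accumulated step
    errors, rounding of time, and interpolation of the walk. The convergence of B_m is added
    afterwards.\<close>
  have "uniform_limit {0..T} (\<lambda>m t. ln (disc_stock s0 \<mu> \<sigma> x m (grid_index m t)) - \<sigma> * BM_approx x m t)
     (\<lambda>t. ln s0 + ?c * t) sequentially"
  proof (rule uniform_limit_squeeze[OF _ lim0])
    show "\<forall>\<^sub>F m in sequentially. \<forall>t\<in>{0..T}.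
      \<bar>ln (disc_stock s0 \<mu> \<sigma> x m (grid_index m t)) - \<sigma> * BM_approx x m t - (ln s0 + ?c * t)\<bar>
      \<le> T * (e (1 / 2 ^ m) / (1 / 2 ^ m)\<^sup>2) + \<bar>?c\<bar> * (1 / 2 ^ m)\<^sup>2 + \<sigma> * (1 / 2 ^ m)"
      using main
    proof eventually_elim
      case (elim m)
      show ?case
      proof
        fix t assume t: "t \<in> {0..T}"
        define k where "k = grid_index m t"
        define G where "G = grid_time m k"
        have G: "G \<le> t" "t < G + (1 / 2 ^ m)\<^sup>2"
          using grid_index_bounds[of t m] t by (auto simp: G_def k_def)
        have b: "\<bar>BM_approx x m G - BM_approx x m t\<bar> \<le> 1 / 2 ^ m"
          unfolding G_def k_def using t by (intro BM_approx_near_grid x) auto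
        have 1: "\<bar>ln (disc_stock s0 \<mu> \<sigma> x m k) - (ln s0 + ?c * G + \<sigma> * BM_approx x m G)\<bar> \<le> real k * e (1 / 2 ^ m)"
          using elim by (simp add: G_def)
        have "real k * e (1 / 2 ^ m) = G * (e (1 / 2 ^ m) / (1 / 2 ^ m)\<^sup>2)"
          by (simp add: G_def grid_time_eq)
        also have "\<dots> \<le> T * (e (1 / 2 ^ m) / (1 / 2 ^ m)\<^sup>2)"
          using G t by (intro mult_right_mono) (auto simp: e_def)
        finally have 2: "real k * e (1 / 2 ^ m) \<le> T * (e (1 / 2 ^ m) / (1 / 2 ^ m)\<^sup>2)" .
        have 3: "\<bar>?c * (G - t)\<bar> \<le> \<bar>?c\<bar> * (1 / 2 ^ m)\<^sup>2"
          unfolding abs_mult using G by (intro mult_left_mono) auto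
        have 4: "\<bar>\<sigma> * (BM_approx x m G - BM_approx x m t)\<bar> \<le> \<sigma> * (1 / 2 ^ m)"
          unfolding abs_mult using b \<open>\<sigma> > 0\<close> by (simp only: abs_of_pos) (intro mult_left_mono, auto)
        show "\<bar>ln (disc_stock s0 \<mu> \<sigma> x m (grid_index m t)) - \<sigma> * BM_approx x m t - (ln s0 + ?c * t)\<bar>
          \<le> T * (e (1 / 2 ^ m) / (1 / 2 ^ m)\<^sup>2) + \<bar>?c\<bar> * (1 / 2 ^ m)\<^sup>2 + \<sigma> * (1 / 2 ^ m)"
          using 1 2 3 4 unfolding k_def[symmetric] right_diff_distrib by linarith
      qed
    qed
  qed
  from uniform_limit_add[OF this bounded_linear.uniform_limit[OF bounded_linear_mult_right[of \<sigma>] \<beta>]]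
  show "uniform_limit {0..T} (\<lambda>m t. ln (disc_stock s0 \<mu> \<sigma> x m (grid_index m t)))
    (\<lambda>t. ln s0 + (\<mu> - \<sigma>\<^sup>2 / 2) * t + \<sigma> * \<beta> t) sequentially"
    by simp
qed

section \<open>Prices as operators on the payoff in logarithmic coordinates\<close>

text \<open>The payoff is an argument because the same averaging operator, applied to the derivative
  of the payoff in y, gives the derivative of the price in y.\<close>

definition disc_log_price ::
  "real \<Rightarrow> real \<Rightarrow> real \<Rightarrow> real \<Rightarrow> nat \<Rightarrow> nat \<Rightarrow> (real \<Rightarrow> real) \<Rightarrow> real \<Rightarrow> real" where
  "disc_log_price \<mu> \<sigma> r T m k \<phi> y = bond_factor r m powi (- int (num_steps T m - k)) *
     (two_point (q_plus \<mu> \<sigma> r m) (ln (up_factor \<mu> \<sigma> m)) (ln (down_factor \<mu> \<sigma> m))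
        ^^ (num_steps T m - k)) \<phi> y"

definition BS_log_price :: "real \<Rightarrow> real \<Rightarrow> real \<Rightarrow> real \<Rightarrow> (real \<Rightarrow> real) \<Rightarrow> real \<Rightarrow> real" where
  "BS_log_price \<sigma> r T t \<phi> y = exp (- r * (T - t)) * heat (r - \<sigma>\<^sup>2 / 2) \<sigma> (T - t) \<phi> y"

lemma bond_factor_powi_bounds:
  assumes "r > 0"
  shows "0 \<le> bond_factor r m powi (- int n)" "bond_factor r m powi (- int n) \<le> 1"
  using assms by (auto simp: bond_factor_def power_int_minus inverse_le_1_iff one_le_power)

lemma jet1_BS_log_price:
  assumes "jet1 B \<phi> \<phi>1" "r > 0" "t \<le> T"
  shows "jet1 B (BS_log_price \<sigma> r T t \<phi>) (BS_log_price \<sigma> r T t \<phi>1)"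
  unfolding BS_log_price_def using assms by (intro jet1_scale jet1_heat) auto

lemma jet1_disc_log_price:
  assumes "jet1 B \<phi> \<phi>1" "r > 0" "0 \<le> q_plus \<mu> \<sigma> r m" "q_plus \<mu> \<sigma> r m \<le> 1"
  shows "jet1 B (disc_log_price \<mu> \<sigma> r T m k \<phi>) (disc_log_price \<mu> \<sigma> r T m k \<phi>1)"
  unfolding disc_log_price_def using assms by (intro jet1_scale jet1_two_point_funpow bond_factor_powi_bounds)

text \<open>Three errors of at most \<epsilon>/4 each: the discount factor, against the bound B of
  the averaged payoff; the Lindeberg comparison at the discrete time to maturity; and the passage
  from that time to T - t.\<close>

lemma disc_log_price_uniform_limit:
  assumes pos: "\<sigma> > 0" "r > 0" "T > 0" "B > 0" and J1: "jet1 B K K1"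
    and J2: "\<And>\<delta>. \<delta> > 0 \<Longrightarrow> \<exists>C\<ge>0. jet2 B \<delta> C K K1 K2"
  shows "uniform_limit ({0..T} \<times> UNIV) (\<lambda>m (t, y). disc_log_price \<mu> \<sigma> r T m (grid_index m t + 1) K y)
    (\<lambda>(t, y). BS_log_price \<sigma> r T t K y) sequentially"
proof (rule uniform_limitI)
  fix \<epsilon> :: real assume "\<epsilon> > 0"
  define a where "a = r - \<sigma>\<^sup>2 / 2"
  define n where "n m t = num_steps T m - (grid_index m t + 1)" for m t
  define c where "c = (\<integral>z. \<bar>z\<bar> \<partial>std_normal_distribution)"
  have n: "\<bar>real (n m t) * (1 / 2 ^ m)\<^sup>2 - (T - t)\<bar> \<le> 2 * (1 / 2 ^ m)\<^sup>2" "real (n m t) * (1 / 2 ^ m)\<^sup>2 \<le> T"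
    if "t \<in> {0..T}" for m t
    using remaining_steps_bounds[of t T m] that by (auto simp: n_def)
  have "uniform_limit {0..T} (\<lambda>m t. bond_factor r m powi (- int (n m t))) (\<lambda>t. exp (- r * (T - t))) sequentially"
    by (rule discount_uniform_limit[where T = T]) (use pos n in auto)
  from uniform_limitD[OF this, of "\<epsilon> / (4 * B)"]
  have ev1: "\<forall>\<^sub>F m in sequentially. \<forall>t\<in>{0..T}. \<bar>bond_factor r m powi (- int (n m t)) - exp (- r * (T - t))\<bar> < \<epsilon> / (4 * B)"
    using \<open>\<epsilon> > 0\<close> \<open>B > 0\<close> by (simp add: dist_real_def)
  \<comment> \<open>The weights q compensate the drift of the stock, so \<mu> cancels here.\<close>
  have "\<mu> + (r - \<mu>) / \<sigma> * \<sigma> - \<sigma>\<^sup>2 / 2 = a" using pos by (simp add: a_def)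
  from two_point_heat_limit[OF pos(1,3) _ J2, where \<eta> = "\<epsilon> / 4" and \<mu> = \<mu> and \<kappa> = "(r - \<mu>) / \<sigma>", unfolded this]
  have "\<forall>\<^sub>F p in at_right 0. \<forall>n y. real n * p\<^sup>2 \<le> T \<longrightarrow>
     \<bar>(two_point (1/2 + 1/2 * ((r - \<mu>) / \<sigma>) * p) (ln (1 + \<sigma> * p + \<mu> * p\<^sup>2)) (ln (1 - \<sigma> * p + \<mu> * p\<^sup>2)) ^^ n) K y
        - heat a \<sigma> (real n * p\<^sup>2) K y\<bar> \<le> \<epsilon> / 4"
    using \<open>\<epsilon> > 0\<close> by simp
  from eventually_compose_filterlim[OF this filterlim_step_size, folded factors_in_step_size(1-4)]
  have ev2: "\<forall>\<^sub>F m in sequentially. \<forall>n y. real n * (1 / 2 ^ m)\<^sup>2 \<le> T \<longrightarrow>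
     \<bar>(two_point (q_plus \<mu> \<sigma> r m) (ln (up_factor \<mu> \<sigma> m)) (ln (down_factor \<mu> \<sigma> m)) ^^ n) K y
        - heat a \<sigma> (real n * (1 / 2 ^ m)\<^sup>2) K y\<bar> \<le> \<epsilon> / 4"
    by simp
  have "((\<lambda>p. B * (\<bar>a\<bar> * (2 * p\<^sup>2) + \<sigma> * sqrt (2 * p\<^sup>2) * c)) \<longlongrightarrow> B * (\<bar>a\<bar> * (2 * 0\<^sup>2) + \<sigma> * sqrt (2 * 0\<^sup>2) * c)) (at_right 0)"
    by (intro tendsto_intros)
  from filterlim_compose[OF this filterlim_step_size]
  have ev3: "\<forall>\<^sub>F m in sequentially. B * (\<bar>a\<bar> * (2 * (1 / 2 ^ m)\<^sup>2) + \<sigma> * sqrt (2 * (1 / 2 ^ m)\<^sup>2) * c) < \<epsilon> / 4"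
    using \<open>\<epsilon> > 0\<close> by (intro order_tendstoD(2)) auto
  have "c \<ge> 0" unfolding c_def by (intro integral_nonneg_AE) auto
  show "\<forall>\<^sub>F m in sequentially. \<forall>p\<in>{0..T} \<times> UNIV.
     dist ((\<lambda>(t, y). disc_log_price \<mu> \<sigma> r T m (grid_index m t + 1) K y) p) ((\<lambda>(t, y). BS_log_price \<sigma> r T t K y) p) < \<epsilon>"
    using ev1 ev2 ev3 eventually_factors_pos[OF \<open>\<sigma> > 0\<close>, of \<mu> r]
  proof eventually_elim
    case (elim m)
    have "\<bar>disc_log_price \<mu> \<sigma> r T m (grid_index m t + 1) K y - BS_log_price \<sigma> r T t K y\<bar> < \<epsilon>"
      if t: "t \<in> {0..T}" for t y
    proof -
      let ?n = "n m t"
      define \<rho> where "\<rho> = bond_factor r m powi (- int ?n)"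
      define \<rho>' where "\<rho>' = exp (- r * (T - t))"
      define A where "A = (two_point (q_plus \<mu> \<sigma> r m) (ln (up_factor \<mu> \<sigma> m)) (ln (down_factor \<mu> \<sigma> m)) ^^ ?n) K y"
      define H where "H = heat a \<sigma> (real ?n * (1 / 2 ^ m)\<^sup>2) K y"
      define H' where "H' = heat a \<sigma> (T - t) K y"
      have "\<bar>A\<bar> \<le> B"
        using jet1_two_point_funpow[OF _ _ J1] elim(4) unfolding A_def jet1_def by blast
      have \<rho>': "0 \<le> \<rho>'" "\<rho>' \<le> 1" using t pos by (auto simp: \<rho>'_def)
      have 1: "\<bar>(\<rho> - \<rho>') * A\<bar> < \<epsilon> / 4"
      proof -
        have "\<bar>(\<rho> - \<rho>') * A\<bar> \<le> \<bar>\<rho> - \<rho>'\<bar> * B"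
          unfolding abs_mult using \<open>\<bar>A\<bar> \<le> B\<close> by (intro mult_left_mono) auto
        also have "\<dots> < \<epsilon> / (4 * B) * B"
          using elim(1) t \<open>B > 0\<close> unfolding \<rho>_def \<rho>'_def by (intro mult_strict_right_mono) auto
        finally show ?thesis using \<open>B > 0\<close> by simp
      qed
      have "\<bar>A - H\<bar> \<le> \<epsilon> / 4" using elim(2) n(2)[OF t] unfolding A_def H_def by blast
      have 2: "\<bar>\<rho>' * (A - H)\<bar> \<le> \<epsilon> / 4"
        using \<rho>' \<open>\<bar>A - H\<bar> \<le> \<epsilon> / 4\<close> unfolding abs_mult
        by (metis abs_ge_zero abs_of_nonneg mult_left_le_one_le order_trans)
      have "\<bar>H - H'\<bar> \<le> B * (\<bar>a\<bar> * \<bar>real ?n * (1 / 2 ^ m)\<^sup>2 - (T - t)\<bar> + \<sigma> * sqrt \<bar>real ?n * (1 / 2 ^ m)\<^sup>2 - (T - t)\<bar> * c)"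
        unfolding H_def H'_def c_def by (rule heat_time_lipschitz[OF J1]) (use t pos in auto)
      also have "\<dots> \<le> B * (\<bar>a\<bar> * (2 * (1 / 2 ^ m)\<^sup>2) + \<sigma> * sqrt (2 * (1 / 2 ^ m)\<^sup>2) * c)"
        using n(1)[OF t] pos \<open>c \<ge> 0\<close>
        by (intro mult_left_mono add_mono mult_right_mono real_sqrt_le_mono) auto
      also have "\<dots> < \<epsilon> / 4" by (rule elim(3))
      finally have "\<bar>H - H'\<bar> \<le> \<epsilon> / 4" by simp
      then have 3: "\<bar>\<rho>' * (H - H')\<bar> \<le> \<epsilon> / 4"
        using \<rho>' unfolding abs_mult by (metis abs_ge_zero abs_of_nonneg mult_left_le_one_le order_trans)
      have "disc_log_price \<mu> \<sigma> r T m (grid_index m t + 1) K y - BS_log_price \<sigma> r T t K y = \<rho> * A - \<rho>' * H'"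
        unfolding disc_log_price_def BS_log_price_def \<rho>_def \<rho>'_def A_def H'_def n_def a_def by simp
      also have "\<dots> = (\<rho> - \<rho>') * A + \<rho>' * (A - H) + \<rho>' * (H - H')" by (simp add: algebra_simps)
      also have "\<bar>\<dots>\<bar> < \<epsilon>" using 1 2 3 \<open>\<epsilon> > 0\<close> by linarith
      finally show ?thesis .
    qed
    then show ?case by (auto simp: dist_real_def)
  qed
qed

text \<open>The limit stays within 1 of some fixed B_m, and that is bounded by counting: at most T
  2^(2m) steps of size 1, plus the interpolation error. The bound later confines the log stock to a
  compact interval.\<close>

lemma BM_approx_limit_bounded:
  assumes x: "\<And>m k. k \<ge> 1 \<Longrightarrow> \<bar>x m k\<bar> = 1"
    and \<beta>: "uniform_limit {0..T} (BM_approx x) \<beta> sequentially"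
  obtains L where "\<And>t. t \<in> {0..T} \<Longrightarrow> \<bar>\<beta> t\<bar> \<le> L"
proof -
  from uniform_limitD[OF \<beta>, of 1] obtain m where m: "\<forall>t\<in>{0..T}. dist (BM_approx x m t) (\<beta> t) < 1"
    by (auto dest: eventually_happens)
  have w: "\<bar>twisted_walk x m k\<bar> \<le> real k" for k
    unfolding twisted_walk_def
    by (rule order_trans[OF sum_abs]) (use abs_twisted_step[of x _ m] x in simp)
  show ?thesis
  proof (rule that)
    fix t assume t: "t \<in> {0..T}"
    let ?k = "grid_index m t"
    have "real ?k / 2 ^ (2 * m) \<le> T" using grid_index_bounds(1)[of t m] t by (simp add: grid_time_def)
    then have k: "real ?k \<le> T * 2 ^ (2 * m)" by (simp add: field_simps)
    have "\<bar>BM_approx x m (grid_time m ?k)\<bar> \<le> \<bar>twisted_walk x m ?k\<bar> / 1"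
      unfolding BM_approx_grid abs_divide by (intro divide_left_mono) auto
    also have "\<dots> \<le> T * 2 ^ (2 * m)" using w[of ?k] k by simp
    finally have "\<bar>BM_approx x m (grid_time m ?k)\<bar> \<le> T * 2 ^ (2 * m)" .
    moreover have "\<bar>BM_approx x m (grid_time m ?k) - BM_approx x m t\<bar> \<le> 1 / 2 ^ m"
      using BM_approx_near_grid[of x t m] x t by auto
    moreover have "1 / 2 ^ m \<le> (1::real)" by simp
    moreover have "\<bar>BM_approx x m t - \<beta> t\<bar> < 1" using m t by (simp add: dist_real_def)
    ultimately show "\<bar>\<beta> t\<bar> \<le> T * 2 ^ (2 * m) + 2" by linarith
  qed
qed

text \<open>The chain rule for x = exp y: the derivative in x is the derivative in y divided by x.
  Differentiability of the price comes from its Taylor bound, without differentiating under the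
  expectation.\<close>

lemma deriv_BS_price_exp:
  assumes W: "standard_BM \<Omega> W" and "r > 0" "t \<le> T" and J: "jet1 B (\<lambda>y. g (exp y)) K1"
  shows "deriv (\<lambda>x. BS_price \<Omega> W \<sigma> r T g t x) (exp y) = BS_log_price \<sigma> r T t K1 y / exp y"
proof (rule DERIV_imp_deriv)
  let ?F = "BS_log_price \<sigma> r T t (\<lambda>y. g (exp y))"
  have "(?F has_real_derivative BS_log_price \<sigma> r T t K1 y) (at (ln (exp y)))"
    using jet1_has_deriv[OF jet1_BS_log_price[OF J assms(2,3)]] by simp
  from DERIV_chain2[OF this DERIV_ln_divide[of "exp y"]]
  have "((\<lambda>x. ?F (ln x)) has_real_derivative BS_log_price \<sigma> r T t K1 y / exp y) (at (exp y))" by simp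
  then show "((\<lambda>x. BS_price \<Omega> W \<sigma> r T g t x) has_real_derivative BS_log_price \<sigma> r T t K1 y / exp y) (at (exp y))"
  proof (rule has_field_derivative_transform_within_open[where S = "{0<..}"])
    fix x :: real assume "x \<in> {0<..}"
    then show "?F (ln x) = BS_price \<Omega> W \<sigma> r T g t x"
      using BS_price_exp[OF W \<open>t \<le> T\<close>, of g \<sigma> r "ln x"] J by (simp add: BS_log_price_def jet1_def)
  qed auto
qed

section \<open>Convergence of shares and bonds along a fixed path\<close>

lemma portfolio_uniform_limit:
  assumes x: "\<And>m k. k \<ge> 1 \<Longrightarrow> \<bar>x m k\<bar> = 1" and pos: "\<sigma> > 0" "r > 0" "T > 0" "s0 > 0"
    and g: "C2c_plus g" and W: "standard_BM \<Omega> W"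
    and \<beta>: "uniform_limit {0..T} (BM_approx x) \<beta> sequentially"
  shows "uniform_limit {0..T} (\<lambda>m t. disc_shares_path s0 \<mu> \<sigma> r T g x m (grid_index m t))
      (BS_shares \<Omega> W s0 \<mu> \<sigma> r T g \<beta>) sequentially" (is ?shares)
    and "uniform_limit {0..T} (\<lambda>m t. disc_bonds_path s0 \<mu> \<sigma> r T g x m (grid_index m t))
      (BS_bonds \<Omega> W s0 \<mu> \<sigma> r T g \<beta>) sequentially" (is ?bonds)
proof -
  define K where "K = (\<lambda>y. g (exp y))"
  define K1 where "K1 = (\<lambda>y. exp y * D_plus g (exp y))"
  define K2 where "K2 = (\<lambda>y. (exp y)\<^sup>2 * D_plus (D_plus g) (exp y) + exp y * D_plus g (exp y))"
  obtain B where "B > 0" and J1: "jet1 B K K1" and J2: "\<And>\<delta>. \<delta> > 0 \<Longrightarrow> \<exists>C\<ge>0. jet2 B \<delta> C K K1 K2"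
    using payoff_jets[OF g] unfolding K_def K1_def K2_def by blast
  define k where "k m t = grid_index m t" for m t
  define \<Phi> where "\<Phi> m t = disc_log_price \<mu> \<sigma> r T m (k m t + 1) K" for m t
  define \<Phi>1 where "\<Phi>1 m t = disc_log_price \<mu> \<sigma> r T m (k m t + 1) K1" for m t
  define \<Psi> where "\<Psi> t = BS_log_price \<sigma> r T t K" for t
  define \<Psi>1 where "\<Psi>1 t = BS_log_price \<sigma> r T t K1" for t
  define u where "u m = up_factor \<mu> \<sigma> m" for m
  define d where "d m = down_factor \<mu> \<sigma> m" for m
  define S where "S m t = disc_stock s0 \<mu> \<sigma> x m (k m t)" for m t
  define \<eta> where "\<eta> t = ln s0 + (\<mu> - \<sigma>\<^sup>2 / 2) * t + \<sigma> * \<beta> t" for t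
  \<comment> \<open>The amount of money held in stock, that is shares times stock price. It is a
    difference quotient of the log price, and shares and bonds are both obtained from it by
    multiplication with convergent factors.\<close>
  define Z where "Z m t = (\<Phi> m t (ln (S m t) + ln (u m)) - \<Phi> m t (ln (S m t) + ln (d m))) / (u m - d m)" for m t

  have \<Phi>_lim: "uniform_limit ({0..T} \<times> UNIV) (\<lambda>m (t, y). \<Phi> m t y) (\<lambda>(t, y). \<Psi> t y) sequentially"
    unfolding \<Phi>_def \<Psi>_def k_def by (rule disc_log_price_uniform_limit[OF pos(1-3) \<open>B > 0\<close> J1 J2])
  have J\<Psi>: "jet1 B (\<Psi> t) (\<Psi>1 t)" if "t \<in> {0..T}" for t
    unfolding \<Psi>_def \<Psi>1_def using that pos by (intro jet1_BS_log_price J1) auto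
  have J\<Phi>: "\<forall>\<^sub>F m in sequentially. \<forall>t\<in>{0..T}. jet1 B (\<Phi> m t) (\<Phi>1 m t)"
    using eventually_factors_pos[OF \<open>\<sigma> > 0\<close>, of \<mu> r]
    by eventually_elim (auto simp: \<Phi>_def \<Phi>1_def intro!: jet1_disc_log_price J1 pos)
  have \<Phi>1_lim: "uniform_limit ({0..T} \<times> UNIV) (\<lambda>m (t, y). \<Phi>1 m t y) (\<lambda>(t, y). \<Psi>1 t y) sequentially"
    by (rule jet1_uniform_limit_deriv[OF J\<Phi> J\<Psi> \<Phi>_lim \<open>B > 0\<close>])
  have S_lim: "uniform_limit {0..T} (\<lambda>m t. ln (S m t)) \<eta> sequentially"
    unfolding S_def k_def \<eta>_def[abs_def]
    by (rule ln_disc_stock_uniform_limit(1)[OF _ \<open>s0 > 0\<close> pos(1,3) \<beta>]) (use x in auto)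
  have "\<forall>\<^sub>F m in sequentially. \<forall>k. disc_stock s0 \<mu> \<sigma> x m k > 0"
    by (rule ln_disc_stock_uniform_limit(2)[OF _ \<open>s0 > 0\<close> pos(1,3) \<beta>]) (use x in auto)
  then have S_pos: "\<forall>\<^sub>F m in sequentially. \<forall>t. S m t > 0"
    by eventually_elim (simp add: S_def)

  have lu_lim: "(\<lambda>m. ln (u m)) \<longlonglongrightarrow> 0"
  proof -
    have "((\<lambda>p. ln (1 + \<sigma> * p + \<mu> * p\<^sup>2)) \<longlongrightarrow> 0) (at_right 0)" using pos by real_asymp
    from filterlim_compose[OF this filterlim_step_size] show ?thesis by (simp add: u_def factors_in_step_size)
  qed
  have u_lim: "(\<lambda>m. u m) \<longlonglongrightarrow> 1"
  proof -
    have "((\<lambda>p. 1 + \<sigma> * p + \<mu> * p\<^sup>2) \<longlongrightarrow> 1) (at_right 0)" by (auto intro!: tendsto_eq_intros)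
    from filterlim_compose[OF this filterlim_step_size] show ?thesis by (simp add: u_def factors_in_step_size)
  qed
  have ud: "u m - d m = 2 * \<sigma> * (1 / 2 ^ m)" for m by (simp add: u_def d_def factors_in_step_size)
  \<comment> \<open>The quotient \<open>Z\<close> has y-increment ln u - ln d but denominator u - d.
    Their ratio tends to 1, and the Taylor remainders, of order p^2, are divided by 2 \<sigma>
    p.\<close>
  have err_lim: "(\<lambda>m. B * \<bar>(ln (u m) - ln (d m)) / (u m - d m) - 1\<bar>
      + B * (((ln (u m))\<^sup>2 + (ln (d m))\<^sup>2) / (u m - d m))) \<longlonglongrightarrow> 0"
  proof -
    have "((\<lambda>p. (ln (1 + \<sigma> * p + \<mu> * p\<^sup>2) - ln (1 - \<sigma> * p + \<mu> * p\<^sup>2)) / (2 * \<sigma> * p)) \<longlongrightarrow> 1) (at_right 0)"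
      "((\<lambda>p. ((ln (1 + \<sigma> * p + \<mu> * p\<^sup>2))\<^sup>2 + (ln (1 - \<sigma> * p + \<mu> * p\<^sup>2))\<^sup>2) / (2 * \<sigma> * p)) \<longlongrightarrow> 0) (at_right 0)"
      using pos by real_asymp+
    note this[THEN filterlim_compose, OF filterlim_step_size, folded factors_in_step_size, folded u_def d_def, folded ud]
    from tendsto_add[OF tendsto_mult[OF tendsto_const[of B] tendsto_rabs[OF tendsto_diff[OF this(1) tendsto_const[of 1]]]]
        tendsto_mult[OF tendsto_const[of B] this(2)]]
    show ?thesis by simp
  qed

  have Z_lim: "uniform_limit {0..T} Z (\<lambda>t. \<Psi>1 t (\<eta> t)) sequentially"
  proof -
    have 1: "uniform_limit {0..T} (\<lambda>m t. \<Phi>1 m t (ln (S m t))) (\<lambda>t. \<Psi>1 t (\<eta> t)) sequentially"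
      by (rule uniform_limit_compose_lipschitz[OF \<Phi>1_lim _ _ S_lim, where L = "2 * B"])
         (use jet1_lipschitz(2)[OF J\<Psi>] \<open>B > 0\<close> in auto)
    have "uniform_limit {0..T} (\<lambda>m t. Z m t - \<Phi>1 m t (ln (S m t))) (\<lambda>t. 0) sequentially"
    proof (rule uniform_limit_squeeze[OF _ err_lim])
      show "\<forall>\<^sub>F m in sequentially. \<forall>t\<in>{0..T}. \<bar>Z m t - \<Phi>1 m t (ln (S m t)) - 0\<bar>
        \<le> B * \<bar>(ln (u m) - ln (d m)) / (u m - d m) - 1\<bar> + B * (((ln (u m))\<^sup>2 + (ln (d m))\<^sup>2) / (u m - d m))"
        using J\<Phi>
      proof eventually_elim
        case (elim m)
        show ?case
        proof
          fix t assume "t \<in> {0..T}"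
          then have J: "jet1 B (\<Phi> m t) (\<Phi>1 m t)" using elim by blast
          define y where "y = ln (S m t)"
          define v where "v = ln (u m)"
          define w where "w = ln (d m)"
          define D where "D = u m - d m"
          define R where "R h = \<Phi> m t (y + h) - \<Phi> m t y - h * \<Phi>1 m t y" for h
          have "D > 0" using pos by (simp add: D_def ud)
          have R: "\<bar>R h\<bar> \<le> B * h\<^sup>2" and b: "\<bar>\<Phi>1 m t y\<bar> \<le> B" for h
            using J unfolding jet1_def R_def by blast+
          have "Z m t - \<Phi>1 m t y = \<Phi>1 m t y * ((v - w) / D - 1) + (R v - R w) / D"
            unfolding Z_def y_def[symmetric] v_def[symmetric] w_def[symmetric] D_def[symmetric] R_def
            using \<open>D > 0\<close> by (simp add: field_simps)
          also have "\<bar>\<dots>\<bar> \<le> \<bar>\<Phi>1 m t y\<bar> * \<bar>(v - w) / D - 1\<bar> + \<bar>R v - R w\<bar> / D"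
            using \<open>D > 0\<close> by (intro order_trans[OF abs_triangle_ineq]) (simp add: abs_mult abs_divide)
          also have "\<dots> \<le> B * \<bar>(v - w) / D - 1\<bar> + (B * v\<^sup>2 + B * w\<^sup>2) / D"
            using \<open>D > 0\<close> b R[of v] R[of w] by (intro add_mono mult_right_mono divide_right_mono) auto
          finally show "\<bar>Z m t - \<Phi>1 m t (ln (S m t)) - 0\<bar>
            \<le> B * \<bar>(ln (u m) - ln (d m)) / (u m - d m) - 1\<bar> + B * (((ln (u m))\<^sup>2 + (ln (d m))\<^sup>2) / (u m - d m))"
            unfolding y_def v_def w_def D_def by (simp add: distrib_left)
        qed
      qed
    qed
    from uniform_limit_add[OF this 1] show ?thesis by simp
  qed

  obtain L where L: "\<And>t. t \<in> {0..T} \<Longrightarrow> \<bar>\<beta> t\<bar> \<le> L" using BM_approx_limit_bounded[OF x \<beta>] by blast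
  define M where "M = \<bar>ln s0\<bar> + \<bar>\<mu> - \<sigma>\<^sup>2 / 2\<bar> * T + \<sigma> * L"
  have \<eta>_bound: "\<bar>\<eta> t\<bar> \<le> M" if t: "t \<in> {0..T}" for t
  proof -
    have "\<bar>(\<mu> - \<sigma>\<^sup>2 / 2) * t\<bar> \<le> \<bar>\<mu> - \<sigma>\<^sup>2 / 2\<bar> * T" unfolding abs_mult using t by (intro mult_left_mono) auto
    moreover have "\<bar>\<sigma> * \<beta> t\<bar> \<le> \<sigma> * L" using L[OF t] pos by (simp add: abs_mult)
    ultimately show ?thesis unfolding \<eta>_def M_def by linarith
  qed
  \<comment> \<open>The exponential is uniformly continuous on bounded sets only, so the log stock
    is first confined to a ball of radius M + 1.\<close>
  have exp_lim: "uniform_limit {0..T} (\<lambda>m t. exp (- ln (S m t))) (\<lambda>t. exp (- \<eta> t)) sequentially"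
  proof (rule uniform_limit_compose_uniformly_continuous_on[OF S_lim, where B = "cball 0 (M + 1)"])
    show "uniformly_continuous_on (cball 0 (M + 1)) (\<lambda>y::real. exp (- y))"
      by (intro compact_uniformly_continuous continuous_intros) auto
    show "\<forall>\<^sub>F m in sequentially. \<forall>t\<in>{0..T}. ln (S m t) \<in> cball 0 (M + 1)"
      using uniform_limitD[OF S_lim zero_less_one]
    proof eventually_elim
      case (elim m)
      show ?case using elim \<eta>_bound by (fastforce simp: dist_real_def)
    qed
  qed auto
  have bdd_exp: "bounded ((\<lambda>t. exp (- \<eta> t)) ` {0..T})"
    unfolding bounded_iff using \<eta>_bound by (intro exI[of _ "exp M"]) (force simp: abs_le_iff)
  have bdd\<Psi>: "bounded ((\<lambda>t. \<Psi> t (\<eta> t)) ` {0..T})" "bounded ((\<lambda>t. \<Psi>1 t (\<eta> t)) ` {0..T})"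
    unfolding bounded_iff using J\<Psi> unfolding jet1_def by (auto intro!: exI[of _ B])

  have price: "disc_price \<mu> \<sigma> r T g m (k m t + 1) (exp y) = \<Phi> m t y" if "0 < u m" "0 < d m" for m t y
    using disc_price_exp[of \<mu> \<sigma> m r T g "k m t + 1" y] that by (simp add: \<Phi>_def disc_log_price_def u_def d_def K_def)
  have BS_S: "BS_stock s0 \<mu> \<sigma> \<beta> t = exp (\<eta> t)" for t
    using pos by (simp add: BS_stock_def \<eta>_def exp_add)
  have BS_deriv: "deriv (\<lambda>x. BS_price \<Omega> W \<sigma> r T g t x) (BS_stock s0 \<mu> \<sigma> \<beta> t) = \<Psi>1 t (\<eta> t) / exp (\<eta> t)"
    if "t \<in> {0..T}" for t
    unfolding BS_S \<Psi>1_def using that pos J1 K_def by (intro deriv_BS_price_exp[OF W]) auto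
  have BS_price: "BS_price \<Omega> W \<sigma> r T g t (BS_stock s0 \<mu> \<sigma> \<beta> t) = \<Psi> t (\<eta> t)" if "t \<in> {0..T}" for t
    using that J1 unfolding BS_S \<Psi>_def BS_log_price_def K_def jet1_def by (intro BS_price_exp[OF W]) auto

  have shares: "\<forall>\<^sub>F m in sequentially. \<forall>t. disc_shares \<mu> \<sigma> r T g m (k m t) (S m t) = Z m t * exp (- ln (S m t))"
    using S_pos eventually_factors_pos[OF \<open>\<sigma> > 0\<close>, of \<mu> r]
  proof eventually_elim
    case (elim m)
    show ?case
    proof
      fix t
      have S: "S m t > 0" and ud': "u m > 0" "d m > 0" using elim by (auto simp: u_def d_def)
      have "u m * S m t = exp (ln (S m t) + ln (u m))" "d m * S m t = exp (ln (S m t) + ln (d m))"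
        using S ud' by (simp_all add: exp_add)
      moreover have "exp (- ln (S m t)) = 1 / S m t" using S by (simp add: exp_minus inverse_eq_divide)
      ultimately show "disc_shares \<mu> \<sigma> r T g m (k m t) (S m t) = Z m t * exp (- ln (S m t))"
        unfolding disc_shares_def u_def[symmetric] d_def[symmetric] Z_def using price ud' by simp
    qed
  qed

  have "uniform_limit {0..T} (\<lambda>m t. Z m t * exp (- ln (S m t))) (\<lambda>t. \<Psi>1 t (\<eta> t) * exp (- \<eta> t)) sequentially"
    by (rule uniform_lim_mult[OF Z_lim exp_lim bdd\<Psi>(2) bdd_exp])
  then show ?shares
  proof (rule uniform_limit_cong[THEN iffD1, rotated 2])
    show "\<forall>\<^sub>F m in sequentially. \<forall>t\<in>{0..T}. Z m t * exp (- ln (S m t)) = disc_shares_path s0 \<mu> \<sigma> r T g x m (grid_index m t)"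
      using shares by eventually_elim (simp add: disc_shares_path_def S_def k_def)
    show "\<Psi>1 t (\<eta> t) * exp (- \<eta> t) = BS_shares \<Omega> W s0 \<mu> \<sigma> r T g \<beta> t" if "t \<in> {0..T}" for t
      unfolding BS_shares_def BS_deriv[OF that] by (simp add: exp_minus divide_inverse)
  qed

  have \<Phi>u_lim: "uniform_limit {0..T} (\<lambda>m t. \<Phi> m t (ln (S m t) + ln (u m))) (\<lambda>t. \<Psi> t (\<eta> t)) sequentially"
  proof (rule uniform_limit_compose_lipschitz[OF \<Phi>_lim _ \<open>B > 0\<close>])
    have "uniform_limit {0..T} (\<lambda>m t. ln (u m)) (\<lambda>t. 0) sequentially"
      by (rule uniform_limit_squeeze[OF _ tendsto_rabs_zero[OF lu_lim]]) simp
    from uniform_limit_add[OF S_lim this]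
    show "uniform_limit {0..T} (\<lambda>m t. ln (S m t) + ln (u m)) \<eta> sequentially" by simp
  qed (use jet1_lipschitz(1)[OF J\<Psi>] in auto)
  have u_ulim: "uniform_limit {0..T} (\<lambda>m t. u m) (\<lambda>t. 1) sequentially"
    by (rule uniform_limit_squeeze[OF _ tendsto_rabs_zero[OF LIM_zero[OF u_lim]]]) simp
  \<comment> \<open>The bond formula discounts by k + 1 steps; k + 1 steps differ from t by at most
    one step, so the limit is still exp (- r t).\<close>
  have disc_lim: "uniform_limit {0..T} (\<lambda>m t. bond_factor r m powi (- int (k m t + 1))) (\<lambda>t. exp (- r * t)) sequentially"
  proof (rule discount_uniform_limit[where T = T])
    fix m t assume "t \<in> {0..T}"
    then show "\<bar>real (k m t + 1) * (1 / 2 ^ m)\<^sup>2 - t\<bar> \<le> 2 * (1 / 2 ^ m)\<^sup>2"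
      using grid_index_bounds[of t m] unfolding grid_time_eq k_def[symmetric] by (simp add: distrib_right)
  qed (use pos in auto)
  have uZ: "uniform_limit {0..T} (\<lambda>m t. u m * Z m t) (\<lambda>t. 1 * \<Psi>1 t (\<eta> t)) sequentially"
    by (rule uniform_lim_mult[OF u_ulim Z_lim _ bdd\<Psi>(2)]) (auto simp: bounded_iff)
  have "bounded ((\<lambda>t. exp (- r * t)) ` {0..T})"
    unfolding bounded_iff using pos by (intro exI[of _ 1]) auto
  moreover have "bounded ((\<lambda>t. \<Psi> t (\<eta> t) - 1 * \<Psi>1 t (\<eta> t)) ` {0..T})"
    using bounded_minus_comp[OF bdd\<Psi>] by simp
  ultimately have "uniform_limit {0..T} (\<lambda>m t. bond_factor r m powi (- int (k m t + 1)) *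
      (\<Phi> m t (ln (S m t) + ln (u m)) - u m * Z m t)) (\<lambda>t. exp (- r * t) * (\<Psi> t (\<eta> t) - 1 * \<Psi>1 t (\<eta> t))) sequentially"
    by (intro uniform_lim_mult[OF disc_lim uniform_limit_minus[OF \<Phi>u_lim uZ]])
  then show ?bonds
  proof (rule uniform_limit_cong[THEN iffD1, rotated 2])
    show "\<forall>\<^sub>F m in sequentially. \<forall>t\<in>{0..T}. bond_factor r m powi (- int (k m t + 1)) *
      (\<Phi> m t (ln (S m t) + ln (u m)) - u m * Z m t) = disc_bonds_path s0 \<mu> \<sigma> r T g x m (grid_index m t)"
      using shares S_pos eventually_factors_pos[OF \<open>\<sigma> > 0\<close>, of \<mu> r]
    proof eventually_elim
      case (elim m)
      show ?case
      proof
        fix t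
        have S: "S m t > 0" and ud': "u m > 0" "d m > 0" using elim by (auto simp: u_def d_def)
        have uS: "u m * S m t = exp (ln (S m t) + ln (u m))" using S ud' by (simp add: exp_add)
        \<comment> \<open>The factor exp (- ln S) of the shares cancels against the stock price, so
          the bonds need only \<open>Z\<close>.\<close>
        have "disc_shares \<mu> \<sigma> r T g m (k m t) (S m t) * u m * S m t = u m * Z m t"
          using elim(1) S by (simp add: exp_minus)
        moreover have "- int (k m t) - 1 = - int (k m t + 1)" by simp
        ultimately show "bond_factor r m powi (- int (k m t + 1)) *
           (\<Phi> m t (ln (S m t) + ln (u m)) - u m * Z m t) = disc_bonds_path s0 \<mu> \<sigma> r T g x m (grid_index m t)"
          unfolding disc_bonds_path_def disc_bonds_def k_def[symmetric] S_def[symmetric] u_def[symmetric]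
          using price[OF ud'] by (simp only: uS)
      qed
    qed
    show "exp (- r * t) * (\<Psi> t (\<eta> t) - 1 * \<Psi>1 t (\<eta> t)) = BS_bonds \<Omega> W s0 \<mu> \<sigma> r T g \<beta> t" if "t \<in> {0..T}" for t
      unfolding BS_bonds_def BS_deriv[OF that] BS_price[OF that] unfolding BS_S by simp
  qed
qed

text \<open>In \<open>ereal\<close> the supremum exists without prior knowledge of boundedness;
  \<open>X\<close> must be nonempty because the empty supremum is minus infinity.\<close>

lemma uniform_limit_imp_SUP_tendsto_0:
  fixes f :: "nat \<Rightarrow> 'x \<Rightarrow> real"
  assumes "uniform_limit X f l sequentially" "X \<noteq> {}"
  shows "(\<lambda>n. SUP x\<in>X. ereal \<bar>f n x - l x\<bar>) \<longlonglongrightarrow> 0"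
proof (rule order_tendstoI)
  fix c :: ereal assume "c < 0"
  have "0 \<le> (SUP x\<in>X. ereal \<bar>f n x - l x\<bar>)" for n
  proof -
    obtain x where x: "x \<in> X" using assms(2) by blast
    show ?thesis by (rule SUP_upper2[OF x]) simp
  qed
  with \<open>c < 0\<close> show "\<forall>\<^sub>F n in sequentially. c < (SUP x\<in>X. ereal \<bar>f n x - l x\<bar>)"
    by (intro always_eventually allI) (rule less_le_trans)
next
  fix c :: ereal assume "0 < c"
  from ereal_dense2[OF this] obtain e where e: "0 < ereal e" "ereal e < c" by metis
  then have "\<forall>\<^sub>F n in sequentially. \<forall>x\<in>X. dist (f n x) (l x) < e"
    using uniform_limitD[OF assms(1)] by simp
  then show "\<forall>\<^sub>F n in sequentially. (SUP x\<in>X. ereal \<bar>f n x - l x\<bar>) < c"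
  proof eventually_elim
    case (elim n)
    have "(SUP x\<in>X. ereal \<bar>f n x - l x\<bar>) \<le> ereal e"
      using elim by (intro SUP_least) (auto simp: dist_real_def less_imp_le)
    then show ?case using e(2) by (rule le_less_trans)
  qed
qed

text \<open>The two values carry probability 1/2 + 1/2 = 1, and the countably many exceptional null
  sets are combined into one.\<close>

lemma AE_iid_signs:
  assumes "prob_space \<Omega>" "iid_signs \<Omega> X"
  shows "AE \<omega> in \<Omega>. \<forall>m. \<forall>k\<ge>1. \<bar>X m k \<omega>\<bar> = 1"
proof -
  interpret prob_space \<Omega> by fact
  have "AE \<omega> in \<Omega>. \<bar>X m k \<omega>\<bar> = 1" if "k \<ge> 1" for m k
  proof -
    have "indep_vars (\<lambda>_. borel) (\<lambda>(m, k). X m k) (UNIV \<times> {1..})"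
      using assms(2) by (simp add: iid_signs_def)
    then have "(case (m, k) of (m, k) \<Rightarrow> X m k) \<in> borel_measurable \<Omega>"
      using that unfolding indep_vars_def by blast
    then have [measurable]: "X m k \<in> borel_measurable \<Omega>" by simp
    let ?P = "\<lambda>c. {\<omega> \<in> space \<Omega>. X m k \<omega> = c}"
    have "prob (?P 1 \<union> ?P (-1)) = prob (?P 1) + prob (?P (-1))"
      by (rule finite_measure_Union) auto
    also have "prob (?P 1) = 1/2" using assms(2) that unfolding iid_signs_def by blast
    also have "prob (?P (-1)) = 1/2" using assms(2) that unfolding iid_signs_def by blast
    also have "?P 1 \<union> ?P (-1) = {\<omega> \<in> space \<Omega>. \<bar>X m k \<omega>\<bar> = 1}" by (auto simp: abs_eq_iff')
    finally have "prob {\<omega> \<in> space \<Omega>. \<bar>X m k \<omega>\<bar> = 1} = 1" by simp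
    then show ?thesis by (subst prob_Collect_eq_1[symmetric]) simp_all
  qed
  then show ?thesis by (simp add: AE_all_countable)
qed

text \<open>The condition on \<open>m_zero\<close> controls the weights only and leaves room for
  \<sigma> 2^-m > 1. Requiring \<open>0 \<le> down_factor \<mu> \<sigma> m\<close> and
  \<open>x > 0\<close> keeps the stock values in the domain of \<open>g\<close> and the denominator
  of \<open>disc_shares\<close> away from 0.\<close>

theorem theorem2:
  fixes \<mu> \<sigma> r T :: real
  assumes "\<sigma> > 0" and "r > 0" and "T > 0"
  shows
    "(\<exists>c3\<ge>0. \<forall>s0>0. \<forall>g. C2c_plus g \<and> bdd_above ((\<lambda>s. \<bar>D_plus (D_plus g) s\<bar>) ` {0..}) \<longrightarrow>
        (let M = (SUP s\<in>{0..}. \<bar>D_plus (D_plus g) s\<bar>) in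
         \<forall>m k. m_zero \<mu> \<sigma> r < ereal (real m) \<and> 0 \<le> down_factor \<mu> \<sigma> m \<and>
               grid_time m k \<in> {0..T} \<longrightarrow>
           (\<forall>x \<in> stock_values s0 \<mu> \<sigma> m k. x > 0 \<longrightarrow>
              \<bar>disc_shares \<mu> \<sigma> r T g m k x - deriv (\<lambda>y. disc_price \<mu> \<sigma> r T g m (k + 1) y) x\<bar>
                \<le> c3 * M * x / 2^m \<and>
              \<bar>disc_bonds \<mu> \<sigma> r T g m k x
                 - bond_factor r m powi (- int k - 1) *
                   (disc_price \<mu> \<sigma> r T g m (k + 1) (up_factor \<mu> \<sigma> m * x)
                    - up_factor \<mu> \<sigma> m * x * deriv (\<lambda>y. disc_price \<mu> \<sigma> r T g m (k + 1) y) x)\<bar>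
                \<le> c3 * M * (1 + \<sigma> / 2^m + \<bar>\<mu>\<bar> / 2^(2*m)) * x\<^sup>2 / 2^m)))
     \<and>
     (\<forall>s0>0. \<forall>g. C2c_plus g \<and> bdd_above ((\<lambda>s. \<bar>D_plus (D_plus g) s\<bar>) ` {0..}) \<longrightarrow>
       (\<forall>(\<Omega> :: 'a measure) (X :: nat \<Rightarrow> nat \<Rightarrow> 'a \<Rightarrow> real) (B :: real \<Rightarrow> 'a \<Rightarrow> real)
         (\<Omega>' :: 'b measure) (W :: real \<Rightarrow> 'b \<Rightarrow> real).
          prob_space \<Omega> \<and> complete_measure \<Omega> \<and> iid_signs \<Omega> X \<and> BM_limit \<Omega> X B \<and>
          standard_BM \<Omega>' W \<longrightarrow>
          (AE \<omega> in \<Omega>.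
             (\<lambda>m. SUP t\<in>{0..T}. ereal
                \<bar>disc_shares_path s0 \<mu> \<sigma> r T g (\<lambda>m k. X m k \<omega>) m (grid_index m t)
                  - BS_shares \<Omega>' W s0 \<mu> \<sigma> r T g (\<lambda>t. B t \<omega>) t\<bar>) \<longlonglongrightarrow> 0 \<and>
             (\<lambda>m. SUP t\<in>{0..T}. ereal
                \<bar>disc_bonds_path s0 \<mu> \<sigma> r T g (\<lambda>m k. X m k \<omega>) m (grid_index m t)
                  - BS_bonds \<Omega>' W s0 \<mu> \<sigma> r T g (\<lambda>t. B t \<omega>) t\<bar>) \<longlonglongrightarrow> 0)))"
proof (intro conjI)
  let ?C = "2 * \<bar>\<mu>\<bar> + \<mu>\<^sup>2 + 2 * (1 + \<bar>\<mu>\<bar>) * \<bar>r - \<mu>\<bar> + \<sigma>\<^sup>2"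
  \<comment> \<open>The first factor comes from the remainders divided by u - d, the exponential
    from the second moment of the remaining steps; neither involves s0, g, m or k.\<close>
  define c3 where "c3 = (\<sigma> + \<mu>\<^sup>2 / \<sigma>) * exp (?C * T)"
  show "\<exists>c3\<ge>0. \<forall>s0>0. \<forall>g. C2c_plus g \<and> bdd_above ((\<lambda>s. \<bar>D_plus (D_plus g) s\<bar>) ` {0..}) \<longrightarrow>
        (let M = (SUP s\<in>{0..}. \<bar>D_plus (D_plus g) s\<bar>) in
         \<forall>m k. m_zero \<mu> \<sigma> r < ereal (real m) \<and> 0 \<le> down_factor \<mu> \<sigma> m \<and>
               grid_time m k \<in> {0..T} \<longrightarrow>
           (\<forall>x \<in> stock_values s0 \<mu> \<sigma> m k. x > 0 \<longrightarrow>
              \<bar>disc_shares \<mu> \<sigma> r T g m k x - deriv (\<lambda>y. disc_price \<mu> \<sigma> r T g m (k + 1) y) x\<bar>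
                \<le> c3 * M * x / 2^m \<and>
              \<bar>disc_bonds \<mu> \<sigma> r T g m k x
                 - bond_factor r m powi (- int k - 1) *
                   (disc_price \<mu> \<sigma> r T g m (k + 1) (up_factor \<mu> \<sigma> m * x)
                    - up_factor \<mu> \<sigma> m * x * deriv (\<lambda>y. disc_price \<mu> \<sigma> r T g m (k + 1) y) x)\<bar>
                \<le> c3 * M * (1 + \<sigma> / 2^m + \<bar>\<mu>\<bar> / 2^(2*m)) * x\<^sup>2 / 2^m))"
    unfolding Let_def
  proof (intro exI[of _ c3] conjI allI impI ballI)
    show "0 \<le> c3" using assms by (simp add: c3_def)
    fix s0 g m k x
    assume "s0 > 0" and g: "C2c_plus g \<and> bdd_above ((\<lambda>s. \<bar>D_plus (D_plus g) s\<bar>) ` {0..})"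
      and m: "m_zero \<mu> \<sigma> r < ereal (real m) \<and> 0 \<le> down_factor \<mu> \<sigma> m \<and> grid_time m k \<in> {0..T}"
      and "x \<in> stock_values s0 \<mu> \<sigma> m k" "x > 0"
    define M where "M = (SUP s\<in>{0..}. \<bar>D_plus (D_plus g) s\<bar>)"
    have M: "\<bar>D_plus (D_plus g) s\<bar> \<le> M" if "0 \<le> s" for s
      unfolding M_def using g that by (intro cSUP_upper) auto
    have A: "\<bar>disc_shares \<mu> \<sigma> r T g m k x - deriv (\<lambda>y. disc_price \<mu> \<sigma> r T g m (k + 1) y) x\<bar>
        \<le> c3 * M * x / 2^m"
      unfolding c3_def using disc_shares_deriv_bound[OF assms _ M] g m m_zero_less_imp[OF assms(1)] \<open>x > 0\<close> by blast
    then show "\<bar>disc_shares \<mu> \<sigma> r T g m k x - deriv (\<lambda>y. disc_price \<mu> \<sigma> r T g m (k + 1) y) x\<bar>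
        \<le> c3 * (SUP s\<in>{0..}. \<bar>D_plus (D_plus g) s\<bar>) * x / 2^m"
      unfolding M_def .
    show "\<bar>disc_bonds \<mu> \<sigma> r T g m k x
                 - bond_factor r m powi (- int k - 1) *
                   (disc_price \<mu> \<sigma> r T g m (k + 1) (up_factor \<mu> \<sigma> m * x)
                    - up_factor \<mu> \<sigma> m * x * deriv (\<lambda>y. disc_price \<mu> \<sigma> r T g m (k + 1) y) x)\<bar>
                \<le> c3 * (SUP s\<in>{0..}. \<bar>D_plus (D_plus g) s\<bar>) * (1 + \<sigma> / 2^m + \<bar>\<mu>\<bar> / 2^(2*m)) * x\<^sup>2 / 2^m"
      using disc_bonds_deriv_bound[OF assms(1,2) \<open>x > 0\<close> _ A] m
      unfolding M_def by (simp add: power2_eq_square mult_ac)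
  qed
next
  show "\<forall>s0>0. \<forall>g. C2c_plus g \<and> bdd_above ((\<lambda>s. \<bar>D_plus (D_plus g) s\<bar>) ` {0..}) \<longrightarrow>
       (\<forall>(\<Omega> :: 'a measure) (X :: nat \<Rightarrow> nat \<Rightarrow> 'a \<Rightarrow> real) (B :: real \<Rightarrow> 'a \<Rightarrow> real)
         (\<Omega>' :: 'b measure) (W :: real \<Rightarrow> 'b \<Rightarrow> real).
          prob_space \<Omega> \<and> complete_measure \<Omega> \<and> iid_signs \<Omega> X \<and> BM_limit \<Omega> X B \<and>
          standard_BM \<Omega>' W \<longrightarrow>
          (AE \<omega> in \<Omega>.
             (\<lambda>m. SUP t\<in>{0..T}. ereal
                \<bar>disc_shares_path s0 \<mu> \<sigma> r T g (\<lambda>m k. X m k \<omega>) m (grid_index m t)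
                  - BS_shares \<Omega>' W s0 \<mu> \<sigma> r T g (\<lambda>t. B t \<omega>) t\<bar>) \<longlonglongrightarrow> 0 \<and>
             (\<lambda>m. SUP t\<in>{0..T}. ereal
                \<bar>disc_bonds_path s0 \<mu> \<sigma> r T g (\<lambda>m k. X m k \<omega>) m (grid_index m t)
                  - BS_bonds \<Omega>' W s0 \<mu> \<sigma> r T g (\<lambda>t. B t \<omega>) t\<bar>) \<longlonglongrightarrow> 0))"
  proof (intro allI impI, elim conjE)
    fix s0 :: real and g and \<Omega> :: "'a measure" and X B and \<Omega>' :: "'b measure" and W
    assume "s0 > 0" "C2c_plus g" "prob_space \<Omega>" "iid_signs \<Omega> X" and BM: "BM_limit \<Omega> X B"
      and W: "standard_BM \<Omega>' W"
    have "AE \<omega> in \<Omega>. \<forall>K\<ge>0. uniform_limit {0..K}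
        (\<lambda>m t. BM_approx (\<lambda>m k. X m k \<omega>) m t) (\<lambda>t. B t \<omega>) sequentially"
      using BM by (simp add: BM_limit_def)
    \<comment> \<open>Outside one null set the path has steps of size 1 and B_m converges uniformly;
      the rest is the deterministic statement for that path.\<close>
    with AE_iid_signs[OF \<open>prob_space \<Omega>\<close> \<open>iid_signs \<Omega> X\<close>]
    show "AE \<omega> in \<Omega>.
             (\<lambda>m. SUP t\<in>{0..T}. ereal
                \<bar>disc_shares_path s0 \<mu> \<sigma> r T g (\<lambda>m k. X m k \<omega>) m (grid_index m t)
                  - BS_shares \<Omega>' W s0 \<mu> \<sigma> r T g (\<lambda>t. B t \<omega>) t\<bar>) \<longlonglongrightarrow> 0 \<and>
             (\<lambda>m. SUP t\<in>{0..T}. ereal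
                \<bar>disc_bonds_path s0 \<mu> \<sigma> r T g (\<lambda>m k. X m k \<omega>) m (grid_index m t)
                  - BS_bonds \<Omega>' W s0 \<mu> \<sigma> r T g (\<lambda>t. B t \<omega>) t\<bar>) \<longlonglongrightarrow> 0"
    proof eventually_elim
      case (elim \<omega>)
      have x: "\<bar>X m k \<omega>\<bar> = 1" if "k \<ge> 1" for m k using elim(1) that by blast
      have \<beta>: "uniform_limit {0..T} (BM_approx (\<lambda>m k. X m k \<omega>)) (\<lambda>t. B t \<omega>) sequentially"
        using elim(2) assms(3) by simp
      have ne: "{0..T} \<noteq> {}" using assms(3) by simp
      note lim = portfolio_uniform_limit[OF _ assms \<open>s0 > 0\<close> \<open>C2c_plus g\<close> W \<beta>]
      show ?case
      proof (intro conjI uniform_limit_imp_SUP_tendsto_0 ne)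
        show "uniform_limit {0..T} (\<lambda>m t. disc_shares_path s0 \<mu> \<sigma> r T g (\<lambda>m k. X m k \<omega>) m (grid_index m t))
            (BS_shares \<Omega>' W s0 \<mu> \<sigma> r T g (\<lambda>t. B t \<omega>)) sequentially"
          by (rule lim(1)) (use x in auto)
        show "uniform_limit {0..T} (\<lambda>m t. disc_bonds_path s0 \<mu> \<sigma> r T g (\<lambda>m k. X m k \<omega>) m (grid_index m t))
            (BS_bonds \<Omega>' W s0 \<mu> \<sigma> r T g (\<lambda>t. B t \<omega>)) sequentially"
          by (rule lim(2)) (use x in auto)
      qed
    qed
  qed
qed

end
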